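(* In the transient case, the self-adjoint operator $W$ acting on $L^2(\mu)$, $Wf(\eta)=\int_{\partial_\infty}U_{\eta\xi}f(\xi)\,\mu(d\xi)$, is a stochastic integral operator (a filtered operator); that is, there exist a filtration $\mathcal F=(\mathcal F_n:n\in\mathbb N)$ on $\partial_\infty$ and an $\mathcal F$-predictable process $G=(G_n:n\in\mathbb N)$ such that $$W=\sum_{n\in\mathbb N}G_n\big(\mathbb E_\mu(\,\cdot\,|\mathcal F_n)-\mathbb E_\mu(\,\cdot\,|\mathcal F_{n-1})\big)$$ as operators on $L^2(\mu)$.
   Context: Tree and matrix. $(I,\mathcal T)$ is a connected, locally finite, non-oriented tree with countably infinite set of sites $I$ and root $r$, every branch being infinite (each site has at least one successor). $|i|$ is the distance from $i$ to $r$; $i^-$ ($i\ne r$) is the neighbour of $i$ closer to $r$; $S_i=\{j:j^-=i\}$; $i\wedge j$ is the common vertex, farthest from $r$, of the geodesics from $r$ to $i$ and to $j$. $w:\mathbb N=\{0,1,\dots\}\to(0,\infty)$ is strictly increasing, $w_{-1}=0$. $U_{ij}=w_{|i\wedge j|}$. The matrix $Q$ is: $Q_{ii^-}=Q_{i^-i}=(w_{|i|}-w_{|i|-1})^{-1}$ for $i\neq r$, $Q_{ii}=-\big((w_{|i|}-w_{|i|-1})^{-1}+|S_i|(w_{|i|+1}-w_{|i|})^{-1}\big)$, and $0$ otherwise. Boundary. $\partial_\infty$ is the set of infinite geodesic rays $\xi=(\xi(n))_{n\ge0}$ with $\xi(0)=r$, $\xi(n+1)\in S_{\xi(n)}$,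 with the compact topology generated by the sets $\partial_\infty(i)=\{\xi:\xi(|i|)=i\}$, $i\in I$. For $\xi\ne\eta$ in $\partial_\infty$, $|\xi\wedge\eta|=\max\{n:\xi(n)=\eta(n)\}$, $U_{\xi\eta}=w_{|\xi\wedge\eta|}$ and $U_{\xi\xi}=\lim_n w_n\in(0,\infty]$. Process. $X$ is the minimal continuous-time Markov chain on $I$ with $q$-matrix $Q$, absorbed from $r$ at rate $1/w_0$ in an extra state $\partial_r$; $\zeta$ is its lifetime (the minimum of the absorption time and the explosion time, possibly $\infty$). $X_\zeta=\partial_r$ if absorption occurs, and otherwise $X_\zeta\in\partial_\infty$ is the almost surely existing limit of $X_t$ as $t\uparrow\zeta$. The transient case is $\mathbb P_r\{X_\zeta\in\partial_\infty\}>0$, and then $\mu(\cdot)=\mathbb P_r\{X_\zeta\in\cdot\mid X_\zeta\in\partial_\infty\}$, a probability measure on $\partial_\infty$. Conventions. $\mathbb E_\mu(\,\cdot\,|\mathcal F_{-1})=0$. Predictable means that (up to $\mu$-null sets) $G_n$ is $\mathcal F_{n-1}$-measurable for $n\ge1$ and $G_0$ is constant. The series of operators is understood in the strong sense on $L^2(\mu)$. *)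

theory Defs
  imports "HOL-Probability.Probability"
begin

section \<open>Rooted trees\<close>

text \<open>The set of sites is the whole type \<open>'v\<close>; the tree is given by its adjacency relation.\<close>

definition is_cycle :: "('v \<Rightarrow> 'v \<Rightarrow> bool) \<Rightarrow> 'v list \<Rightarrow> bool" where
  "is_cycle adj p \<longleftrightarrow>
     3 \<le> length p \<and> distinct p \<and> successively adj p \<and> adj (last p) (hd p)"

definition is_tree :: "('v \<Rightarrow> 'v \<Rightarrow> bool) \<Rightarrow> bool" where
  "is_tree adj \<longleftrightarrow> symp adj \<and> irreflp adj \<and> (\<forall>i j. adj\<^sup>*\<^sup>* i j) \<and> (\<nexists>p. is_cycle adj p)"

definition level :: "('v \<Rightarrow> 'v \<Rightarrow> bool) \<Rightarrow> 'v \<Rightarrow> 'v \<Rightarrow> nat" where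
  "level adj r i = (LEAST n. (adj ^^ n) r i)"

definition geodesic :: "('v \<Rightarrow> 'v \<Rightarrow> bool) \<Rightarrow> 'v \<Rightarrow> 'v \<Rightarrow> 'v list" where
  "geodesic adj r i =
     (THE p. length p = Suc (level adj r i) \<and> hd p = r \<and> last p = i \<and> successively adj p)"

definition parent :: "('v \<Rightarrow> 'v \<Rightarrow> bool) \<Rightarrow> 'v \<Rightarrow> 'v \<Rightarrow> 'v" where
  "parent adj r i = (THE j. adj i j \<and> level adj r j < level adj r i)"

definition successors :: "('v \<Rightarrow> 'v \<Rightarrow> bool) \<Rightarrow> 'v \<Rightarrow> 'v \<Rightarrow> 'v set" where
  "successors adj r i = {j. j \<noteq> r \<and> parent adj r j = i}"

definition infinite_rooted_tree :: "('v \<Rightarrow> 'v \<Rightarrow> bool) \<Rightarrow> 'v \<Rightarrow> bool" where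
  "infinite_rooted_tree adj r \<longleftrightarrow>
     is_tree adj \<and> countable (UNIV :: 'v set) \<and> infinite (UNIV :: 'v set) \<and>
     (\<forall>i. finite {j. adj i j}) \<and> (\<forall>i. successors adj r i \<noteq> {})"


section \<open>The boundary\<close>

definition rays :: "('v \<Rightarrow> 'v \<Rightarrow> bool) \<Rightarrow> 'v \<Rightarrow> (nat \<Rightarrow> 'v) set" where
  "rays adj r = {\<xi>. \<xi> 0 = r \<and> (\<forall>n. \<xi> (Suc n) \<in> successors adj r (\<xi> n))}"

definition rays_through :: "('v \<Rightarrow> 'v \<Rightarrow> bool) \<Rightarrow> 'v \<Rightarrow> 'v \<Rightarrow> (nat \<Rightarrow> 'v) set" where
  "rays_through adj r i = {\<xi> \<in> rays adj r. \<xi> (level adj r i) = i}"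

definition boundary_topology :: "('v \<Rightarrow> 'v \<Rightarrow> bool) \<Rightarrow> 'v \<Rightarrow> (nat \<Rightarrow> 'v) topology" where
  "boundary_topology adj r = topology_generated_by (range (rays_through adj r))"

definition boundary_borel :: "('v \<Rightarrow> 'v \<Rightarrow> bool) \<Rightarrow> 'v \<Rightarrow> (nat \<Rightarrow> 'v) measure" where
  "boundary_borel adj r = sigma (rays adj r) {A. openin (boundary_topology adj r) A}"

text \<open>The extended ultrametric matrix; its diagonal may be infinite.\<close>

definition U_boundary :: "(nat \<Rightarrow> real) \<Rightarrow> (nat \<Rightarrow> 'v) \<Rightarrow> (nat \<Rightarrow> 'v) \<Rightarrow> ennreal" where
  "U_boundary w \<xi> \<eta> =
     (if \<xi> = \<eta> then lim (\<lambda>n. ennreal (w n)) else ennreal (w (Max {n. \<xi> n = \<eta> n})))"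


section \<open>The \<open>q\<close>-matrix\<close>

text \<open>The difference \<open>w n - w (n - 1)\<close> with the convention \<open>w (-1) = 0\<close>.\<close>

definition increment :: "(nat \<Rightarrow> real) \<Rightarrow> nat \<Rightarrow> real" where
  "increment w n = w n - (if n = 0 then 0 else w (n - 1))"

definition Q_matrix :: "('v \<Rightarrow> 'v \<Rightarrow> bool) \<Rightarrow> 'v \<Rightarrow> (nat \<Rightarrow> real) \<Rightarrow> 'v \<Rightarrow> 'v \<Rightarrow> real" where
  "Q_matrix adj r w i j =
     (if i = j then
        - (1 / increment w (level adj r i)
           + real (card (successors adj r i)) / increment w (Suc (level adj r i)))
      else if i \<noteq> r \<and> j = parent adj r i then 1 / increment w (level adj r i)
      else if j \<noteq> r \<and> i = parent adj r j then 1 / increment w (level adj r j)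
      else 0)"

text \<open>\<open>Absorbed\<close> is the extra state \<open>\<partial>\<^sub>r\<close>.\<close>

datatype 'v state = Site 'v | Absorbed

fun Q_absorbed ::
  "('v \<Rightarrow> 'v \<Rightarrow> bool) \<Rightarrow> 'v \<Rightarrow> (nat \<Rightarrow> real) \<Rightarrow> 'v state \<Rightarrow> 'v state \<Rightarrow> real" where
  "Q_absorbed adj r w (Site i) (Site j) = Q_matrix adj r w i j"
| "Q_absorbed adj r w (Site i) Absorbed = (if i = r then 1 / w 0 else 0)"
| "Q_absorbed adj r w Absorbed _ = 0"


section \<open>Minimal continuous-time Markov chains\<close>

definition jump_prob :: "('s \<Rightarrow> 's \<Rightarrow> real) \<Rightarrow> 's \<Rightarrow> 's \<Rightarrow> real" where
  "jump_prob q s t =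
     (if q s s = 0 then of_bool (s = t) else if s = t then 0 else - q s t / q s s)"

text \<open>
  Law of the jump chain \<open>Y\<close> and the holding times \<open>H\<close> of the chain started from \<open>x\<close>: \<open>Y\<close> is
  Markov with transition matrix \<^term>\<open>jump_prob q\<close> and, given \<open>Y\<close>, the \<open>H k\<close> are independent and
  exponential with parameter \<open>- q (Y k) (Y k)\<close>. An exponential time with parameter \<open>0\<close> (absorbing
  state) is a.s. infinite, which is why holding times are extended reals; they are a.s. positive,
  and a version positive everywhere is taken. The joint law is given by
  its values on a generating intersection-stable family.
\<close>

definition jump_hold_law ::
  "'w measure \<Rightarrow> ('s \<Rightarrow> 's \<Rightarrow> real) \<Rightarrow> 's \<Rightarrow> (nat \<Rightarrow> 'w \<Rightarrow> 's) \<Rightarrow> (nat \<Rightarrow> 'w \<Rightarrow> ennreal) \<Rightarrow> bool" where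
  "jump_hold_law M q x Y H \<longleftrightarrow>
     (\<forall>k. Y k \<in> measurable M (count_space UNIV)) \<and>
     (\<forall>k. H k \<in> borel_measurable M) \<and>
     (\<forall>k. \<forall>\<omega>\<in>space M. 0 < H k \<omega>) \<and>
     (\<forall>n (i :: nat \<Rightarrow> 's) (s :: nat \<Rightarrow> real). (\<forall>k\<le>n. 0 \<le> s k) \<longrightarrow>
        measure M {\<omega> \<in> space M. \<forall>k\<le>n. Y k \<omega> = i k \<and> ennreal (s k) < H k \<omega>} =
          of_bool (i 0 = x) * (\<Prod>k<n. jump_prob q (i k) (i (Suc k)))
            * (\<Prod>k\<le>n. exp (q (i k) (i k) * s k)))"

definition jump_time :: "(nat \<Rightarrow> 'w \<Rightarrow> ennreal) \<Rightarrow> nat \<Rightarrow> 'w \<Rightarrow> ennreal" where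
  "jump_time H n \<omega> = (\<Sum>k<n. H k \<omega>)"

text \<open>
  The minimal process: it sits at \<open>Y n\<close> during the \<open>n\<close>-th holding interval and is \<open>None\<close>
  from the explosion time on (in particular at \<open>t = \<infinity>\<close>).
\<close>

definition jump_hold_path ::
  "(nat \<Rightarrow> 'w \<Rightarrow> 's) \<Rightarrow> (nat \<Rightarrow> 'w \<Rightarrow> ennreal) \<Rightarrow> ennreal \<Rightarrow> 'w \<Rightarrow> 's option" where
  "jump_hold_path Y H t \<omega> =
     (if \<exists>n. jump_time H n \<omega> \<le> t \<and> t < jump_time H (Suc n) \<omega>
      then Some (Y (THE n. jump_time H n \<omega> \<le> t \<and> t < jump_time H (Suc n) \<omega>) \<omega>)
      else None)"

definition minimal_chain ::
  "'w measure \<Rightarrow> ('s \<Rightarrow> 's \<Rightarrow> real) \<Rightarrow> 's \<Rightarrow> (ennreal \<Rightarrow> 'w \<Rightarrow> 's option) \<Rightarrow> bool" where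
  "minimal_chain M q x X \<longleftrightarrow>
     prob_space M \<and>
     (\<exists>Y H. jump_hold_law M q x Y H \<and> (\<forall>t. \<forall>\<omega>\<in>space M. X t \<omega> = jump_hold_path Y H t \<omega>))"


section \<open>Lifetime, exit point and exit distribution\<close>

definition absorption_time :: "(ennreal \<Rightarrow> 'w \<Rightarrow> 'v state option) \<Rightarrow> 'w \<Rightarrow> ennreal" where
  "absorption_time X \<omega> = Inf {t. X t \<omega> = Some Absorbed}"

definition explosion_time :: "(ennreal \<Rightarrow> 'w \<Rightarrow> 'v state option) \<Rightarrow> 'w \<Rightarrow> ennreal" where
  "explosion_time X \<omega> = Inf {t. X t \<omega> = None}"

definition lifetime :: "(ennreal \<Rightarrow> 'w \<Rightarrow> 'v state option) \<Rightarrow> 'w \<Rightarrow> ennreal" where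
  "lifetime X \<omega> = min (absorption_time X \<omega>) (explosion_time X \<omega>)"

text \<open>
  \<open>X\<^sub>t \<rightarrow> \<xi>\<close> as \<open>t \<up> \<zeta>\<close> in the end compactification of the tree: a neighbourhood basis of the ray
  \<open>\<xi>\<close> is formed by the branches hanging from the sites \<open>\<xi> n\<close>, and a site \<open>j\<close> is in that branch iff
  \<open>\<xi> n\<close> lies on the geodesic from the root to \<open>j\<close>.
\<close>

definition tends_to_ray ::
  "('v \<Rightarrow> 'v \<Rightarrow> bool) \<Rightarrow> 'v \<Rightarrow> (ennreal \<Rightarrow> 'w \<Rightarrow> 'v state option) \<Rightarrow> 'w \<Rightarrow> (nat \<Rightarrow> 'v) \<Rightarrow> bool" where
  "tends_to_ray adj r X \<omega> \<xi> \<longleftrightarrow>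
     \<xi> \<in> rays adj r \<and>
     (\<forall>n. \<forall>\<^sub>F t in at_left (lifetime X \<omega>).
        \<exists>j. X t \<omega> = Some (Site j) \<and> \<xi> n \<in> set (geodesic adj r j))"

text \<open>The event that the exit point \<open>X\<^sub>\<zeta>\<close> belongs to the boundary, and its value there.\<close>

definition boundary_exit ::
  "('v \<Rightarrow> 'v \<Rightarrow> bool) \<Rightarrow> 'v \<Rightarrow> 'w measure \<Rightarrow> (ennreal \<Rightarrow> 'w \<Rightarrow> 'v state option) \<Rightarrow> 'w set" where
  "boundary_exit adj r M X =
     {\<omega> \<in> space M. (\<forall>t. X t \<omega> \<noteq> Some Absorbed) \<and> (\<exists>\<xi>. tends_to_ray adj r X \<omega> \<xi>)}"

definition exit_ray ::
  "('v \<Rightarrow> 'v \<Rightarrow> bool) \<Rightarrow> 'v \<Rightarrow> (ennreal \<Rightarrow> 'w \<Rightarrow> 'v state option) \<Rightarrow> 'w \<Rightarrow> (nat \<Rightarrow> 'v)" where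
  "exit_ray adj r X \<omega> = (THE \<xi>. tends_to_ray adj r X \<omega> \<xi>)"

text \<open>
  Law of the exit point conditioned on exit through the boundary. The restriction only serves to
  make \<open>exit_ray\<close> a map into \<open>rays adj r\<close>; \<^const>\<open>uniform_measure\<close> is conditioning on an event.
\<close>

definition exit_distribution ::
  "('v \<Rightarrow> 'v \<Rightarrow> bool) \<Rightarrow> 'v \<Rightarrow> 'w measure \<Rightarrow> (ennreal \<Rightarrow> 'w \<Rightarrow> 'v state option)
     \<Rightarrow> (nat \<Rightarrow> 'v) measure" where
  "exit_distribution adj r M X =
     (let E = boundary_exit adj r M X
      in distr (uniform_measure (restrict_space M E) E) (boundary_borel adj r) (exit_ray adj r X))"


section \<open>Operators on \<open>L\<^sup>2\<close>\<close>

text \<open>Elements of (real) \<open>L\<^sup>2(\<mu>)\<close> are represented by functions, identified up to \<open>\<mu>\<close>-null sets.\<close>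

definition L2 :: "'a measure \<Rightarrow> ('a \<Rightarrow> real) set" where
  "L2 \<mu> = {f \<in> borel_measurable \<mu>. integrable \<mu> (\<lambda>x. (f x)\<^sup>2)}"

definition L2_operator :: "'a measure \<Rightarrow> (('a \<Rightarrow> real) \<Rightarrow> 'a \<Rightarrow> real) \<Rightarrow> bool" where
  "L2_operator \<mu> T \<longleftrightarrow>
     (\<forall>f\<in>L2 \<mu>. T f \<in> L2 \<mu>) \<and>
     (\<forall>f\<in>L2 \<mu>. \<forall>g\<in>L2 \<mu>. (AE x in \<mu>. f x = g x) \<longrightarrow> (AE x in \<mu>. T f x = T g x)) \<and>
     (\<forall>f\<in>L2 \<mu>. \<forall>g\<in>L2 \<mu>. \<forall>a b. AE x in \<mu>. T (\<lambda>y. a * f y + b * g y) x = a * T f x + b * T g x)"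

text \<open>For everywhere defined operators, self-adjointness is symmetry (Hellinger-Toeplitz).\<close>

definition self_adjoint_L2 :: "'a measure \<Rightarrow> (('a \<Rightarrow> real) \<Rightarrow> 'a \<Rightarrow> real) \<Rightarrow> bool" where
  "self_adjoint_L2 \<mu> T \<longleftrightarrow>
     L2_operator \<mu> T \<and>
     (\<forall>f\<in>L2 \<mu>. \<forall>g\<in>L2 \<mu>. (\<integral>x. T f x * g x \<partial>\<mu>) = (\<integral>x. f x * T g x \<partial>\<mu>))"

definition predictable :: "'a measure \<Rightarrow> (nat \<Rightarrow> 'a measure) \<Rightarrow> (nat \<Rightarrow> 'a \<Rightarrow> real) \<Rightarrow> bool" where
  "predictable \<mu> F G \<longleftrightarrow>
     (\<forall>n. G n \<in> borel_measurable \<mu>) \<and>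
     (\<exists>c. AE x in \<mu>. G 0 x = c) \<and>
     (\<forall>n. \<exists>g \<in> borel_measurable (F n). AE x in \<mu>. G (Suc n) x = g x)"

text \<open>\<open>E(f | F n) - E(f | F (n - 1))\<close> with the convention \<open>E(f | F (-1)) = 0\<close>.\<close>

definition cond_exp_diff ::
  "'a measure \<Rightarrow> (nat \<Rightarrow> 'a measure) \<Rightarrow> nat \<Rightarrow> ('a \<Rightarrow> real) \<Rightarrow> 'a \<Rightarrow> real" where
  "cond_exp_diff \<mu> F n f x =
     real_cond_exp \<mu> (F n) f x - (if n = 0 then 0 else real_cond_exp \<mu> (F (n - 1)) f x)"

definition stochastic_integral_operator ::
  "'a measure \<Rightarrow> (('a \<Rightarrow> real) \<Rightarrow> 'a \<Rightarrow> real) \<Rightarrow> bool" where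
  "stochastic_integral_operator \<mu> T \<longleftrightarrow>
     (\<exists>F G. filtration (space \<mu>) F \<and> (\<forall>n. subalgebra \<mu> (F n)) \<and> predictable \<mu> F G \<and>
       (\<forall>f\<in>L2 \<mu>. T f \<in> L2 \<mu> \<and> (\<forall>n. (\<lambda>x. G n x * cond_exp_diff \<mu> F n f x) \<in> L2 \<mu>) \<and>
         (\<lambda>N. \<integral>\<^sup>+x. ennreal ((T f x - (\<Sum>n<N. G n x * cond_exp_diff \<mu> F n f x))\<^sup>2) \<partial>\<mu>)
           \<longlonglongrightarrow> 0))"

text \<open>
  The integral of the possibly infinite \<open>U \<eta> \<xi> * f \<xi>\<close>, as the difference of the integrals of its
  positive and negative parts. It is a genuine integral only where \<open>\<integral>\<^sup>+\<xi>. U \<eta> \<xi> * \<bar>f \<xi>\<bar> \<partial>\<mu> < \<infinity>\<close>.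
\<close>

definition W_operator ::
  "(nat \<Rightarrow> real) \<Rightarrow> (nat \<Rightarrow> 'v) measure \<Rightarrow> ((nat \<Rightarrow> 'v) \<Rightarrow> real) \<Rightarrow> (nat \<Rightarrow> 'v) \<Rightarrow> real" where
  "W_operator w \<mu> f \<eta> =
     enn2real (\<integral>\<^sup>+\<xi>. U_boundary w \<eta> \<xi> * ennreal (f \<xi>) \<partial>\<mu>)
     - enn2real (\<integral>\<^sup>+\<xi>. U_boundary w \<eta> \<xi> * ennreal (- f \<xi>) \<partial>\<mu>)"

end

theory Submission
  imports Defs
begin

text \<open>
  On rays, \<open>U \<xi> \<eta> = (\<Sum>n. \<delta> n * [\<xi> n = \<eta> n])\<close> with \<open>\<delta> n = w n - w (n - 1)\<close>. With \<open>F n\<close> generated by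
  \<open>\<xi> \<mapsto> \<xi> n\<close> and \<open>\<mu> n \<xi>\<close> the mass of the rays through \<open>\<xi> n\<close>, this gives
  \<open>W f = (\<Sum>n. \<delta> n * \<mu> n * E(f | F n))\<close>, and summation by parts turns it into the required form with
  \<open>G n = c - (\<Sum>k<n. \<delta> k * \<mu> k)\<close>, provided that \<open>(\<Sum>n. \<delta> n * \<mu> n) = c\<close> is a.e. constant; then
  Schur's test also bounds \<open>W\<close>.

  The constancy is where the chain enters. Let \<open>V\<close> be its Green potential (expected number of visits
  over the rate) and \<open>e i\<close> the probability of exit through the branch at \<open>i\<close>. Counting crossings of
  the edge above \<open>i\<close> gives \<open>V (par i) - V i = \<delta> |i| * e i\<close>, so that the partial sums of \<open>\<delta> n * e (\<xi> n)\<close>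
  telescope to \<open>w 0 - V (\<xi> n)\<close>, and one needs \<open>V \<rightarrow> 0\<close> along \<open>\<mu>\<close>-almost every ray. As \<open>V\<close> decreases
  along rays, it suffices that \<open>(\<Sum>|i| = m. V i * e i) \<rightarrow> 0\<close>, which follows from the nonnegativity of the
  Dirichlet energy of \<open>V - V m\<close>, where \<open>V m\<close> is the Green potential of the first \<open>m\<close> steps.
\<close>

text \<open>The constant is \<open>c = w 0 / e r\<close>: conditioning on exit through the boundary
  gives the branch at \<open>i\<close> the mass \<open>e i / e r\<close>, and the telescoped sums
  tend to \<open>w 0\<close> once \<open>V\<close> vanishes in the limit. The energy argument closes
  because \<open>e\<close> is a flow without sources and \<open>V m\<close> is zero on the sphere of
  radius \<open>m\<close>: up to level \<open>m\<close>, the mixed energy of \<open>V\<close> and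
  \<open>V m\<close> is exactly \<open>w 0 * e r\<close>, and that of \<open>V m\<close> is at most
  \<open>w 0\<close> times the probability of no absorption within \<open>m\<close> steps. Expanding
  the square bounds the sum of \<open>V i * e i\<close> over the sphere by \<open>w 0\<close> times
  the excess of that probability over \<open>e r\<close>, its limit. On the operator side,
  \<open>U\<close> is infinite on the diagonal when \<open>w\<close> is unbounded, so
  \<open>W f\<close> is controlled only a.e. and through partial sums dominated by the kernel
  applied to \<open>\<bar>f\<bar>\<close>. Summation by parts leaves the remainder
  \<open>G N * E(f | F (N - 1))\<close>. As \<open>G N\<close> is predictable, its norm is at most
  that of \<open>G N * f\<close>, to which dominated convergence applies directly.\<close>

lemma L2_cong:
  assumes "\<And>x. x \<in> space \<mu> \<Longrightarrow> f x = g x"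
  shows "f \<in> L2 \<mu> \<longleftrightarrow> g \<in> L2 \<mu>"
proof -
  have "f \<in> borel_measurable \<mu> \<longleftrightarrow> g \<in> borel_measurable \<mu>"
    using assms by (rule measurable_cong)
  moreover have "integrable \<mu> (\<lambda>x. (f x)\<^sup>2) \<longleftrightarrow> integrable \<mu> (\<lambda>x. (g x)\<^sup>2)"
    using assms by (intro Bochner_Integration.integrable_cong) simp_all
  ultimately show ?thesis by (simp add: L2_def)
qed

text \<open>\<open>W_operator\<close> is matched with the kernel operator only at rays, where the
  series for \<open>U_boundary\<close> is proved; this lemma and
  \<open>stochastic_integral_operator_cong\<close> transfer the two properties.\<close>

lemma self_adjoint_L2_cong:
  assumes T: "self_adjoint_L2 \<mu> T" and eq: "\<And>x f. x \<in> space \<mu> \<Longrightarrow> S f x = T f x"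
  shows "self_adjoint_L2 \<mu> S"
proof -
  have 1: "S f \<in> L2 \<mu> \<longleftrightarrow> T f \<in> L2 \<mu>" for f by (rule L2_cong) (rule eq)
  have 2: "(AE x in \<mu>. S f x = S g x) \<longleftrightarrow> (AE x in \<mu>. T f x = T g x)" for f g
    by (rule AE_cong) (simp add: eq)
  have 3: "(AE x in \<mu>. S h x = a * S f x + b * S g x) \<longleftrightarrow> (AE x in \<mu>. T h x = a * T f x + b * T g x)" for f g h a b
    by (rule AE_cong) (simp add: eq)
  have 4: "(\<integral>x. S f x * g x \<partial>\<mu>) = (\<integral>x. T f x * g x \<partial>\<mu>)" "(\<integral>x. g x * S f x \<partial>\<mu>) = (\<integral>x. g x * T f x \<partial>\<mu>)" for f g
    by (rule Bochner_Integration.integral_cong[OF refl], simp add: eq)+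
  show ?thesis
    using T unfolding self_adjoint_L2_def L2_operator_def 1 2 3 4 .
qed

lemma stochastic_integral_operator_cong:
  assumes T: "stochastic_integral_operator \<mu> T" and eq: "\<And>x f. x \<in> space \<mu> \<Longrightarrow> S f x = T f x"
  shows "stochastic_integral_operator \<mu> S"
proof -
  have 1: "S f \<in> L2 \<mu> \<longleftrightarrow> T f \<in> L2 \<mu>" for f by (rule L2_cong) (rule eq)
  have 2: "(\<integral>\<^sup>+x. ennreal ((S f x - h x)\<^sup>2) \<partial>\<mu>) = (\<integral>\<^sup>+x. ennreal ((T f x - h x)\<^sup>2) \<partial>\<mu>)" for f h
    by (rule nn_integral_cong) (simp add: eq)
  show ?thesis
    using T unfolding stochastic_integral_operator_def 1 2 .
qed


section \<open>Ultrametric kernels of refining partitions\<close>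

text \<open>In the application \<open>x n\<close> is the \<open>n\<close>-th vertex of a ray and
  \<open>d\<close> the increments of \<open>w\<close>. By \<open>refine\<close> the fibres of
  \<open>x (Suc n)\<close> subdivide those of \<open>x n\<close>; \<open>total\<close> is the
  constancy of the row integrals, the assumption whose proof needs the potential theory of the
  chain.\<close>

locale filtered_kernel = prob_space \<mu> for \<mu> :: "'a measure" +
  fixes x :: "nat \<Rightarrow> 'a \<Rightarrow> 'b" and d :: "nat \<Rightarrow> real" and c :: real
  assumes x_measurable [measurable]: "\<And>n. x n \<in> measurable \<mu> (count_space UNIV)"
    and finite_range: "\<And>n. finite (x n ` space \<mu>)"
    and refine: "\<And>n a b. a \<in> space \<mu> \<Longrightarrow> b \<in> space \<mu> \<Longrightarrow> x (Suc n) a = x (Suc n) b \<Longrightarrow> x n a = x n b"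
    and d_nonneg: "\<And>n. 0 \<le> d n"
    and total: "AE a in \<mu>. (\<lambda>n. d n * measure \<mu> {b \<in> space \<mu>. x n b = x n a}) sums c"
begin

definition atom :: "nat \<Rightarrow> 'b \<Rightarrow> 'a set" where
  "atom n v = {b \<in> space \<mu>. x n b = v}"

text \<open>Extended-valued, because the diagonal value is the sum of all \<open>d n\<close>,
  possibly infinite.\<close>

definition kern :: "'a \<Rightarrow> 'a \<Rightarrow> ennreal" where
  "kern a b = (\<Sum>n. ennreal (d n) * indicator (atom n (x n a)) b)"

text \<open>Written like \<open>W_operator\<close>, so that the two coincide as soon as the kernels
  do.\<close>

definition oper :: "('a \<Rightarrow> real) \<Rightarrow> 'a \<Rightarrow> real" where
  "oper f a = enn2real (\<integral>\<^sup>+b. kern a b * ennreal (f b) \<partial>\<mu>) - enn2real (\<integral>\<^sup>+b. kern a b * ennreal (- f b) \<partial>\<mu>)"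

definition atom_int :: "nat \<Rightarrow> ('a \<Rightarrow> real) \<Rightarrow> 'a \<Rightarrow> real" where
  "atom_int n f a = (\<integral>b. indicator (atom n (x n a)) b * f b \<partial>\<mu>)"

definition mass :: "nat \<Rightarrow> 'a \<Rightarrow> real" where
  "mass n a = measure \<mu> (atom n (x n a))"

definition part :: "nat \<Rightarrow> ('a \<Rightarrow> real) \<Rightarrow> 'a \<Rightarrow> real" where
  "part N f a = (\<Sum>n<N. d n * atom_int n f a)"

definition filt :: "nat \<Rightarrow> 'a measure" where
  "filt n = vimage_algebra (space \<mu>) (x n) (count_space UNIV)"

text \<open>The tail of the series in \<open>total\<close>. The strict bound \<open>k<n\<close>
  makes \<open>weight n\<close> depend on levels below \<open>n\<close> only, hence predictable, and
  \<open>weight 0\<close> the constant \<open>c\<close>.\<close>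

definition weight :: "nat \<Rightarrow> 'a \<Rightarrow> real" where
  "weight n a = c - (\<Sum>k<n. d k * mass k a)"

section \<open>The filtration and its predictable weights\<close>

lemma atom_sets [measurable]: "atom n v \<in> sets \<mu>"
  unfolding atom_def by measurable

lemma x_filt: "x n \<in> measurable (filt n) (count_space UNIV)"
  unfolding filt_def by (rule measurable_vimage_algebra1) auto

lemma space_filt [simp]: "space (filt n) = space \<mu>"
  by (simp add: filt_def)

lemma sets_filt: "sets (filt n) = {x n -` A \<inter> space \<mu> | A. True}"
  unfolding filt_def by (subst sets_vimage_algebra2) auto

lemma subalgebra_filt: "subalgebra \<mu> (filt n)"
  unfolding subalgebra_def sets_filt using measurable_sets[OF x_measurable] by auto

text \<open>By \<open>refine\<close>, a union of fibres of \<open>x n\<close> contains with each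
  point its whole fibre under \<open>x (Suc n)\<close>.\<close>

lemma sets_filt_Suc: "sets (filt n) \<subseteq> sets (filt (Suc n))"
proof
  fix S assume "S \<in> sets (filt n)"
  then obtain A where S: "S = x n -` A \<inter> space \<mu>" unfolding sets_filt by auto
  have "S = x (Suc n) -` (x (Suc n) ` S) \<inter> space \<mu>"
    using refine unfolding S by auto
  then show "S \<in> sets (filt (Suc n))" unfolding sets_filt by blast
qed

lemma sets_filt_mono: "m \<le> n \<Longrightarrow> sets (filt m) \<subseteq> sets (filt n)"
  using lift_Suc_mono_le[of "\<lambda>n. sets (filt n)"] sets_filt_Suc by blast

lemma filtration_filt: "filtration (space \<mu>) filt"
  by unfold_locales (auto dest: sets_filt_mono)

lemma function_of_x_measurable:
  "(\<lambda>a. h (x n a)) \<in> borel_measurable (filt n)" "(\<lambda>a. h (x n a)) \<in> borel_measurable \<mu>"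
  by (auto intro: measurable_compose[OF x_filt] measurable_compose[OF x_measurable])

lemma mass_filt: "mass n \<in> borel_measurable (filt n)"
  and mass_measurable [measurable]: "mass n \<in> borel_measurable \<mu>"
  unfolding mass_def by (rule function_of_x_measurable)+

lemma atom_int_measurable [measurable]: "atom_int n f \<in> borel_measurable \<mu>"
  unfolding atom_int_def by (rule function_of_x_measurable)

lemma part_measurable [measurable]: "part N f \<in> borel_measurable \<mu>"
  unfolding part_def by measurable

lemma weight_measurable [measurable]: "weight n \<in> borel_measurable \<mu>"
  unfolding weight_def by measurable

lemma weight_Suc_filt: "weight (Suc n) \<in> borel_measurable (filt n)"
proof -
  have "mass k \<in> borel_measurable (filt n)" if "k \<le> n" for k
    using mass_filt[of k] sets_filt_mono[OF that] by (auto simp: measurable_def)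
  then show ?thesis unfolding weight_def
    by (auto intro!: borel_measurable_diff borel_measurable_sum borel_measurable_times)
qed

lemma mass_nonneg: "0 \<le> mass n a" by (simp add: mass_def)

lemma weight_bounds: "AE a in \<mu>. (\<forall>n. 0 \<le> weight n a \<and> weight n a \<le> c) \<and> (\<lambda>n. weight n a) \<longlonglongrightarrow> 0"
  using total
proof eventually_elim
  case (elim a)
  then have s: "(\<lambda>n. d n * mass n a) sums c" by (simp add: mass_def atom_def)
  have "(\<lambda>n. weight n a) \<longlonglongrightarrow> c - c"
    unfolding weight_def using s by (intro tendsto_intros) (simp add: sums_def)
  moreover have "(\<Sum>k<n. d k * mass k a) \<le> c" for n
    using s d_nonneg mass_nonneg sum_le_suminf[of "\<lambda>n. d n * mass n a" "{..<n}"]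
    by (auto simp: sums_iff)
  ultimately show ?case
    by (auto simp: weight_def intro!: sum_nonneg mult_nonneg_nonneg d_nonneg mass_nonneg)
qed

lemma c_nonneg: "0 \<le> c"
proof -
  have "AE a in \<mu>. 0 \<le> c" using weight_bounds by eventually_elim (auto intro: order_trans)
  then show ?thesis by simp
qed

section \<open>Symmetry and row integrals of the kernel\<close>

lemma indicator_atom_sum:
  "a \<in> space \<mu> \<Longrightarrow> indicator (atom n (x n a)) b =
    (\<Sum>v\<in>x n ` space \<mu>. indicator (atom n v) a * indicator (atom n v) b :: 'c::semiring_1)"
  using finite_range[of n]
  by (subst sum.mono_neutral_right[of _ "{x n a}"]) (auto simp: atom_def indicator_def)

lemma kern_measurable [measurable]: "kern a \<in> borel_measurable \<mu>"
  unfolding kern_def by measurable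

lemma nn_integral_kern:
  assumes [measurable]: "h \<in> borel_measurable \<mu>"
  shows "(\<integral>\<^sup>+b. kern a b * h b \<partial>\<mu>) = (\<Sum>n. ennreal (d n) * (\<integral>\<^sup>+b. indicator (atom n (x n a)) b * h b \<partial>\<mu>))"
proof -
  have "(\<integral>\<^sup>+b. kern a b * h b \<partial>\<mu>) = (\<integral>\<^sup>+b. (\<Sum>n. ennreal (d n) * (indicator (atom n (x n a)) b * h b)) \<partial>\<mu>)"
    unfolding kern_def by (simp add: ennreal_suminf_multc[symmetric] mult.assoc)
  then show ?thesis by (simp add: nn_integral_suminf nn_integral_cmult)
qed

lemma nn_integral_kern_measurable [measurable]:
  assumes [measurable]: "h \<in> borel_measurable \<mu>"
  shows "(\<lambda>a. \<integral>\<^sup>+b. kern a b * h b \<partial>\<mu>) \<in> borel_measurable \<mu>"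
proof -
  have [measurable]: "(\<lambda>a. \<integral>\<^sup>+b. indicator (atom n (x n a)) b * h b \<partial>\<mu>) \<in> borel_measurable \<mu>" for n
    by (rule function_of_x_measurable)
  show ?thesis by (simp add: nn_integral_kern)
qed

text \<open>Writing the indicator kernel as a finite sum of products separates the variables; the
  result is symmetric in \<open>g\<close> and \<open>h\<close>, and the symmetry of the whole kernel
  follows term by term.\<close>

lemma nn_integral_atom_swap:
  assumes [measurable]: "h \<in> borel_measurable \<mu>" "g \<in> borel_measurable \<mu>"
  shows "(\<integral>\<^sup>+a. g a * (\<integral>\<^sup>+b. indicator (atom n (x n a)) b * h b \<partial>\<mu>) \<partial>\<mu>)
    = (\<Sum>v\<in>x n ` space \<mu>. (\<integral>\<^sup>+a. indicator (atom n v) a * g a \<partial>\<mu>) * (\<integral>\<^sup>+b. indicator (atom n v) b * h b \<partial>\<mu>))"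
proof -
  have "(\<integral>\<^sup>+b. indicator (atom n (x n a)) b * h b \<partial>\<mu>)
      = (\<Sum>v\<in>x n ` space \<mu>. indicator (atom n v) a * (\<integral>\<^sup>+b. indicator (atom n v) b * h b \<partial>\<mu>))"
    if "a \<in> space \<mu>" for a
    by (simp add: indicator_atom_sum[OF that] sum_distrib_right mult.assoc nn_integral_sum nn_integral_cmult)
  then have "(\<integral>\<^sup>+a. g a * (\<integral>\<^sup>+b. indicator (atom n (x n a)) b * h b \<partial>\<mu>) \<partial>\<mu>)
    = (\<integral>\<^sup>+a. (\<Sum>v\<in>x n ` space \<mu>. (indicator (atom n v) a * g a) * (\<integral>\<^sup>+b. indicator (atom n v) b * h b \<partial>\<mu>)) \<partial>\<mu>)"
    by (intro nn_integral_cong) (simp add: sum_distrib_left mult_ac)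
  also have "\<dots> = (\<Sum>v\<in>x n ` space \<mu>. (\<integral>\<^sup>+a. indicator (atom n v) a * g a \<partial>\<mu>) * (\<integral>\<^sup>+b. indicator (atom n v) b * h b \<partial>\<mu>))"
    by (simp add: nn_integral_sum nn_integral_multc)
  finally show ?thesis .
qed

lemma nn_integral_kern_swap:
  assumes [measurable]: "h \<in> borel_measurable \<mu>" "g \<in> borel_measurable \<mu>"
  shows "(\<integral>\<^sup>+a. g a * (\<integral>\<^sup>+b. kern a b * h b \<partial>\<mu>) \<partial>\<mu>) = (\<integral>\<^sup>+b. h b * (\<integral>\<^sup>+a. kern b a * g a \<partial>\<mu>) \<partial>\<mu>)"
proof -
  have [measurable]: "(\<lambda>a. \<integral>\<^sup>+b. indicator (atom n (x n a)) b * h b \<partial>\<mu>) \<in> borel_measurable \<mu>"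
    for n and h :: "'a \<Rightarrow> ennreal"
    by (rule function_of_x_measurable)
  have *: "(\<integral>\<^sup>+a. g a * (\<integral>\<^sup>+b. kern a b * h b \<partial>\<mu>) \<partial>\<mu>)
    = (\<Sum>n. ennreal (d n) * (\<integral>\<^sup>+a. g a * (\<integral>\<^sup>+b. indicator (atom n (x n a)) b * h b \<partial>\<mu>) \<partial>\<mu>))"
    if [measurable]: "h \<in> borel_measurable \<mu>" "g \<in> borel_measurable \<mu>" for g h :: "'a \<Rightarrow> ennreal"
  proof -
    have "g a * (\<integral>\<^sup>+b. kern a b * h b \<partial>\<mu>)
        = (\<Sum>n. ennreal (d n) * (g a * (\<integral>\<^sup>+b. indicator (atom n (x n a)) b * h b \<partial>\<mu>)))" for a
      unfolding nn_integral_kern[OF that(1)] ennreal_suminf_cmult[symmetric]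
      by (intro suminf_cong) (rule mult.left_commute)
    then show ?thesis
      by (simp add: nn_integral_suminf nn_integral_cmult)
  qed
  show ?thesis
    unfolding *[OF assms] *[OF assms(2,1)] nn_integral_atom_swap[OF assms] nn_integral_atom_swap[OF assms(2,1)]
    by (intro suminf_cong) (simp add: mult.commute)
qed

text \<open>Here \<open>total\<close> becomes the row integral of Schur's test: the
  \<open>n\<close>-th term of the kernel integrates to \<open>d n\<close> times the mass of the atom
  of \<open>a\<close>.\<close>

lemma nn_integral_kern_one: "AE a in \<mu>. (\<integral>\<^sup>+b. kern a b \<partial>\<mu>) = ennreal c"
  using total
proof eventually_elim
  case (elim a)
  have "(\<integral>\<^sup>+b. kern a b \<partial>\<mu>) = (\<Sum>n. ennreal (d n * measure \<mu> {b \<in> space \<mu>. x n b = x n a}))"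
    using nn_integral_kern[of "\<lambda>_. 1" a]
    by (simp add: emeasure_eq_measure ennreal_mult d_nonneg atom_def)
  also have "\<dots> = ennreal c"
    using elim d_nonneg by (intro suminf_ennreal_eq) auto
  finally show ?case .
qed


subsection \<open>Boundedness on square integrable functions\<close>

lemma L2_D:
  assumes "f \<in> L2 \<mu>"
  shows "f \<in> borel_measurable \<mu>" "integrable \<mu> (\<lambda>a. (f a)\<^sup>2)" "integrable \<mu> f" "integrable \<mu> (\<lambda>a. \<bar>f a\<bar>)"
proof -
  show 1: "f \<in> borel_measurable \<mu>" "integrable \<mu> (\<lambda>a. (f a)\<^sup>2)"
    using assms by (simp_all add: L2_def)
  show 2: "integrable \<mu> f"
    by (rule square_integrable_imp_integrable[OF 1])
  show "integrable \<mu> (\<lambda>a. \<bar>f a\<bar>)"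
    by (rule integrable_abs[OF 2])
qed

lemma L2_bound:
  assumes z: "z \<in> L2 \<mu>" and [measurable]: "f \<in> borel_measurable \<mu>"
    and le: "AE a in \<mu>. \<bar>f a\<bar> \<le> \<bar>z a\<bar>"
  shows "f \<in> L2 \<mu>"
proof -
  have "integrable \<mu> (\<lambda>a. (f a)\<^sup>2)"
    by (rule Bochner_Integration.integrable_bound[OF L2_D(2)[OF z]])
      (use le in \<open>auto simp: abs_le_square_iff\<close>)
  then show ?thesis by (simp add: L2_def)
qed

lemma L2_mult_integrable:
  assumes "f \<in> L2 \<mu>" "g \<in> L2 \<mu>"
  shows "integrable \<mu> (\<lambda>a. f a * g a)"
proof -
  note [measurable] = L2_D(1)[OF assms(1)] L2_D(1)[OF assms(2)]
  have "\<bar>s * t\<bar> \<le> s\<^sup>2 + t\<^sup>2" for s t :: real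
    using sum_squares_bound[of "\<bar>s\<bar>" "\<bar>t\<bar>"] abs_ge_zero[of "s * t"] unfolding abs_mult power2_abs by linarith
  then show ?thesis
    using Bochner_Integration.integrable_bound[OF Bochner_Integration.integrable_add
        [OF L2_D(2)[OF assms(1)] L2_D(2)[OF assms(2)]], of "\<lambda>a. f a * g a"] by auto
qed

lemma L2_lincomb:
  assumes "f \<in> L2 \<mu>" "g \<in> L2 \<mu>"
  shows "(\<lambda>a. s * f a + t * g a) \<in> L2 \<mu>"
proof -
  note [measurable] = L2_D(1)[OF assms(1)] L2_D(1)[OF assms(2)]
  have "(\<lambda>a. (s * f a + t * g a)\<^sup>2) = (\<lambda>a. s\<^sup>2 * (f a)\<^sup>2 + t\<^sup>2 * (g a)\<^sup>2 + 2 * s * t * (f a * g a))"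
    by (auto simp: power2_eq_square algebra_simps)
  then show ?thesis
    using L2_D(2)[OF assms(1)] L2_D(2)[OF assms(2)] L2_mult_integrable[OF assms]
    by (simp add: L2_def)
qed

text \<open>A majorant of all partial sums, extended-valued until \<open>bound_finite\<close> shows
  that it is finite a.e.\<close>

definition bound :: "('a \<Rightarrow> real) \<Rightarrow> 'a \<Rightarrow> ennreal" where
  "bound f a = (\<integral>\<^sup>+b. kern a b * ennreal \<bar>f b\<bar> \<partial>\<mu>)"

lemma bound_measurable: "f \<in> borel_measurable \<mu> \<Longrightarrow> bound f \<in> borel_measurable \<mu>"
  unfolding bound_def by measurable

text \<open>Schur's test: the kernel is symmetric with row integrals \<open>c\<close>.\<close>

lemma bound_square:
  assumes "f \<in> L2 \<mu>"
  shows "(\<integral>\<^sup>+a. (bound f a)\<^sup>2 \<partial>\<mu>) < \<infinity>"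
proof -
  note [measurable] = L2_D(1)[OF assms]
  \<comment> \<open>Cauchy-Schwarz for the constant 1 and \<open>\<bar>f\<bar>\<close> under the
    measure with density \<open>kern a\<close>.\<close>
  have CS: "(bound f a)\<^sup>2 \<le> (\<integral>\<^sup>+b. kern a b \<partial>\<mu>) * (\<integral>\<^sup>+b. kern a b * ennreal ((f b)\<^sup>2) \<partial>\<mu>)" for a
    using Cauchy_Schwarz_nn_integral[of "\<lambda>_. 1" "density \<mu> (kern a)" "\<lambda>b. ennreal \<bar>f b\<bar>"]
    by (simp add: bound_def nn_integral_density ennreal_power emeasure_density nn_integral_cong[OF mult.right_neutral]
        cong: nn_integral_cong)
  have "(\<integral>\<^sup>+a. (bound f a)\<^sup>2 \<partial>\<mu>) \<le> (\<integral>\<^sup>+a. ennreal c * (\<integral>\<^sup>+b. kern a b * ennreal ((f b)\<^sup>2) \<partial>\<mu>) \<partial>\<mu>)"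
    using nn_integral_kern_one by (intro nn_integral_mono_AE) (auto elim!: eventually_mono simp: CS intro: order_trans[OF CS])
  \<comment> \<open>The swap with the constant function 1 produces a second row integral, again
    equal to \<open>c\<close> a.e.\<close>
  also have "\<dots> = ennreal c * (\<integral>\<^sup>+b. ennreal ((f b)\<^sup>2) * (\<integral>\<^sup>+a. kern b a \<partial>\<mu>) \<partial>\<mu>)"
    using nn_integral_kern_swap[of "\<lambda>b. ennreal ((f b)\<^sup>2)" "\<lambda>_. 1"] by (simp add: nn_integral_cmult)
  also have "(\<integral>\<^sup>+b. ennreal ((f b)\<^sup>2) * (\<integral>\<^sup>+a. kern b a \<partial>\<mu>) \<partial>\<mu>) = (\<integral>\<^sup>+b. ennreal ((f b)\<^sup>2) * ennreal c \<partial>\<mu>)"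
    by (rule nn_integral_cong_AE) (use nn_integral_kern_one in eventually_elim, simp)
  also have "\<dots> = ennreal (\<integral>b. (f b)\<^sup>2 \<partial>\<mu>) * ennreal c"
    using L2_D(2)[OF assms] by (simp add: nn_integral_multc nn_integral_eq_integral)
  finally show ?thesis
    by (rule le_less_trans) (simp add: ennreal_mult_less_top)
qed

lemma bound_finite:
  assumes "f \<in> L2 \<mu>"
  shows "AE a in \<mu>. bound f a < \<infinity>"
proof -
  note [measurable] = bound_measurable[OF L2_D(1)[OF assms]]
  have "AE a in \<mu>. (bound f a)\<^sup>2 \<noteq> \<infinity>"
    using bound_square[OF assms] by (intro nn_integral_PInf_AE) auto
  then show ?thesis
    by eventually_elim (auto simp: less_top[symmetric] power2_eq_square)
qed

text \<open>\<open>enn2real\<close> replaces infinity by 0, which for \<open>f\<close> in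
  \<open>L2\<close> happens only on a null set.\<close>

definition dominant :: "('a \<Rightarrow> real) \<Rightarrow> 'a \<Rightarrow> real" where
  "dominant f a = enn2real (bound f a)"

lemma dominant_L2:
  assumes "f \<in> L2 \<mu>"
  shows "dominant f \<in> L2 \<mu>"
proof -
  note [measurable] = bound_measurable[OF L2_D(1)[OF assms]]
  have "(\<integral>\<^sup>+a. ennreal ((dominant f a)\<^sup>2) \<partial>\<mu>) = (\<integral>\<^sup>+a. (bound f a)\<^sup>2 \<partial>\<mu>)"
    using bound_finite[OF assms]
    by (intro nn_integral_cong_AE) (auto elim!: eventually_mono simp: dominant_def ennreal_power[symmetric])
  then show ?thesis
    using bound_square[OF assms] unfolding L2_def dominant_def
    by (auto intro!: integrableI_nonneg)
qed

lemma part_tendsto_nonneg: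
  assumes h: "integrable \<mu> h" "\<And>b. 0 \<le> h b" and fin: "(\<integral>\<^sup>+b. kern a b * ennreal (h b) \<partial>\<mu>) < \<infinity>"
  shows "(\<lambda>N. part N h a) \<longlonglongrightarrow> enn2real (\<integral>\<^sup>+b. kern a b * ennreal (h b) \<partial>\<mu>)"
    and "part N h a \<le> enn2real (\<integral>\<^sup>+b. kern a b * ennreal (h b) \<partial>\<mu>)"
proof -
  note [measurable] = borel_measurable_integrable[OF h(1)]
  have int: "integrable \<mu> (\<lambda>b. indicator A b * h b)" if "A \<in> sets \<mu>" for A
    using integrable_mult_indicator[OF that h(1)] by simp
  have eq: "ennreal (d n) * (\<integral>\<^sup>+b. indicator (atom n (x n a)) b * ennreal (h b) \<partial>\<mu>) = ennreal (d n * atom_int n h a)" for n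
  proof -
    have "(\<integral>\<^sup>+b. indicator (atom n (x n a)) b * ennreal (h b) \<partial>\<mu>) = (\<integral>\<^sup>+b. ennreal (indicator (atom n (x n a)) b * h b) \<partial>\<mu>)"
      by (intro nn_integral_cong) (auto simp: indicator_def)
    also have "\<dots> = ennreal (atom_int n h a)"
      unfolding atom_int_def using h by (intro nn_integral_eq_integral int) auto
    finally show ?thesis
      by (simp add: ennreal_mult' d_nonneg)
  qed
  have nn: "0 \<le> d n * atom_int n h a" for n
    unfolding atom_int_def by (intro mult_nonneg_nonneg d_nonneg integral_nonneg_AE) (auto simp: h)
  let ?S = "\<integral>\<^sup>+b. kern a b * ennreal (h b) \<partial>\<mu>"
  have S: "?S = (\<Sum>n. ennreal (d n * atom_int n h a))"
    by (subst nn_integral_kern) (auto simp: eq)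
  have sm: "summable (\<lambda>n. d n * atom_int n h a)"
    using fin S by (intro summable_suminf_not_top nn) auto
  have *: "enn2real ?S = (\<Sum>n. d n * atom_int n h a)"
    unfolding S using sm nn by (simp add: suminf_ennreal2 suminf_nonneg)
  show "(\<lambda>N. part N h a) \<longlonglongrightarrow> enn2real ?S"
    unfolding * part_def by (rule summable_LIMSEQ[OF sm])
  show "part N h a \<le> enn2real ?S"
    unfolding * part_def by (intro sum_le_suminf sm) (auto simp: nn)
qed

lemma atom_int_lincomb:
  assumes "integrable \<mu> f" "integrable \<mu> g"
  shows "atom_int n (\<lambda>b. s * f b + t * g b) a = s * atom_int n f a + t * atom_int n g a"
proof -
  have i: "integrable \<mu> (\<lambda>b. indicator (atom n (x n a)) b * h b)" if "integrable \<mu> h" for h :: "'a \<Rightarrow> real"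
    using integrable_mult_indicator[OF atom_sets that] by simp
  show ?thesis
    using i[OF assms(1)] i[OF assms(2)] unfolding atom_int_def by (simp add: algebra_simps)
qed

lemma part_lincomb:
  assumes "integrable \<mu> f" "integrable \<mu> g"
  shows "part N (\<lambda>b. s * f b + t * g b) a = s * part N f a + t * part N g a"
  by (simp add: part_def atom_int_lincomb[OF assms] sum_distrib_left sum.distrib algebra_simps)

text \<open>Positive and negative parts reduce this to nonnegative series;
  \<open>bound f a < \<infinity>\<close> keeps both integrals finite, so that the difference in
  \<open>oper\<close> is genuine.\<close>

lemma part_tendsto:
  assumes f: "f \<in> L2 \<mu>" and fin: "bound f a < \<infinity>"
  shows "(\<lambda>N. part N f a) \<longlonglongrightarrow> oper f a" and "\<bar>part N f a\<bar> \<le> dominant f a"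
proof -
  note [measurable] = L2_D(1)[OF f]
  define p where "p b = max 0 (f b)" for b
  define m where "m b = max 0 (- f b)" for b
  have int: "integrable \<mu> p" "integrable \<mu> m"
    unfolding p_def m_def using L2_D(3)[OF f] by auto
  have "(\<integral>\<^sup>+b. kern a b * ennreal (p b) \<partial>\<mu>) \<le> bound f a" "(\<integral>\<^sup>+b. kern a b * ennreal (m b) \<partial>\<mu>) \<le> bound f a"
    unfolding bound_def p_def m_def by (auto intro!: nn_integral_mono mult_left_mono ennreal_leI)
  then have fin': "(\<integral>\<^sup>+b. kern a b * ennreal (p b) \<partial>\<mu>) < \<infinity>" "(\<integral>\<^sup>+b. kern a b * ennreal (m b) \<partial>\<mu>) < \<infinity>"
    using fin by (auto intro: le_less_trans)
  \<comment> \<open>\<open>ennreal\<close> truncates negative reals to 0, so \<open>oper\<close>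
    performs the same splitting.\<close>
  have e: "ennreal (p b) = ennreal (f b)" "ennreal (m b) = ennreal (- f b)" for b
    by (auto simp: p_def m_def max_def ennreal_neg)
  have nn: "0 \<le> p b" "0 \<le> m b" for b by (auto simp: p_def m_def)
  have f_eq: "f = (\<lambda>b. 1 * p b + (-1) * m b)" "(\<lambda>b. \<bar>f b\<bar>) = (\<lambda>b. 1 * p b + 1 * m b)"
    by (auto simp: p_def m_def)
  have pf: "part N f a = part N p a - part N m a" "part N (\<lambda>b. \<bar>f b\<bar>) a = part N p a + part N m a" for N
    by (subst f_eq, subst part_lincomb[OF int], simp)+
  show "(\<lambda>N. part N f a) \<longlonglongrightarrow> oper f a"
    unfolding pf oper_def using part_tendsto_nonneg(1)[OF int(1) nn(1) fin'(1)] part_tendsto_nonneg(1)[OF int(2) nn(2) fin'(2)]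
    by (intro tendsto_diff) (simp_all add: e)
  have "part N h a \<ge> 0" if "\<And>b. 0 \<le> h b" for h
    unfolding part_def atom_int_def by (intro sum_nonneg mult_nonneg_nonneg d_nonneg integral_nonneg_AE) (auto simp: that)
  then have "\<bar>part N f a\<bar> \<le> part N (\<lambda>b. \<bar>f b\<bar>) a"
    unfolding pf using nn by (smt (verit))
  also have "\<dots> \<le> dominant f a"
    unfolding dominant_def bound_def using fin L2_D(4)[OF f]
    by (intro part_tendsto_nonneg(2)) (auto simp: bound_def)
  finally show "\<bar>part N f a\<bar> \<le> dominant f a" .
qed

lemma oper_measurable [measurable]:
  assumes [measurable]: "f \<in> borel_measurable \<mu>"
  shows "oper f \<in> borel_measurable \<mu>"
  unfolding oper_def by measurable

lemma AE_part:
  assumes f: "f \<in> L2 \<mu>"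
  shows "AE a in \<mu>. (\<lambda>N. part N f a) \<longlonglongrightarrow> oper f a \<and> (\<forall>N. \<bar>part N f a\<bar> \<le> dominant f a) \<and> \<bar>oper f a\<bar> \<le> dominant f a"
  using bound_finite[OF f]
proof eventually_elim
  case (elim a)
  have "\<bar>oper f a\<bar> \<le> dominant f a"
    using part_tendsto[OF f elim] by (intro LIMSEQ_le_const2[OF tendsto_rabs]) auto
  then show ?case using part_tendsto[OF f elim] by auto
qed

lemma dominant_nonneg [simp]: "0 \<le> dominant f a" by (simp add: dominant_def)

lemma oper_L2:
  assumes f: "f \<in> L2 \<mu>"
  shows "oper f \<in> L2 \<mu>"
  by (rule L2_bound[OF dominant_L2[OF f] oper_measurable[OF L2_D(1)[OF f]]], use AE_part[OF f] in eventually_elim, simp)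

lemma part_L2:
  assumes f: "f \<in> L2 \<mu>"
  shows "part N f \<in> L2 \<mu>"
  by (rule L2_bound[OF dominant_L2[OF f] part_measurable], use AE_part[OF f] in eventually_elim, simp)

lemma oper_cong_AE:
  assumes "f \<in> L2 \<mu>" "g \<in> L2 \<mu>" "AE a in \<mu>. f a = g a"
  shows "oper f a = oper g a"
proof -
  have "(\<integral>\<^sup>+b. kern a b * ennreal (f b) \<partial>\<mu>) = (\<integral>\<^sup>+b. kern a b * ennreal (g b) \<partial>\<mu>)"
    "(\<integral>\<^sup>+b. kern a b * ennreal (- f b) \<partial>\<mu>) = (\<integral>\<^sup>+b. kern a b * ennreal (- g b) \<partial>\<mu>)"
    by (rule nn_integral_cong_AE, use assms(3) in eventually_elim, simp)+
  then show ?thesis by (simp add: oper_def)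
qed

lemma L2_operator_oper: "L2_operator \<mu> oper"
  unfolding L2_operator_def
proof (intro conjI ballI allI impI)
  fix f g and s t :: real assume fg: "f \<in> L2 \<mu>" "g \<in> L2 \<mu>"
  show "AE a in \<mu>. oper (\<lambda>b. s * f b + t * g b) a = s * oper f a + t * oper g a"
    using AE_part[OF fg(1)] AE_part[OF fg(2)] AE_part[OF L2_lincomb[OF fg, of s t]]
  proof eventually_elim
    case (elim a)
    have "(\<lambda>N. part N (\<lambda>b. s * f b + t * g b) a) \<longlonglongrightarrow> s * oper f a + t * oper g a"
      unfolding part_lincomb[OF L2_D(3)[OF fg(1)] L2_D(3)[OF fg(2)]]
      using elim by (intro tendsto_intros) auto
    then show ?case by (rule LIMSEQ_unique[OF conjunct1[OF elim(3)]])
  qed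
next
  fix f g assume "f \<in> L2 \<mu>" "g \<in> L2 \<mu>" "AE a in \<mu>. f a = g a"
  then show "AE a in \<mu>. oper f a = oper g a"
    by (intro AE_I2) (rule oper_cong_AE)
qed (rule oper_L2)

text \<open>In this form of the truncated operator \<open>f\<close> and \<open>g\<close> play the
  same role; self-adjointness of \<open>oper\<close> is the limit of this symmetry.\<close>

lemma integral_part_mult:
  assumes f: "f \<in> L2 \<mu>" and g: "g \<in> L2 \<mu>"
  shows "(\<integral>a. part N f a * g a \<partial>\<mu>) = (\<Sum>n<N. d n * (\<Sum>v\<in>x n ` space \<mu>.
    (\<integral>b. indicator (atom n v) b * f b \<partial>\<mu>) * (\<integral>b. indicator (atom n v) b * g b \<partial>\<mu>)))"
proof -
  have i: "integrable \<mu> (\<lambda>b. indicator (atom n v) b * h b)" if "h \<in> L2 \<mu>" for h n v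
    using integrable_mult_indicator[OF atom_sets L2_D(3)[OF that]] by simp
  have "part N f a * g a = (\<Sum>n<N. \<Sum>v\<in>x n ` space \<mu>. d n *
      (\<integral>b. indicator (atom n v) b * f b \<partial>\<mu>) * (indicator (atom n v) a * g a))" if "a \<in> space \<mu>" for a
  proof -
    have "atom_int n f a = (\<Sum>v\<in>x n ` space \<mu>. indicator (atom n v) a * (\<integral>b. indicator (atom n v) b * f b \<partial>\<mu>))" for n
      unfolding atom_int_def indicator_atom_sum[OF that]
      by (simp add: sum_distrib_right mult.assoc i[OF f] Bochner_Integration.integral_sum)
    then show ?thesis
      by (simp add: part_def sum_distrib_left sum_distrib_right mult_ac)
  qed
  then have "(\<integral>a. part N f a * g a \<partial>\<mu>) = (\<integral>a. (\<Sum>n<N. \<Sum>v\<in>x n ` space \<mu>. d n *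
      (\<integral>b. indicator (atom n v) b * f b \<partial>\<mu>) * (indicator (atom n v) a * g a)) \<partial>\<mu>)"
    by (intro Bochner_Integration.integral_cong) auto
  also have "\<dots> = (\<Sum>n<N. \<Sum>v\<in>x n ` space \<mu>. d n *
      (\<integral>b. indicator (atom n v) b * f b \<partial>\<mu>) * (\<integral>b. indicator (atom n v) b * g b \<partial>\<mu>))"
    by (simp add: Bochner_Integration.integral_sum i[OF g])
  finally show ?thesis by (simp add: sum_distrib_left mult.assoc)
qed

lemma integral_part_tendsto:
  assumes f: "f \<in> L2 \<mu>" and g: "g \<in> L2 \<mu>"
  shows "(\<lambda>N. \<integral>a. part N f a * g a \<partial>\<mu>) \<longlonglongrightarrow> (\<integral>a. oper f a * g a \<partial>\<mu>)"
proof (rule integral_dominated_convergence)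
  note [measurable] = L2_D(1)[OF f] L2_D(1)[OF g]
  show "integrable \<mu> (\<lambda>a. \<bar>dominant f a * g a\<bar>)"
    using L2_mult_integrable[OF dominant_L2[OF f] g] by simp
  show "(\<lambda>a. oper f a * g a) \<in> borel_measurable \<mu>" "(\<lambda>a. part N f a * g a) \<in> borel_measurable \<mu>" for N
    by measurable
  show "AE a in \<mu>. (\<lambda>N. part N f a * g a) \<longlonglongrightarrow> oper f a * g a"
    using AE_part[OF f] by eventually_elim (auto intro: tendsto_intros)
  show "AE a in \<mu>. norm (part N f a * g a) \<le> \<bar>dominant f a * g a\<bar>" for N
    using AE_part[OF f] by eventually_elim (auto simp: abs_mult intro!: mult_right_mono)
qed

lemma self_adjoint_oper: "self_adjoint_L2 \<mu> oper"
  unfolding self_adjoint_L2_def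
proof (intro conjI L2_operator_oper ballI)
  fix f g assume fg: "f \<in> L2 \<mu>" "g \<in> L2 \<mu>"
  have "(\<lambda>N. \<integral>a. part N f a * g a \<partial>\<mu>) = (\<lambda>N. \<integral>a. part N g a * f a \<partial>\<mu>)"
    unfolding integral_part_mult[OF fg] integral_part_mult[OF fg(2,1)]
    by (intro ext sum.cong refl) (simp add: mult.commute)
  then have "(\<lambda>N. \<integral>a. part N f a * g a \<partial>\<mu>) \<longlonglongrightarrow> (\<integral>a. oper g a * f a \<partial>\<mu>)"
    using integral_part_tendsto[OF fg(2,1)] by simp
  then have "(\<integral>a. oper f a * g a \<partial>\<mu>) = (\<integral>a. oper g a * f a \<partial>\<mu>)"
    by (rule LIMSEQ_unique[OF integral_part_tendsto[OF fg]])
  then show "(\<integral>a. oper f a * g a \<partial>\<mu>) = (\<integral>a. f a * oper g a \<partial>\<mu>)"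
    by (simp add: mult.commute)
qed


subsection \<open>Summation by parts\<close>

lemma finite_measure_subalgebra_filt: "finite_measure_subalgebra \<mu> (filt n)"
  by unfold_locales (rule subalgebra_filt)

text \<open>Each level has finitely many atoms, so those of measure 0 together form a null
  set.\<close>

lemma AE_mass_pos: "AE a in \<mu>. \<forall>n. 0 < mass n a"
proof (subst AE_all_countable, intro allI)
  fix n
  have "AE a in \<mu>. \<forall>v\<in>x n ` space \<mu>. measure \<mu> (atom n v) = 0 \<longrightarrow> a \<notin> atom n v"
    using finite_range[of n] by (intro AE_finite_allI) (auto intro!: AE_not_in null_setsI simp: emeasure_eq_measure)
  with AE_space show "AE a in \<mu>. 0 < mass n a"
  proof eventually_elim
    case (elim a)
    then have "measure \<mu> (atom n (x n a)) \<noteq> 0" by (auto simp: atom_def)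
    then show ?case by (simp add: mass_def zero_less_measure_iff)
  qed
qed

text \<open>On a finite partition the conditional expectation is the average over the atom;
  multiplied by \<open>mass\<close> it becomes the integral that occurs in
  \<open>part\<close>.\<close>

lemma mass_cond_exp:
  assumes f: "integrable \<mu> f"
  shows "AE a in \<mu>. mass n a * real_cond_exp \<mu> (filt n) f a = atom_int n f a"
proof -
  interpret sub: finite_measure_subalgebra \<mu> "filt n"
    by (rule finite_measure_subalgebra_filt)
  have i: "integrable \<mu> (\<lambda>b. indicator (atom n v) b * f b)" for v
    using integrable_mult_indicator[OF atom_sets f] by simp
  have atom_filt: "atom n v \<in> sets (filt n)" for v
    unfolding sets_filt atom_def by (auto intro!: exI[of _ "{v}"])
  define h where "h v = (\<integral>b. indicator (atom n v) b * f b \<partial>\<mu>)" for v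
  define q where "q a = h (x n a) / mass n a" for a
  have fin: "finite (x n ` space \<mu>)" by (rule finite_range)
  have qv: "q a = (\<Sum>v\<in>x n ` space \<mu>. (h v / measure \<mu> (atom n v)) * indicator (atom n v) a)" if "a \<in> space \<mu>" for a
    using fin that
    by (subst sum.mono_neutral_right[of _ "{x n a}"]) (auto simp: atom_def indicator_def q_def mass_def)
  have intq: "integrable \<mu> q"
    by (rule iffD2[OF Bochner_Integration.integrable_cong[OF refl qv]])
      (auto intro!: Bochner_Integration.integrable_sum integrable_mult_right simp: less_top[symmetric])
  have q_filt: "q \<in> borel_measurable (filt n)"
    unfolding q_def by (intro borel_measurable_divide mass_filt function_of_x_measurable)
  have atoms: "(\<integral>b. indicator (atom n v) b * f b \<partial>\<mu>) = (\<integral>b. indicator (atom n v) b * q b \<partial>\<mu>)" for v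
  proof (cases "measure \<mu> (atom n v) = 0")
    case True
    \<comment> \<open>On a null atom \<open>q\<close> is a division by 0, but both integrals vanish
      there.\<close>
    then have "AE b in \<mu>. b \<notin> atom n v"
      by (intro AE_not_in null_setsI) (simp_all add: emeasure_eq_measure)
    then have *: "AE b in \<mu>. indicator (atom n v) b * k b = 0" for k :: "'a \<Rightarrow> real"
      by eventually_elim simp
    show ?thesis
      using *[of f] *[of q] by (simp add: integral_eq_zero_AE)
  next
    case False
    have "(\<integral>b. indicator (atom n v) b * q b \<partial>\<mu>) = (\<integral>b. (h v / measure \<mu> (atom n v)) * indicator (atom n v) b \<partial>\<mu>)"
      by (intro Bochner_Integration.integral_cong) (auto simp: atom_def indicator_def q_def mass_def)
    also have "\<dots> = h v" using False by simp
    finally show ?thesis by (simp add: h_def)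
  qed
  have "AE a in \<mu>. real_cond_exp \<mu> (filt n) f a = q a"
  proof (rule sub.real_cond_exp_charact[OF _ f intq q_filt])
    fix S assume "S \<in> sets (filt n)"
    then obtain V where S: "S = x n -` V \<inter> space \<mu>" unfolding sets_filt by auto
    \<comment> \<open>A set of \<open>filt n\<close> is a finite disjoint union of fibres, so
      equality of the integrals need only be known on atoms.\<close>
    have *: "(LINT a:S|\<mu>. k a) = (\<Sum>v\<in>x n ` S. \<integral>b. indicator (atom n v) b * k b \<partial>\<mu>)" if k: "integrable \<mu> k" for k :: "'a \<Rightarrow> real"
    proof -
      have finS: "finite (x n ` S)" using fin by (rule finite_subset[rotated]) (auto simp: S)
      have "(LINT a:S|\<mu>. k a) = (\<integral>b. (\<Sum>v\<in>x n ` S. indicator (atom n v) b * k b) \<partial>\<mu>)"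
        unfolding set_lebesgue_integral_def
      proof (intro Bochner_Integration.integral_cong refl)
        fix b assume b: "b \<in> space \<mu>"
        have "(\<Sum>v\<in>x n ` S. indicator (atom n v) b) = (indicator S b :: real)"
        proof (cases "b \<in> S")
          case True
          then show ?thesis using finS
            by (subst sum.mono_neutral_right[of _ "{x n b}"]) (auto simp: atom_def indicator_def b)
        next
          case False
          then have "x n b \<notin> x n ` S" using b by (auto simp: S)
          then have "indicator (atom n v) b = (0 :: real)" if "v \<in> x n ` S" for v
            using that by (auto simp: atom_def indicator_def)
          with False show ?thesis by simp
        qed
        then show "indicator S b *\<^sub>R k b = (\<Sum>v\<in>x n ` S. indicator (atom n v) b * k b)"
          by (simp add: sum_distrib_right[symmetric])
      qed
      also have "\<dots> = (\<Sum>v\<in>x n ` S. \<integral>b. indicator (atom n v) b * k b \<partial>\<mu>)"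
        using integrable_mult_indicator[OF atom_sets k]
        by (intro Bochner_Integration.integral_sum) simp
      finally show ?thesis .
    qed
    show "(LINT a:S|\<mu>. f a) = (LINT a:S|\<mu>. q a)"
      unfolding *[OF f] *[OF intq] by (simp add: atoms)
  qed
  with AE_mass_pos show ?thesis
    by eventually_elim (auto simp: q_def h_def atom_int_def less_imp_neq[symmetric])
qed

text \<open>Index shifted by one: \<open>cexp N\<close> is the expectation given
  \<open>filt (N - 1)\<close>, and \<open>N = 0\<close> encodes the convention for index -1.\<close>

definition cexp :: "nat \<Rightarrow> ('a \<Rightarrow> real) \<Rightarrow> 'a \<Rightarrow> real" where
  "cexp N f a = (if N = 0 then 0 else real_cond_exp \<mu> (filt (N - 1)) f a)"

lemma cond_exp_diff_filt: "cond_exp_diff \<mu> filt n f a = cexp (Suc n) f a - cexp n f a"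
  by (simp add: cond_exp_diff_def cexp_def)

lemma cexp_measurable [measurable]: "cexp N f \<in> borel_measurable \<mu>"
  unfolding cexp_def by simp

text \<open>Abel summation with \<open>weight N - weight (Suc N) = d N * mass N\<close>, where
  \<open>mass N\<close> times the conditional expectation is \<open>atom_int N\<close>. In the
  remainder, \<open>weight N\<close> is measurable for the very algebra on which
  \<open>cexp N\<close> conditions when \<open>N > 0\<close>.\<close>

lemma summation_by_parts:
  assumes f: "integrable \<mu> f"
  shows "AE a in \<mu>. \<forall>N. (\<Sum>n<N. weight n a * cond_exp_diff \<mu> filt n f a) = weight N a * cexp N f a + part N f a"
proof -
  have "AE a in \<mu>. \<forall>n. mass n a * real_cond_exp \<mu> (filt n) f a = atom_int n f a"
    unfolding AE_all_countable using mass_cond_exp[OF f] by blast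
  then show ?thesis
  proof eventually_elim
    case (elim a)
    show ?case
    proof
      fix N show "(\<Sum>n<N. weight n a * cond_exp_diff \<mu> filt n f a) = weight N a * cexp N f a + part N f a"
      proof (induction N)
        case (Suc N)
        have "atom_int N f a = mass N a * cexp (Suc N) f a"
          using elim by (simp add: cexp_def)
        then have *: "part (Suc N) f a = part N f a + d N * (mass N a * cexp (Suc N) f a)"
          by (simp add: part_def)
        have w: "weight N a = weight (Suc N) a + d N * mass N a" by (simp add: weight_def)
        have "(\<Sum>n<Suc N. weight n a * cond_exp_diff \<mu> filt n f a) = part N f a + weight N a * cexp (Suc N) f a"
          using Suc by (simp add: cond_exp_diff_filt right_diff_distrib)
        then show ?case
          unfolding * w by (simp add: algebra_simps)
      qed (simp add: part_def cexp_def)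
    qed
  qed
qed

lemma cexp_square:
  assumes f: "f \<in> L2 \<mu>"
  shows "AE a in \<mu>. (cexp (Suc N) f a)\<^sup>2 \<le> real_cond_exp \<mu> (filt N) (\<lambda>a. (f a)\<^sup>2) a"
proof -
  interpret sub: finite_measure_subalgebra \<mu> "filt N"
    by (rule finite_measure_subalgebra_filt)
  have "convex_on UNIV (\<lambda>t::real. t\<^sup>2)"
    by (intro convex_power_even) auto
  then show ?thesis
    using sub.real_cond_exp_jensens_inequality(2)[OF L2_D(3)[OF f], where q = "\<lambda>t. t\<^sup>2" and I = UNIV] L2_D(2)[OF f]
    by (simp add: cexp_def)
qed

lemma cexp_L2:
  assumes f: "f \<in> L2 \<mu>"
  shows "cexp N f \<in> L2 \<mu>"
proof (cases N)
  case 0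
  then show ?thesis by (simp add: L2_def cexp_def)
next
  case (Suc n)
  interpret sub: finite_measure_subalgebra \<mu> "filt n"
    by (rule finite_measure_subalgebra_filt)
  have "integrable \<mu> (\<lambda>a. (cexp N f a)\<^sup>2)"
    by (rule Bochner_Integration.integrable_bound[OF sub.real_cond_exp_int(1)[OF L2_D(2)[OF f]]])
      (use cexp_square[OF f, of n] in \<open>auto simp: Suc\<close>)
  then show ?thesis by (simp add: L2_def)
qed

lemma weight_mult_L2:
  assumes f: "f \<in> L2 \<mu>"
  shows "(\<lambda>a. weight n a * f a) \<in> L2 \<mu>"
proof (rule L2_bound)
  note [measurable] = L2_D(1)[OF f]
  show "(\<lambda>a. c * f a) \<in> L2 \<mu>" using L2_lincomb[OF f f, of c 0] by simp
  show "(\<lambda>a. weight n a * f a) \<in> borel_measurable \<mu>" by measurable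
  show "AE a in \<mu>. \<bar>weight n a * f a\<bar> \<le> \<bar>c * f a\<bar>"
    using weight_bounds c_nonneg by (auto simp: abs_mult elim!: eventually_mono intro!: mult_right_mono)
qed

text \<open>By Jensen's inequality and because \<open>weight (Suc N)\<close> is measurable for
  \<open>filt N\<close>, the conditional expectation can be removed under the integral; what remains
  has the majorant \<open>c\<^sup>2 * (f a)\<^sup>2\<close>, independent of
  \<open>N\<close>.\<close>

lemma weight_cexp_tendsto:
  assumes f: "f \<in> L2 \<mu>"
  shows "(\<lambda>N. \<integral>a. (weight N a * cexp N f a)\<^sup>2 \<partial>\<mu>) \<longlonglongrightarrow> 0"
proof -
  note [measurable] = L2_D(1)[OF f]
  have lim: "(\<lambda>N. \<integral>a. (weight (Suc N) a)\<^sup>2 * (f a)\<^sup>2 \<partial>\<mu>) \<longlonglongrightarrow> (\<integral>a. 0 \<partial>\<mu>)"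
  proof (rule integral_dominated_convergence)
    show "integrable \<mu> (\<lambda>a. c\<^sup>2 * (f a)\<^sup>2)" using L2_D(2)[OF f] by simp
    show "(\<lambda>a. (weight (Suc N) a)\<^sup>2 * (f a)\<^sup>2) \<in> borel_measurable \<mu>" for N by measurable
    show "AE a in \<mu>. (\<lambda>N. (weight (Suc N) a)\<^sup>2 * (f a)\<^sup>2) \<longlonglongrightarrow> 0"
      using weight_bounds
    proof eventually_elim
      case (elim a)
      then have "(\<lambda>N. weight (Suc N) a) \<longlonglongrightarrow> 0" by (intro LIMSEQ_Suc) simp
      then have "(\<lambda>N. (weight (Suc N) a)\<^sup>2 * (f a)\<^sup>2) \<longlonglongrightarrow> 0\<^sup>2 * (f a)\<^sup>2" by (intro tendsto_intros)
      then show ?case by simp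
    qed
    show "AE a in \<mu>. norm ((weight (Suc N) a)\<^sup>2 * (f a)\<^sup>2) \<le> c\<^sup>2 * (f a)\<^sup>2" for N
      using weight_bounds by eventually_elim (auto intro!: mult_right_mono power_mono)
  qed simp
  have le: "(\<integral>a. (weight (Suc N) a * cexp (Suc N) f a)\<^sup>2 \<partial>\<mu>) \<le> (\<integral>a. (weight (Suc N) a)\<^sup>2 * (f a)\<^sup>2 \<partial>\<mu>)" for N
  proof -
    interpret sub: finite_measure_subalgebra \<mu> "filt N"
      by (rule finite_measure_subalgebra_filt)
    have int: "integrable \<mu> (\<lambda>a. (weight (Suc N) a)\<^sup>2 * (f a)\<^sup>2)"
      using L2_D(2)[OF weight_mult_L2[OF f, of "Suc N"]] by (simp add: power_mult_distrib)
    have m: "(\<lambda>a. (weight (Suc N) a)\<^sup>2) \<in> borel_measurable (filt N)"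
      by (intro borel_measurable_power weight_Suc_filt)
    have "(\<integral>a. (weight (Suc N) a * cexp (Suc N) f a)\<^sup>2 \<partial>\<mu>)
        \<le> (\<integral>a. (weight (Suc N) a)\<^sup>2 * real_cond_exp \<mu> (filt N) (\<lambda>a. (f a)\<^sup>2) a \<partial>\<mu>)"
    proof (rule integral_mono_AE)
      show "integrable \<mu> (\<lambda>a. (weight (Suc N) a * cexp (Suc N) f a)\<^sup>2)"
        by (intro L2_D weight_mult_L2 cexp_L2 f)
      show "AE a in \<mu>. (weight (Suc N) a * cexp (Suc N) f a)\<^sup>2 \<le> (weight (Suc N) a)\<^sup>2 * real_cond_exp \<mu> (filt N) (\<lambda>a. (f a)\<^sup>2) a"
        using cexp_square[OF f, of N] by eventually_elim (simp add: power_mult_distrib mult_left_mono)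
    qed (rule sub.real_cond_exp_intg(1)[OF int m], measurable)
    also have "\<dots> = (\<integral>a. (weight (Suc N) a)\<^sup>2 * (f a)\<^sup>2 \<partial>\<mu>)"
      by (rule sub.real_cond_exp_intg(2)[OF int m]) measurable
    finally show ?thesis .
  qed
  have "(\<lambda>N. \<integral>a. (weight (Suc N) a * cexp (Suc N) f a)\<^sup>2 \<partial>\<mu>) \<longlonglongrightarrow> 0"
  proof (rule tendsto_sandwich[OF always_eventually[OF allI] always_eventually[OF allI[OF le]] tendsto_const])
    show "0 \<le> (\<integral>a. (weight (Suc N) a * cexp (Suc N) f a)\<^sup>2 \<partial>\<mu>)" for N by simp
  qed (use lim in simp)
  then show ?thesis by (rule LIMSEQ_imp_Suc)
qed

lemma part_oper_tendsto:
  assumes f: "f \<in> L2 \<mu>"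
  shows "(\<lambda>N. \<integral>a. (oper f a - part N f a)\<^sup>2 \<partial>\<mu>) \<longlonglongrightarrow> 0"
proof -
  note [measurable] = L2_D(1)[OF f]
  have "(\<lambda>N. \<integral>a. (oper f a - part N f a)\<^sup>2 \<partial>\<mu>) \<longlonglongrightarrow> (\<integral>a. 0 \<partial>\<mu>)"
  proof (rule integral_dominated_convergence)
    \<comment> \<open>Both \<open>oper f\<close> and \<open>part N f\<close> are bounded by
      \<open>dominant f\<close>; squaring twice this bound gives the factor 4.\<close>
    show "integrable \<mu> (\<lambda>a. 4 * (dominant f a)\<^sup>2)" using L2_D(2)[OF dominant_L2[OF f]] by simp
    show "(\<lambda>a. (oper f a - part N f a)\<^sup>2) \<in> borel_measurable \<mu>" for N by measurable
    show "AE a in \<mu>. (\<lambda>N. (oper f a - part N f a)\<^sup>2) \<longlonglongrightarrow> 0"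
      using AE_part[OF f]
    proof eventually_elim
      case (elim a)
      then have "(\<lambda>N. (oper f a - part N f a)\<^sup>2) \<longlonglongrightarrow> (oper f a - oper f a)\<^sup>2" by (intro tendsto_intros) auto
      then show ?case by simp
    qed
    show "AE a in \<mu>. norm ((oper f a - part N f a)\<^sup>2) \<le> 4 * (dominant f a)\<^sup>2" for N
      using AE_part[OF f]
    proof eventually_elim
      case (elim a)
      then have "\<bar>oper f a\<bar> \<le> dominant f a" "\<bar>part N f a\<bar> \<le> dominant f a" by auto
      then have "\<bar>oper f a - part N f a\<bar> \<le> \<bar>2 * dominant f a\<bar>" by linarith
      then have "(oper f a - part N f a)\<^sup>2 \<le> (2 * dominant f a)\<^sup>2" by (simp only: abs_le_square_iff)
      then show ?case by simp
    qed
  qed simp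
  then show ?thesis by simp
qed

lemma stochastic_integral_oper: "stochastic_integral_operator \<mu> oper"
  unfolding stochastic_integral_operator_def
proof (intro exI[of _ filt] exI[of _ weight] conjI ballI allI)
  show "predictable \<mu> filt weight"
    unfolding predictable_def using weight_Suc_filt
    by (auto intro!: exI[of _ c] simp: weight_def[of 0])
next
  fix f n assume f: "f \<in> L2 \<mu>"
  show "(\<lambda>a. weight n a * cond_exp_diff \<mu> filt n f a) \<in> L2 \<mu>"
    unfolding cond_exp_diff_filt
    using weight_mult_L2[OF L2_lincomb[OF cexp_L2[OF f] cexp_L2[OF f], of 1 "Suc n" "-1" n]] by simp
next
  fix f assume f: "f \<in> L2 \<mu>"
  define A where "A N a = (weight N a * cexp N f a)\<^sup>2" for N a
  define B where "B N a = (oper f a - part N f a)\<^sup>2" for N a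
  note [measurable] = L2_D(1)[OF f]
  have diff: "(\<lambda>a. oper f a - part N f a) \<in> L2 \<mu>" for N
    using L2_lincomb[OF oper_L2[OF f] part_L2[OF f], of 1 "-1"] by simp
  have int: "integrable \<mu> (A N)" "integrable \<mu> (B N)" for N
    unfolding A_def B_def by (rule L2_D(2)[OF weight_mult_L2[OF cexp_L2[OF f]]], rule L2_D(2)[OF diff])
  have le: "(\<integral>\<^sup>+a. ennreal ((oper f a - (\<Sum>n<N. weight n a * cond_exp_diff \<mu> filt n f a))\<^sup>2) \<partial>\<mu>)
      \<le> ennreal (2 * (\<integral>a. A N a \<partial>\<mu>) + 2 * (\<integral>a. B N a \<partial>\<mu>))" for N
  proof -
    have "(\<integral>\<^sup>+a. ennreal ((oper f a - (\<Sum>n<N. weight n a * cond_exp_diff \<mu> filt n f a))\<^sup>2) \<partial>\<mu>)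
      \<le> (\<integral>\<^sup>+a. ennreal (2 * A N a + 2 * B N a) \<partial>\<mu>)"
    proof (rule nn_integral_mono_AE)
      \<comment> \<open>Used with \<open>s\<close> the value of \<open>oper f\<close>,
        \<open>t\<close> the remainder of the summation by parts and \<open>u\<close> the partial
        sum, so that the error separates into \<open>A\<close> and \<open>B\<close>.\<close>
      have ineq: "(s - (t + u))\<^sup>2 \<le> 2 * t\<^sup>2 + 2 * (s - u)\<^sup>2" for s t u :: real
        using zero_le_power2[of "t + (s - u)"] by (simp add: power2_eq_square algebra_simps)
      show "AE a in \<mu>. ennreal ((oper f a - (\<Sum>n<N. weight n a * cond_exp_diff \<mu> filt n f a))\<^sup>2) \<le> ennreal (2 * A N a + 2 * B N a)"
        using summation_by_parts[OF L2_D(3)[OF f]]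
      proof eventually_elim
        case (elim a)
        show ?case
          unfolding elim[rule_format] A_def B_def by (rule ennreal_leI, rule ineq)
      qed
    qed
    also have "\<dots> = ennreal (\<integral>a. 2 * A N a + 2 * B N a \<partial>\<mu>)"
    proof (rule nn_integral_eq_integral)
      show "integrable \<mu> (\<lambda>a. 2 * A N a + 2 * B N a)" using int by simp
      show "AE a in \<mu>. 0 \<le> 2 * A N a + 2 * B N a" by (simp add: A_def B_def)
    qed
    also have "(\<integral>a. 2 * A N a + 2 * B N a \<partial>\<mu>) = 2 * (\<integral>a. A N a \<partial>\<mu>) + 2 * (\<integral>a. B N a \<partial>\<mu>)"
      using int by simp
    finally show ?thesis .
  qed
  have lim: "(\<lambda>N. ennreal (2 * (\<integral>a. A N a \<partial>\<mu>) + 2 * (\<integral>a. B N a \<partial>\<mu>))) \<longlonglongrightarrow> ennreal (2 * 0 + 2 * 0)"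
    unfolding A_def B_def using weight_cexp_tendsto[OF f] part_oper_tendsto[OF f]
    by (intro tendsto_ennrealI tendsto_add tendsto_mult tendsto_const)
  show "(\<lambda>N. \<integral>\<^sup>+a. ennreal ((oper f a - (\<Sum>n<N. weight n a * cond_exp_diff \<mu> filt n f a))\<^sup>2) \<partial>\<mu>) \<longlonglongrightarrow> 0"
    by (rule tendsto_sandwich[OF always_eventually[OF allI[OF zero_le]] always_eventually[OF allI[OF le]] tendsto_const])
      (use lim in simp)
qed (simp_all add: filtration_filt subalgebra_filt oper_L2)

end


section \<open>Rooted trees\<close>

locale rooted_tree =
  fixes adj :: "'v \<Rightarrow> 'v \<Rightarrow> bool" and r :: 'v
  assumes tree: "infinite_rooted_tree adj r"
begin

abbreviation lev :: "'v \<Rightarrow> nat" where "lev \<equiv> level adj r"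
abbreviation par :: "'v \<Rightarrow> 'v" where "par \<equiv> parent adj r"
abbreviation succs :: "'v \<Rightarrow> 'v set" where "succs \<equiv> successors adj r"

section \<open>Levels and the uniqueness of the parent\<close>

lemma adj_sym: "adj i j \<Longrightarrow> adj j i"
  and adj_connected: "adj\<^sup>*\<^sup>* i j"
  and no_cycle: "\<not> is_cycle adj q"
  using tree by (auto simp: infinite_rooted_tree_def is_tree_def symp_def)

lemma countable_sites: "countable (UNIV :: 'v set)"
  and finite_neighbours: "finite {j. adj i j}"
  using tree by (auto simp: infinite_rooted_tree_def)

lemma lev_path: "(adj ^^ lev i) r i"
proof -
  obtain n where "(adj ^^ n) r i" using adj_connected[of r i] by (auto simp: rtranclp_power)
  then show ?thesis unfolding level_def by (rule LeastI)
qed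

lemma lev_le: "(adj ^^ n) r i \<Longrightarrow> lev i \<le> n"
  unfolding level_def by (rule Least_le)

lemma lev_eq_0_iff [simp]: "lev i = 0 \<longleftrightarrow> i = r"
proof
  assume "lev i = 0" then show "i = r" using lev_path[of i] by simp
next
  assume "i = r" then show "lev i = 0" using lev_le[of 0 r] by simp
qed

lemma lev_root [simp]: "lev r = 0" by simp

lemma lev_adj_le: "adj i j \<Longrightarrow> lev j \<le> Suc (lev i)"
  using lev_path[of i] by (intro lev_le) auto

lemma lower_neighbour:
  assumes "i \<noteq> r" shows "\<exists>j. adj i j \<and> Suc (lev j) = lev i"
proof -
  obtain n where n: "lev i = Suc n" using assms by (cases "lev i") auto
  then obtain j where j: "(adj ^^ n) r j" "adj j i" using lev_path[of i] by auto
  have "lev j \<le> n" by (rule lev_le) (rule j)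
  moreover have "lev i \<le> Suc (lev j)" by (rule lev_adj_le) (rule j)
  ultimately show ?thesis using n adj_sym[OF j(2)] by (intro exI[of _ j]) auto
qed

text \<open>Two lower neighbours of \<open>i\<close> would close a cycle at the first common vertex of their descents to the root.\<close>

lemma lower_neighbour_unique:
  assumes j: "adj i j" "lev j < lev i" and k: "adj i k" "lev k < lev i"
  shows "j = k"
proof (rule ccontr)
  assume "j \<noteq> k"
  define n where "n = lev j"
  have lj: "lev i = Suc n" using j lev_adj_le[OF adj_sym[OF j(1)]] by (simp add: n_def)
  have lk: "lev k = n" using k lev_adj_le[OF adj_sym[OF k(1)]] lj by simp
  define p where "p v = (SOME u. adj v u \<and> Suc (lev u) = lev v)" for v
  have p: "adj v (p v)" "Suc (lev (p v)) = lev v" if "v \<noteq> r" for v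
    using someI_ex[OF lower_neighbour[OF that]] by (simp_all add: p_def)
  have lp: "lev ((p ^^ t) v) = n - t" if "lev v = n" "t \<le> n" for t v
    using that(2)
  proof (induction t)
    case (Suc t)
    then have "lev ((p ^^ t) v) = n - t" by simp
    moreover from this Suc.prems have "(p ^^ t) v \<noteq> r" by (auto simp flip: lev_eq_0_iff)
    ultimately show ?case using p(2)[of "(p ^^ t) v"] by simp
  qed (use that in simp)
  have "(p ^^ n) j = (p ^^ n) k"
    using lp[of j n] lp[of k n] lk by (simp add: n_def)
  then have ex: "\<exists>t. (p ^^ t) j = (p ^^ t) k" by blast
  define t where "t = (LEAST t. (p ^^ t) j = (p ^^ t) k)"
  have t: "(p ^^ t) j = (p ^^ t) k" unfolding t_def by (rule LeastI_ex[OF ex])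
  have tmin: "(p ^^ s) j \<noteq> (p ^^ s) k" if "s < t" for s
    using not_less_Least that unfolding t_def by blast
  have tn: "t \<le> n" unfolding t_def by (rule Least_le) fact
  have t0: "t \<noteq> 0" using t \<open>j \<noteq> k\<close> by (cases t) auto
  have step: "adj ((p ^^ s) v) ((p ^^ Suc s) v)" if "s < t" "lev v = n" for s v
  proof -
    have "lev ((p ^^ s) v) \<noteq> 0" using lp[of v s] that tn by simp
    then show ?thesis using p(1)[of "(p ^^ s) v"] by simp
  qed
  \<comment> \<open>\<open>J\<close> ends with the meeting vertex and \<open>K\<close> stops just
    before it, so that this vertex occurs once in the cycle \<open>i # J @ rev K\<close>.\<close>
  define J where "J = map (\<lambda>s. (p ^^ s) j) [0..<Suc t]"
  define K where "K = map (\<lambda>s. (p ^^ s) k) [0..<t]"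
  have nJ: "s \<le> t \<Longrightarrow> J ! s = (p ^^ s) j" and nK: "s < t \<Longrightarrow> K ! s = (p ^^ s) k" for s
    by (simp_all add: J_def K_def del: upt_Suc)
  have len: "length J = Suc t" "length K = t" by (simp_all add: J_def K_def)
  have lj': "lev j = n" by (simp add: n_def)
  have levJ: "v \<in> set J \<Longrightarrow> lev v \<le> n" and levK: "v \<in> set K \<Longrightarrow> lev v \<le> n" for v
    using lp[OF lj'] lp[OF lk] tn by (auto simp: J_def K_def simp del: upt_Suc)
  have sJ: "successively adj J"
    unfolding successively_conv_nth using step[OF _ lj'] by (simp add: len nJ)
  have sK: "successively adj K"
    unfolding successively_conv_nth using step[OF _ lk] by (simp add: len nK)
  have lastJ: "last J = (p ^^ t) j" by (simp add: J_def)
  have hdJ: "hd J = j" by (simp add: J_def upt_conv_Cons del: upt_Suc)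
  have hdK: "hd K = k" using t0 by (simp add: K_def upt_conv_Cons)
  have lastK: "last K = (p ^^ (t - 1)) k" using t0 by (simp add: K_def last_map)
  have injJ: "inj_on (\<lambda>s. (p ^^ s) v) {..t}" if "lev v = n" for v
    using lp[OF that] tn by (intro inj_onI) (metis atMost_iff diff_diff_cancel order_trans)
  have "is_cycle adj (i # J @ rev K)"
    unfolding is_cycle_def
  proof (intro conjI)
    show "3 \<le> length (i # J @ rev K)" using t0 by (simp add: len)
    \<comment> \<open>The level of a vertex tells the number of steps leading to it, so a common
      vertex would be an earlier meeting.\<close>
    have disj: "set J \<inter> set K = {}"
    proof (rule ccontr)
      assume "\<not> ?thesis"
      then obtain a b where ab: "a \<le> t" "b < t" "(p ^^ a) j = (p ^^ b) k"
        by (auto simp: J_def K_def less_Suc_eq_le simp del: upt_Suc)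
      then have "n - a = n - b" using lp[OF lj', of a] lp[OF lk, of b] tn by simp
      then have "a = b" using ab tn by simp
      then show False using ab tmin by simp
    qed
    have dJ: "distinct J" using injJ[OF lj'] by (auto simp: J_def distinct_map atLeast0LessThan lessThan_Suc_atMost simp del: upt_Suc)
    have "{..<t} \<subseteq> {..t}" by auto
    then have dK: "distinct K" using inj_on_subset[OF injJ[OF lk], of "{..<t}"] by (auto simp: K_def distinct_map atLeast0LessThan)
    show "distinct (i # J @ rev K)"
      using levJ[of i] levK[of i] lj disj dJ dK by auto
    have "successively adj (J @ rev K)"
      using sJ sK t0 step[OF _ lk, of "t - 1"] t
      by (auto simp: successively_append_iff lastJ hd_rev lastK adj_sym elim: successively_mono)
    then show "successively adj (i # J @ rev K)"
      using j(1) len hdJ by (cases J) (auto simp: successively_Cons)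
    show "adj (last (i # J @ rev K)) (hd (i # J @ rev K))"
      using t0 hdK adj_sym[OF k(1)] len by (cases K) (auto simp: last_rev)
  qed
  then show False using no_cycle by blast
qed

lemma par_eqI: "adj i j \<Longrightarrow> lev j < lev i \<Longrightarrow> par i = j"
  unfolding parent_def by (rule the_equality) (auto intro: lower_neighbour_unique)

lemma par_adj: "i \<noteq> r \<Longrightarrow> adj i (par i)"
  and lev_par: "i \<noteq> r \<Longrightarrow> Suc (lev (par i)) = lev i"
  using lower_neighbour[of i] par_eqI[of i] by (metis lessI)+

lemma succs_iff: "j \<in> succs i \<longleftrightarrow> j \<noteq> r \<and> par j = i"
  by (simp add: successors_def)

lemma lev_succ: "j \<in> succs i \<Longrightarrow> lev j = Suc (lev i)"
  using lev_par by (auto simp: succs_iff)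

lemma finite_succs: "finite (succs i)"
  by (rule finite_subset[OF _ finite_neighbours[of i]]) (auto simp: succs_iff intro: adj_sym[OF par_adj])

lemma par_neq: "i \<noteq> r \<Longrightarrow> par i \<noteq> i"
  using lev_par[of i] by auto

section \<open>Geodesics from the root as iterated parents\<close>

lemma lev_par_pow: "t \<le> lev i \<Longrightarrow> lev ((par ^^ t) i) = lev i - t"
proof (induction t)
  case (Suc t)
  then have "lev ((par ^^ t) i) = lev i - t" by simp
  moreover from this Suc.prems have "(par ^^ t) i \<noteq> r" by (auto simp flip: lev_eq_0_iff)
  ultimately show ?case using lev_par[of "(par ^^ t) i"] by simp
qed simp

definition descent :: "'v \<Rightarrow> 'v list" where
  "descent i = rev (map (\<lambda>s. (par ^^ s) i) [0..<Suc (lev i)])"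

lemma descent_root: "descent r = [r]" by (simp add: descent_def)

lemma descent_step: "i \<noteq> r \<Longrightarrow> descent i = descent (par i) @ [i]"
proof -
  assume "i \<noteq> r"
  then have l: "lev i = Suc (lev (par i))" by (simp add: lev_par)
  have "map (\<lambda>s. (par ^^ s) i) [0..<Suc (lev i)] = i # map (\<lambda>s. (par ^^ s) (par i)) [0..<Suc (lev (par i))]"
    unfolding l by (simp add: upt_conv_Cons map_Suc_upt[symmetric] funpow_swap1 del: upt_Suc)
  then show ?thesis by (simp add: descent_def)
qed

text \<open>Induction on the level: on a path of this minimal length the last but one vertex has
  smaller level, so it is the parent by uniqueness of the lower neighbour.\<close>

lemma path_descent:
  "length q = Suc (lev i) \<Longrightarrow> hd q = r \<Longrightarrow> last q = i \<Longrightarrow> successively adj q \<Longrightarrow> q = descent i"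
proof (induction "lev i" arbitrary: i q)
  case 0
  then have "i = r" by (metis lev_eq_0_iff)
  with 0 show ?case by (cases q) (auto simp: descent_root)
next
  case (Suc n)
  have ir: "i \<noteq> r" using Suc(2) by auto
  obtain q' where q: "q = q' @ [i]" using Suc.prems by (metis append_butlast_last_id length_0_conv nat.distinct(1))
  have l: "length q' = Suc n" using Suc.prems Suc(2) q by simp
  then have ne: "q' \<noteq> []" by auto
  have s: "successively adj q'" "adj (last q') i"
    using Suc.prems(4) ne by (auto simp: q successively_append_iff)
  have "hd q' = r" using Suc.prems(2) ne q by simp
  have path: "(adj ^^ (length xs - 1)) (hd xs) (last xs)" if "xs \<noteq> []" "successively adj xs" for xs
    using that
  proof (induction xs rule: rev_nonempty_induct)
    case (snoc x xs)
    then have "(adj ^^ (length xs - 1)) (hd xs) (last xs)" "adj (last xs) x" by (auto simp: successively_append_iff)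
    then have "(adj ^^ Suc (length xs - 1)) (hd xs) x" by (rule relpowp_Suc_I)
    moreover have "Suc (length xs - 1) = length (xs @ [x]) - 1" using snoc.hyps by (cases xs) auto
    ultimately show ?case using snoc.hyps by simp
  qed simp
  have "lev (last q') \<le> n" using lev_le path[OF ne s(1)] l \<open>hd q' = r\<close> by simp
  then have "par i = last q'" using Suc(2) adj_sym[OF s(2)] by (intro par_eqI) auto
  then have last: "last q' = par i" by simp
  have n: "n = lev (par i)" using lev_par[OF ir] Suc(2) by simp
  have "length q' = Suc (lev (par i))" using l unfolding n .
  then have "q' = descent (par i)"
    using \<open>hd q' = r\<close> last s(1) by (rule Suc(1)[OF n])
  then show ?case unfolding q descent_step[OF ir] by (rule arg_cong[of _ _ "\<lambda>l. l @ [i]"])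
qed

lemma descent_path:
  "length (descent i) = Suc (lev i) \<and> hd (descent i) = r \<and> last (descent i) = i \<and> successively adj (descent i)"
proof (induction "lev i" arbitrary: i)
  case 0
  then have "i = r" by (metis lev_eq_0_iff)
  then show ?case by (simp add: descent_root)
next
  case (Suc n)
  have ir: "i \<noteq> r" using Suc(2) by auto
  have l: "n = lev (par i)" using lev_par[OF ir] Suc(2) by simp
  have ne: "descent (par i) \<noteq> []" by (simp add: descent_def)
  show ?case unfolding descent_step[OF ir]
    using Suc(1)[OF l] ne adj_sym[OF par_adj[OF ir]] lev_par[OF ir]
    by (auto simp: successively_append_iff)
qed

lemma geodesic_eq: "geodesic adj r i = descent i"
  unfolding geodesic_def by (rule the_equality) (use descent_path path_descent in blast)+

section \<open>Branches of the tree\<close>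

definition branch :: "'v \<Rightarrow> 'v set" where
  "branch i = {j. i \<in> set (geodesic adj r j)}"

text \<open>The geodesic consists of the iterated parents of \<open>j\<close>, and the level of an
  entry tells how many steps lead to it.\<close>

lemma branch_iff: "j \<in> branch i \<longleftrightarrow> lev i \<le> lev j \<and> (par ^^ (lev j - lev i)) j = i"
proof
  assume "j \<in> branch i"
  then obtain s where "s \<le> lev j" "i = (par ^^ s) j"
    by (auto simp: branch_def geodesic_eq descent_def less_Suc_eq_le simp del: upt_Suc)
  then show "lev i \<le> lev j \<and> (par ^^ (lev j - lev i)) j = i" by (simp add: lev_par_pow)
next
  assume "lev i \<le> lev j \<and> (par ^^ (lev j - lev i)) j = i"
  then have "\<exists>s\<le>lev j. i = (par ^^ s) j" by (metis diff_le_self)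
  then show "j \<in> branch i"
    by (auto simp: branch_def geodesic_eq descent_def simp del: upt_Suc)
qed

lemma branch_self [simp]: "i \<in> branch i" by (simp add: branch_iff)

lemma branch_root [simp]: "branch r = UNIV"
proof -
  have "j \<in> branch r" for j
    using lev_par_pow[of "lev j" j] by (simp add: branch_iff)
  then show ?thesis by blast
qed

lemma branch_lev: "j \<in> branch i \<Longrightarrow> lev i \<le> lev j" by (simp add: branch_iff)

lemma branch_par: "j \<noteq> r \<Longrightarrow> j \<in> branch i \<longleftrightarrow> j = i \<or> par j \<in> branch i"
proof -
  assume "j \<noteq> r"
  then have l: "lev j = Suc (lev (par j))" by (simp add: lev_par)
  show ?thesis
  proof (cases "lev i \<le> lev (par j)")
    case True
    then have "lev j - lev i = Suc (lev (par j) - lev i)" using l by simp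
    moreover have "j \<noteq> i" using True l by auto
    ultimately show ?thesis using True l by (simp add: branch_iff funpow_swap1)
  next
    case False
    then show ?thesis using l by (auto simp: branch_iff)
  qed
qed

lemma branch_same_level: "j \<in> branch i \<Longrightarrow> j \<in> branch k \<Longrightarrow> lev i = lev k \<Longrightarrow> i = k"
  by (simp add: branch_iff)

lemma branch_trans: "k \<in> branch j \<Longrightarrow> j \<in> branch i \<Longrightarrow> k \<in> branch i"
proof -
  assume "k \<in> branch j" "j \<in> branch i"
  then have a: "lev j \<le> lev k" "(par ^^ (lev k - lev j)) k = j" "lev i \<le> lev j" "(par ^^ (lev j - lev i)) j = i"
    by (auto simp: branch_iff)
  then have "lev k - lev i = (lev j - lev i) + (lev k - lev j)" by simp
  then have "(par ^^ (lev k - lev i)) k = (par ^^ (lev j - lev i)) ((par ^^ (lev k - lev j)) k)"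
    by (simp only: funpow_add o_apply)
  also have "\<dots> = i" unfolding a(2) by (rule a(4))
  finally show ?thesis unfolding branch_iff using order_trans[OF a(3) a(1)] by blast
qed

lemma branch_succ: "j \<in> succs i \<Longrightarrow> branch j \<subseteq> branch i"
proof -
  assume "j \<in> succs i"
  then have "j \<noteq> r" "par j = i" by (simp_all add: succs_iff)
  then have "j \<in> branch i" using branch_par[of j i] branch_self[of i] by metis
  then show ?thesis using branch_trans by blast
qed

lemma branch_decomp: "branch i = insert i (\<Union>j\<in>succs i. branch j)"
proof (intro equalityI subsetI)
  fix k assume "k \<in> branch i"
  then show "k \<in> insert i (\<Union>j\<in>succs i. branch j)"
  proof (induction "lev k" arbitrary: k)
    case 0
    then have "lev k = lev i" using branch_lev[of k i] by simp
    then show ?case using 0(2) by (simp add: branch_iff)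
  next
    case (Suc n)
    have kr: "k \<noteq> r" using Suc(2) by auto
    show ?case
    proof (cases "k = i")
      case False
      then have "par k \<in> branch i" using Suc.prems branch_par[OF kr] by blast
      moreover have "n = lev (par k)" using lev_par[OF kr] Suc(2) by simp
      ultimately have "par k \<in> insert i (\<Union>j\<in>succs i. branch j)" using Suc(1) by blast
      then consider "par k = i" | j where "j \<in> succs i" "par k \<in> branch j" by blast
      then show ?thesis
      proof cases
        case 1
        then have "k \<in> succs i" using kr by (simp add: succs_iff)
        then show ?thesis using branch_self by blast
      next
        case 2
        then have "k \<in> branch j" using branch_par[OF kr] by blast
        then show ?thesis using 2 by blast
      qed
    qed simp
  qed
next
  fix k assume "k \<in> insert i (\<Union>j\<in>succs i. branch j)"
  then show "k \<in> branch i" using branch_succ by auto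
qed

lemma not_branch_succ: "j \<in> succs i \<Longrightarrow> i \<notin> branch j"
  using branch_lev[of i j] lev_succ[of j i] by auto

lemma branch_disjoint: "j \<in> succs i \<Longrightarrow> k \<in> succs i \<Longrightarrow> j \<noteq> k \<Longrightarrow> branch j \<inter> branch k = {}"
  using branch_same_level[of _ j k] lev_succ[of j i] lev_succ[of k i] by auto

section \<open>Spheres and rays\<close>

definition sphere :: "nat \<Rightarrow> 'v set" where "sphere n = {i. lev i = n}"

lemma sphere_0 [simp]: "sphere 0 = {r}" by (auto simp: sphere_def)

lemma sphere_Suc: "sphere (Suc n) = (\<Union>i\<in>sphere n. succs i)"
proof (intro equalityI subsetI)
  fix j assume "j \<in> sphere (Suc n)"
  then have l: "lev j = Suc n" by (simp add: sphere_def)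
  then have "j \<noteq> r" by auto
  then have "par j \<in> sphere n" "j \<in> succs (par j)" using lev_par[of j] l by (auto simp: sphere_def succs_iff)
  then show "j \<in> (\<Union>i\<in>sphere n. succs i)" by blast
qed (auto simp: sphere_def lev_succ)

lemma finite_sphere [simp]: "finite (sphere n)"
  by (induction n) (auto simp: sphere_Suc finite_succs)

lemma sum_sphere_Suc: "(\<Sum>j\<in>sphere (Suc n). f j) = (\<Sum>i\<in>sphere n. \<Sum>j\<in>succs i. f j)"
  unfolding sphere_Suc by (rule sum.UNION_disjoint) (auto simp: finite_succs succs_iff)

lemma ray_succ: "\<xi> \<in> rays adj r \<Longrightarrow> \<xi> (Suc n) \<in> succs (\<xi> n)"
  and ray_0: "\<xi> \<in> rays adj r \<Longrightarrow> \<xi> 0 = r"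
  by (auto simp: rays_def)

lemma ray_par: "\<xi> \<in> rays adj r \<Longrightarrow> par (\<xi> (Suc n)) = \<xi> n"
  using ray_succ[of \<xi> n] by (simp add: succs_iff)

lemma ray_lev: "\<xi> \<in> rays adj r \<Longrightarrow> lev (\<xi> n) = n"
proof (induction n)
  case (Suc n)
  then show ?case using lev_succ[OF ray_succ[of \<xi> n]] by simp
qed (simp add: ray_0)

text \<open>Each vertex of a ray determines the preceding one as its parent, so agreement propagates
  towards the root; this supplies \<open>refine\<close>.\<close>

lemma ray_eq_below: "\<xi> \<in> rays adj r \<Longrightarrow> \<eta> \<in> rays adj r \<Longrightarrow> \<xi> n = \<eta> n \<Longrightarrow> m \<le> n \<Longrightarrow> \<xi> m = \<eta> m"
proof (induction n)
  case (Suc n)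
  then have "\<xi> n = \<eta> n" using ray_par[of \<xi> n] ray_par[of \<eta> n] by simp
  then show ?case using Suc by (cases "m = Suc n") auto
qed simp

end


section \<open>Jump chains\<close>

locale jump_chain = prob_space M for M :: "'w measure" +
  fixes q :: "'s \<Rightarrow> 's \<Rightarrow> real" and x :: 's
    and Y :: "nat \<Rightarrow> 'w \<Rightarrow> 's" and H :: "nat \<Rightarrow> 'w \<Rightarrow> ennreal"
  assumes law: "jump_hold_law M q x Y H"
    and countable_states: "countable (UNIV :: 's set)"
    and jump_prob_nonneg: "\<And>a b. 0 \<le> jump_prob q a b"
begin

abbreviation jp :: "'s \<Rightarrow> 's \<Rightarrow> real" where "jp \<equiv> jump_prob q"

lemma Y_measurable [measurable]: "Y k \<in> measurable M (count_space UNIV)"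
  and H_measurable [measurable]: "H k \<in> borel_measurable M"
  and H_pos: "\<omega> \<in> space M \<Longrightarrow> 0 < H k \<omega>"
  using law by (auto simp: jump_hold_law_def)

lemma law_eq:
  assumes "\<And>k. k \<le> n \<Longrightarrow> 0 \<le> s k"
  shows "prob {\<omega> \<in> space M. \<forall>k\<le>n. Y k \<omega> = i k \<and> ennreal (s k) < H k \<omega>} =
    of_bool (i 0 = x) * (\<Prod>k<n. jp (i k) (i (Suc k))) * (\<Prod>k\<le>n. exp (q (i k) (i k) * s k))"
  using law assms unfolding jump_hold_law_def by blast

lemma path_prob:
  "prob {\<omega> \<in> space M. \<forall>k\<le>n. Y k \<omega> = i k} = of_bool (i 0 = x) * (\<Prod>k<n. jp (i k) (i (Suc k)))"
proof -
  \<comment> \<open>All thresholds are 0 and impose nothing, because the holding times are positive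
    everywhere.\<close>
  have "{\<omega> \<in> space M. \<forall>k\<le>n. Y k \<omega> = i k} = {\<omega> \<in> space M. \<forall>k\<le>n. Y k \<omega> = i k \<and> ennreal 0 < H k \<omega>}"
    using H_pos by auto
  then show ?thesis using law_eq[of n "\<lambda>_. 0" i] by simp
qed

lemma prob_start: "prob {\<omega> \<in> space M. Y 0 \<omega> = y} = of_bool (y = x)"
  using path_prob[of 0 "\<lambda>_. y"] by simp

lemma AE_start: "AE \<omega> in M. Y 0 \<omega> = x"
  using prob_start[of x] by (subst prob_Collect_eq_1[symmetric]) auto

text \<open>Total probability over the value of \<open>Y m\<close>, as an \<open>ennreal\<close>
  integral so that no summability has to be tracked.\<close>

lemma emeasure_split:
  assumes A: "A \<in> sets M"
  shows "emeasure M A = (\<integral>\<^sup>+s. emeasure M {\<omega> \<in> A. Y m \<omega> = s} \<partial>count_space UNIV)"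
proof -
  have meas: "{\<omega> \<in> A. Y m \<omega> = s} \<in> sets M" for s
  proof -
    have "{\<omega> \<in> A. Y m \<omega> = s} = A \<inter> {\<omega> \<in> space M. Y m \<omega> = s}"
      using sets.sets_into_space[OF A] by auto
    then show ?thesis using A by simp
  qed
  have "emeasure M (\<Union>s\<in>UNIV. {\<omega> \<in> A. Y m \<omega> = s}) = (\<integral>\<^sup>+s. emeasure M {\<omega> \<in> A. Y m \<omega> = s} \<partial>count_space UNIV)"
    by (rule emeasure_UN_countable) (use meas countable_states in \<open>auto simp: disjoint_family_on_def\<close>)
  moreover have "(\<Union>s\<in>UNIV. {\<omega> \<in> A. Y m \<omega> = s}) = A" by auto
  ultimately show ?thesis by simp
qed

text \<open>The Markov property, obtained by summing the path probabilities over the states before time \<open>m\<close>.\<close>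

lemma markov:
  assumes "m \<le> n"
  shows "prob {\<omega> \<in> space M. \<forall>k. m \<le> k \<and> k \<le> Suc n \<longrightarrow> Y k \<omega> = i k}
    = prob {\<omega> \<in> space M. \<forall>k. m \<le> k \<and> k \<le> n \<longrightarrow> Y k \<omega> = i k} * jp (i n) (i (Suc n))"
  using assms
proof (induction m arbitrary: i)
  case 0
  show ?case using path_prob[of "Suc n" i] path_prob[of n i] by simp
next
  case (Suc m)
  define A where "A n m i = {\<omega> \<in> space M. \<forall>k. m \<le> k \<and> k \<le> n \<longrightarrow> Y k \<omega> = i k}" for n m i
  have A_sets [measurable]: "A n m i \<in> sets M" for n m i unfolding A_def by measurable
  \<comment> \<open>Prescribing also \<open>Y m \<omega> = s\<close> amounts to starting one index
    lower with the sequence overridden at \<open>m\<close>, which fits the induction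
    hypothesis.\<close>
  have sub: "{\<omega> \<in> A n' (Suc m) i. Y m \<omega> = s} = A n' m (i(m := s))" if "m \<le> n'" for n' s i
  proof -
    have *: "m \<le> k \<and> k \<le> n' \<longleftrightarrow> k = m \<or> (Suc m \<le> k \<and> k \<le> n')" for k using that by auto
    have "(\<forall>k. m \<le> k \<and> k \<le> n' \<longrightarrow> Y k \<omega> = (i(m := s)) k)
        \<longleftrightarrow> Y m \<omega> = s \<and> (\<forall>k. Suc m \<le> k \<and> k \<le> n' \<longrightarrow> Y k \<omega> = i k)" for \<omega>
      unfolding * by (metis fun_upd_apply not_less_eq_eq order_refl)
    then show ?thesis unfolding A_def by auto
  qed
  have nm: "n \<noteq> m" "Suc n \<noteq> m" using Suc.prems by auto
  have eq: "emeasure M (A (Suc n) m (i(m := s))) = emeasure M (A n m (i(m := s))) * ennreal (jp (i n) (i (Suc n)))" for s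
  proof -
    have "measure M (A (Suc n) m (i(m := s))) = measure M (A n m (i(m := s))) * jp (i n) (i (Suc n))"
      using Suc.IH[of "i(m := s)"] Suc.prems nm by (simp add: A_def del: fun_upd_apply add: fun_upd_other)
    then show ?thesis
      by (simp add: emeasure_eq_measure ennreal_mult jump_prob_nonneg)
  qed
  have "emeasure M (A (Suc n) (Suc m) i) = (\<integral>\<^sup>+s. emeasure M (A n m (i(m := s))) * ennreal (jp (i n) (i (Suc n))) \<partial>count_space UNIV)"
    using Suc.prems by (subst emeasure_split[of _ m]) (simp_all only: sub eq A_sets Suc_leD le_SucI)
  also have "\<dots> = (\<integral>\<^sup>+s. emeasure M (A n m (i(m := s))) \<partial>count_space UNIV) * ennreal (jp (i n) (i (Suc n)))"
    by (rule nn_integral_multc) simp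
  also have "\<dots> = emeasure M (A n (Suc m) i) * ennreal (jp (i n) (i (Suc n)))"
  proof (rule arg_cong[where f = "\<lambda>t. t * _"])
    show "(\<integral>\<^sup>+s. emeasure M (A n m (i(m := s))) \<partial>count_space UNIV) = emeasure M (A n (Suc m) i)"
      using Suc.prems by (subst emeasure_split[of "A n (Suc m) i" m]) (simp_all only: sub A_sets Suc_leD)
  qed
  finally have *: "ennreal (measure M (A (Suc n) (Suc m) i)) = ennreal (measure M (A n (Suc m) i)) * ennreal (jp (i n) (i (Suc n)))"
    by (simp add: emeasure_eq_measure)
  then show ?case by (simp add: A_def jump_prob_nonneg flip: ennreal_mult)
qed

lemma prob_two_step:
  "prob {\<omega> \<in> space M. Y n \<omega> = a \<and> Y (Suc n) \<omega> = b} = prob {\<omega> \<in> space M. Y n \<omega> = a} * jp a b"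
proof -
  have 1: "(\<forall>k. n \<le> k \<and> k \<le> Suc n \<longrightarrow> Y k \<omega> = ((\<lambda>_. a)(Suc n := b)) k) \<longleftrightarrow> Y n \<omega> = a \<and> Y (Suc n) \<omega> = b" for \<omega>
  proof -
    have *: "n \<le> k \<and> k \<le> Suc n \<longleftrightarrow> k = n \<or> k = Suc n" for k by linarith
    show ?thesis unfolding * by (metis fun_upd_apply n_not_Suc_n)
  qed
  have 2: "(\<forall>k. n \<le> k \<and> k \<le> n \<longrightarrow> Y k \<omega> = ((\<lambda>_. a)(Suc n := b)) k) \<longleftrightarrow> Y n \<omega> = a" for \<omega>
    by auto
  show ?thesis using markov[of n n "(\<lambda>_. a)(Suc n := b)"] unfolding 1 2 by simp
qed

text \<open>Countably many pairs of states and times give one null set outside which no forbidden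
  transition occurs; later arguments can then be pathwise.\<close>

lemma AE_step: "AE \<omega> in M. \<forall>n. jp (Y n \<omega>) (Y (Suc n) \<omega>) \<noteq> 0"
proof -
  have "AE \<omega> in M. \<forall>a\<in>UNIV. \<forall>b\<in>UNIV. jp a b = 0 \<longrightarrow> \<not> (Y n \<omega> = a \<and> Y (Suc n) \<omega> = b)" for n
  proof (intro AE_ball_countable'[OF _ countable_states])
    fix a b
    show "AE \<omega> in M. jp a b = 0 \<longrightarrow> \<not> (Y n \<omega> = a \<and> Y (Suc n) \<omega> = b)"
    proof (cases "jp a b = 0")
      case True
      then have "prob {\<omega> \<in> space M. Y n \<omega> = a \<and> Y (Suc n) \<omega> = b} = 0" by (simp add: prob_two_step)
      then have "AE \<omega> in M. \<not> (Y n \<omega> = a \<and> Y (Suc n) \<omega> = b)"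
        by (subst prob_Collect_eq_0[symmetric]) auto
      then show ?thesis by eventually_elim simp
    qed simp
  qed
  then have "AE \<omega> in M. jp (Y n \<omega>) (Y (Suc n) \<omega>) \<noteq> 0" for n
    by (rule eventually_mono) auto
  then show ?thesis by (simp add: AE_all_countable)
qed

text \<open>For a fixed history up to time \<open>n\<close> the exponential tail tends to 0, and
  there are countably many histories.\<close>

lemma AE_finite_hold: "AE \<omega> in M. \<forall>n. q (Y n \<omega>) (Y n \<omega>) < 0 \<longrightarrow> H n \<omega> < \<infinity>"
proof -
  have null: "AE \<omega> in M. \<not> ((\<forall>k\<le>n. Y k \<omega> = i k) \<and> H n \<omega> = \<infinity>)" if neg: "q (i n) (i n) < 0" for i n
  proof -
    let ?A = "{\<omega> \<in> space M. (\<forall>k\<le>n. Y k \<omega> = i k) \<and> H n \<omega> = \<infinity>}"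
    define c where "c = of_bool (i 0 = x) * (\<Prod>k<n. jp (i k) (i (Suc k)))"
    have "prob ?A \<le> c * exp (q (i n) (i n) * real m)" for m
    proof -
      \<comment> \<open>Only the last holding time is constrained.\<close>
      let ?s = "\<lambda>k. if k = n then real m else 0"
      have "prob ?A \<le> prob {\<omega> \<in> space M. \<forall>k\<le>n. Y k \<omega> = i k \<and> ennreal (?s k) < H k \<omega>}"
        using H_pos by (intro finite_measure_mono) (auto simp: less_top[symmetric])
      also have "\<dots> = c * (\<Prod>k\<le>n. exp (q (i k) (i k) * ?s k))"
        unfolding c_def by (rule law_eq) simp
      also have "(\<Prod>k\<le>n. exp (q (i k) (i k) * ?s k)) = exp (q (i n) (i n) * real m)"
        by (subst prod.remove[of _ n]) auto
      finally show ?thesis .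
    qed
    moreover have "(\<lambda>m. c * exp (q (i n) (i n) * real m)) \<longlonglongrightarrow> c * 0"
    proof (intro tendsto_mult tendsto_const)
      have "(\<lambda>m. exp (q (i n) (i n)) ^ m) \<longlonglongrightarrow> 0"
        using neg by (intro LIMSEQ_realpow_zero) auto
      then show "(\<lambda>m. exp (q (i n) (i n) * real m)) \<longlonglongrightarrow> 0"
        by (simp add: exp_of_nat_mult[symmetric] mult.commute)
    qed
    ultimately have "prob ?A \<le> c * 0"
      by (intro LIMSEQ_le_const) auto
    then have "prob ?A = 0" by (simp add: measure_le_0_iff)
    then show ?thesis by (subst prob_Collect_eq_0[symmetric]) auto
  qed
  \<comment> \<open>Histories are encoded as lists, which are countably many, unlike functions on
    \<open>nat\<close>.\<close>
  have "AE \<omega> in M. \<forall>l\<in>lists UNIV. q (l ! n) (l ! n) < 0 \<longrightarrow> \<not> ((\<forall>k\<le>n. Y k \<omega> = l ! k) \<and> H n \<omega> = \<infinity>)" for n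
    using null by (intro AE_ball_countable' countable_lists countable_states) auto
  then have "AE \<omega> in M. \<forall>n. \<forall>l\<in>lists UNIV. q (l ! n) (l ! n) < 0 \<longrightarrow> \<not> ((\<forall>k\<le>n. Y k \<omega> = l ! k) \<and> H n \<omega> = \<infinity>)"
    by (simp add: AE_all_countable)
  then show ?thesis
  proof eventually_elim
    case (elim \<omega>)
    show ?case
    proof (intro allI impI)
      fix n assume "q (Y n \<omega>) (Y n \<omega>) < 0"
      moreover have "map (\<lambda>k. Y k \<omega>) [0..<Suc n] ! k = Y k \<omega>" if "k \<le> n" for k
        using that by (simp del: upt_Suc)
      ultimately show "H n \<omega> < \<infinity>"
        using bspec[OF spec[OF elim, of n], of "map (\<lambda>k. Y k \<omega>) [0..<Suc n]"]
        by (simp add: less_top del: upt_Suc)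
    qed
  qed
qed

end


section \<open>The chain on the tree\<close>

locale tree_weights = rooted_tree adj r for adj :: "'v \<Rightarrow> 'v \<Rightarrow> bool" and r :: 'v +
  fixes w :: "nat \<Rightarrow> real"
  assumes w_mono: "strict_mono w" and w_pos: "\<And>n. 0 < w n"
begin

abbreviation \<delta> :: "nat \<Rightarrow> real" where "\<delta> \<equiv> increment w"

lemma increment_pos: "0 < \<delta> n"
  using strict_monoD[OF w_mono, of "n - 1" n] w_pos by (auto simp: increment_def)

lemma increment_0 [simp]: "\<delta> 0 = w 0" by (simp add: increment_def)

definition rate :: "'v \<Rightarrow> real" where "rate i = - Q_matrix adj r w i i"

lemma rate_pos: "0 < rate i"
proof -
  have "0 < 1 / \<delta> (lev i)" "0 \<le> real (card (succs i)) / \<delta> (Suc (lev i))"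
    using increment_pos by (simp_all add: less_imp_le)
  then have "0 < 1 / \<delta> (lev i) + real (card (succs i)) / \<delta> (Suc (lev i))"
    by (rule add_pos_nonneg)
  then show ?thesis unfolding rate_def Q_matrix_def by simp
qed

abbreviation tp :: "'v state \<Rightarrow> 'v state \<Rightarrow> real" where "tp \<equiv> jump_prob (Q_absorbed adj r w)"

lemma tp_nonneg: "0 \<le> tp a b"
proof (cases a)
  case (Site i)
  have "Q_absorbed adj r w (Site i) (Site i) < 0" using rate_pos[of i] by (simp add: rate_def)
  moreover have "0 \<le> Q_absorbed adj r w (Site i) b" if "Site i \<noteq> b"
    using that by (cases b) (auto simp: Q_matrix_def less_imp_le increment_pos w_pos)
  ultimately show ?thesis using Site by (simp add: jump_prob_def divide_nonneg_neg)
qed (simp add: jump_prob_def)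

lemma tp_par: "i \<noteq> r \<Longrightarrow> tp (Site i) (Site (par i)) = 1 / (\<delta> (lev i) * rate i)"
proof -
  assume i: "i \<noteq> r"
  have "Q_matrix adj r w i (par i) = 1 / \<delta> (lev i)"
    using par_neq[OF i] i unfolding Q_matrix_def by (metis (full_types))
  moreover have "Q_matrix adj r w i i = - rate i" by (simp add: rate_def)
  ultimately show ?thesis
    using rate_pos[of i] par_neq[OF i] by (auto simp: jump_prob_def)
qed

text \<open>Together with \<open>tp_par\<close>: \<open>rate\<close> times the jump probability is
  the conductance \<open>1 / \<delta> (lev i)\<close> in both directions. This reversibility makes
  potential differences proportional to net crossings.\<close>

lemma tp_succ:
  assumes "i \<noteq> r"
  shows "tp (Site (par i)) (Site i) = 1 / (\<delta> (lev i) * rate (par i))"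
proof -
  have "\<not> (par i \<noteq> r \<and> i = par (par i))"
    using lev_par[OF assms] lev_par[of "par i"] by auto
  then have "Q_matrix adj r w (par i) i = 1 / \<delta> (lev i)"
    using par_neq[OF assms] assms unfolding Q_matrix_def by (metis (full_types))
  moreover have "Q_matrix adj r w (par i) (par i) = - rate (par i)" by (simp add: rate_def)
  ultimately show ?thesis
    using rate_pos[of "par i"] par_neq[OF assms] by (auto simp: jump_prob_def)
qed

lemma tp_absorb: "tp (Site r) Absorbed = 1 / (w 0 * rate r)"
  using rate_pos[of r] by (auto simp: jump_prob_def rate_def)

lemma tp_nonzeroE:
  assumes "tp a b \<noteq> 0"
  obtains "a = Absorbed" "b = Absorbed"
  | "a = Site r" "b = Absorbed"
  | i where "i \<noteq> r" "a = Site i" "b = Site (par i)"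
  | i where "i \<noteq> r" "a = Site (par i)" "b = Site i"
proof (cases a)
  case Absorbed
  then show ?thesis using assms that(1) by (auto simp: jump_prob_def split: if_splits)
next
  case (Site i)
  have n: "Q_absorbed adj r w a a \<noteq> 0" using rate_pos[of i] by (simp add: rate_def Site)
  then have nb: "a \<noteq> b" "Q_absorbed adj r w a b \<noteq> 0" using assms by (auto simp: jump_prob_def split: if_splits)
  show ?thesis
  proof (cases b)
    case Absorbed
    then show ?thesis using nb that(2) by (auto simp: Site split: if_splits)
  next
    case b: (Site j)
    have "i \<noteq> j" "Q_matrix adj r w i j \<noteq> 0" using nb by (simp_all add: Site b)
    then have "(i \<noteq> r \<and> j = par i) \<or> (j \<noteq> r \<and> i = par j)"
      unfolding Q_matrix_def by metis
    then show ?thesis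
    proof (elim disjE conjE)
      assume "i \<noteq> r" "j = par i"
      then show ?thesis by (intro that(3)[of i]) (simp_all add: Site b)
    next
      assume "j \<noteq> r" "i = par j"
      then show ?thesis by (intro that(4)[of j]) (simp_all add: Site b)
    qed
  qed
qed

text \<open>The only edges of the extended tree between a branch and its complement are \<open>{i, par i}\<close>, or \<open>{r, \<partial>\<^sub>r}\<close>.\<close>

lemma leave_branch:
  assumes "tp a b \<noteq> 0" "a \<in> Site ` branch i" "b \<notin> Site ` branch i"
  shows "a = Site i" "b = (if i = r then Absorbed else Site (par i))"
proof -
  have "a = Site i \<and> b = (if i = r then Absorbed else Site (par i))"
    using assms(1)
  proof (cases rule: tp_nonzeroE)
    case 1 then show ?thesis using assms by auto
  next
    case 2
    then have "r \<in> branch i" using assms by auto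
    then have "i = r" using branch_lev[of r i] by simp
    then show ?thesis using 2 by simp
  next
    case (3 k)
    then have "k \<in> branch i" "par k \<notin> branch i" using assms by auto
    then have "k = i" using branch_par[OF 3(1), of i] by blast
    then show ?thesis using 3 by simp
  next
    case (4 k)
    then have "par k \<in> branch i" "k \<notin> branch i" using assms by auto
    then show ?thesis using branch_par[OF 4(1), of i] by blast
  qed
  then show "a = Site i" "b = (if i = r then Absorbed else Site (par i))" by auto
qed

text \<open>The branch at the root can be left but not entered, since its complement is the
  absorbing extra state.\<close>

lemma enter_branch:
  assumes "tp a b \<noteq> 0" "a \<notin> Site ` branch i" "b \<in> Site ` branch i"
  shows "i \<noteq> r \<and> a = Site (par i) \<and> b = Site i"
  using assms(1)
proof (cases rule: tp_nonzeroE)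
  case 1 then show ?thesis using assms by auto
next
  case 2 then show ?thesis using assms by auto
next
  case (3 k)
  then have "k \<notin> branch i" "par k \<in> branch i" using assms by auto
  then show ?thesis using branch_par[OF 3(1), of i] by blast
next
  case (4 k)
  then have k: "par k \<notin> branch i" "k \<in> branch i" using assms by auto
  then have "k = i" using branch_par[OF 4(1), of i] by blast
  then show ?thesis using 4 by simp
qed

text \<open>The value at the parent, with value \<open>w 0\<close> at the extra state \<open>\<partial>\<^sub>r\<close> above the root.\<close>

definition above :: "('v \<Rightarrow> real) \<Rightarrow> 'v \<Rightarrow> real" where
  "above f i = (if i = r then w 0 else f (par i))"

text \<open>Green's formula for a flow \<open>c\<close> down the tree that loses \<open>s i\<close>
  at \<open>i\<close>: the parent terms of one level cancel the boundary term of the previous one.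
  The term \<open>w 0 * c r\<close> is the boundary value above the root.\<close>

lemma energy_by_parts:
  assumes c: "\<And>i. c i = s i + (\<Sum>j\<in>succs i. c j)"
  shows "(\<Sum>k\<le>m. \<Sum>j\<in>sphere k. (above f j - f j) * c j)
    = w 0 * c r - (\<Sum>i\<in>sphere m. f i * c i) - (\<Sum>k<m. \<Sum>i\<in>sphere k. f i * s i)"
proof (induction m)
  case 0
  show ?case by (simp add: above_def algebra_simps)
next
  case (Suc m)
  have "(\<Sum>j\<in>sphere (Suc m). above f j * c j) = (\<Sum>i\<in>sphere m. \<Sum>j\<in>succs i. f i * c j)"
    unfolding sum_sphere_Suc by (intro sum.cong refl) (auto simp: above_def succs_iff)
  also have "\<dots> = (\<Sum>i\<in>sphere m. f i * c i) - (\<Sum>i\<in>sphere m. f i * s i)"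
    unfolding sum_subtractf[symmetric]
  proof (intro sum.cong refl)
    fix i
    have "(\<Sum>j\<in>succs i. f i * c j) = f i * (\<Sum>j\<in>succs i. c j)" by (simp add: sum_distrib_left)
    also have "(\<Sum>j\<in>succs i. c j) = c i - s i" using c[of i] by linarith
    finally show "(\<Sum>j\<in>succs i. f i * c j) = f i * c i - f i * s i" by (simp add: right_diff_distrib)
  qed
  finally show ?case
    using Suc by (simp add: left_diff_distrib sum_subtractf)
qed

end


locale tree_chain = tree_weights adj r w + prob_space M
  for adj :: "'v \<Rightarrow> 'v \<Rightarrow> bool" and r :: 'v and w :: "nat \<Rightarrow> real" and M :: "'w measure" +
  fixes Y :: "nat \<Rightarrow> 'w \<Rightarrow> 'v state" and H :: "nat \<Rightarrow> 'w \<Rightarrow> ennreal"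
  assumes tree_law: "jump_hold_law M (Q_absorbed adj r w) (Site r) Y H"
begin

lemma countable_tree_states: "countable (UNIV :: 'v state set)"
proof -
  have "(UNIV :: 'v state set) = insert Absorbed (Site ` UNIV)"
      by (auto simp: image_iff) (metis state.exhaust)
  then show ?thesis using countable_image[OF countable_sites, of Site] countable_insert by metis
qed

sublocale jump_chain M "Q_absorbed adj r w" "Site r" Y H
  by unfold_locales (rule tree_law countable_tree_states tp_nonneg)+

lemma Y_pred [measurable]: "Measurable.pred M (\<lambda>\<omega>. Y n \<omega> \<in> S)" "Measurable.pred M (\<lambda>\<omega>. Y n \<omega> = s)"
  by (rule measurable_compose[OF Y_measurable], simp)+

section \<open>Occupation probabilities and net crossings of an edge\<close>

definition occ :: "nat \<Rightarrow> 'v \<Rightarrow> real" where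
  "occ n i = prob {\<omega> \<in> space M. Y n \<omega> = Site i}"

definition inb :: "nat \<Rightarrow> 'v \<Rightarrow> real" where
  "inb n i = prob {\<omega> \<in> space M. Y n \<omega> \<in> Site ` branch i}"

definition green :: "nat \<Rightarrow> 'v \<Rightarrow> real" where
  "green N i = (\<Sum>n<N. occ n i / rate i)"

lemma occ_nonneg: "0 \<le> occ n i" by (simp add: occ_def)
lemma inb_nonneg: "0 \<le> inb n i" by (simp add: inb_def)

lemma green_nonneg: "0 \<le> green N i"
  unfolding green_def using rate_pos by (intro sum_nonneg divide_nonneg_pos occ_nonneg)

text \<open>The probability changes by that of entering minus that of leaving in one step, and
  almost surely both use the single edge above the branch.\<close>

lemma inb_Suc:
  "inb (Suc n) i - inb n i =
    (if i = r then 0 else prob {\<omega> \<in> space M. Y n \<omega> = Site (par i) \<and> Y (Suc n) \<omega> = Site i})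
    - prob {\<omega> \<in> space M. Y n \<omega> = Site i \<and> Y (Suc n) \<omega> = (if i = r then Absorbed else Site (par i))}"
proof -
  define B where "B n = {\<omega> \<in> space M. Y n \<omega> \<in> Site ` branch i}" for n
  define I where "I = {\<omega> \<in> space M. i \<noteq> r \<and> Y n \<omega> = Site (par i) \<and> Y (Suc n) \<omega> = Site i}"
  define L where "L = {\<omega> \<in> space M. Y n \<omega> = Site i \<and> Y (Suc n) \<omega> = (if i = r then Absorbed else Site (par i))}"
  have [measurable]: "B n \<in> sets M" "I \<in> sets M" "L \<in> sets M" for n
    unfolding B_def I_def L_def by measurable
  have par_notin: "par i \<notin> branch i" if "i \<noteq> r"
    using branch_lev[of "par i" i] lev_par[OF that] by auto
  have "prob (B (Suc n) - B n) = prob I"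
  proof (rule finite_measure_eq_AE)
    show "AE \<omega> in M. \<omega> \<in> B (Suc n) - B n \<longleftrightarrow> \<omega> \<in> I"
      using AE_step
    proof eventually_elim
      case (elim \<omega>)
      then show ?case
        using enter_branch[of "Y n \<omega>" "Y (Suc n) \<omega>" i] par_notin by (auto simp: B_def I_def)
    qed
  qed auto
  moreover have "prob (B n - B (Suc n)) = prob L"
  proof (rule finite_measure_eq_AE)
    show "AE \<omega> in M. \<omega> \<in> B n - B (Suc n) \<longleftrightarrow> \<omega> \<in> L"
      using AE_step
    proof eventually_elim
      case (elim \<omega>)
      then show ?case
        using leave_branch[of "Y n \<omega>" "Y (Suc n) \<omega>" i] par_notin by (auto simp: B_def L_def)
    qed
  qed auto
  moreover have "prob (B (Suc n) - B n) = prob (B (Suc n)) - prob (B (Suc n) \<inter> B n)"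
    "prob (B n - B (Suc n)) = prob (B n) - prob (B n \<inter> B (Suc n))"
    by (rule finite_measure_Diff'; measurable)+
  ultimately have "prob (B (Suc n)) - prob (B n) = prob I - prob L"
    by (simp add: Int_commute)
  moreover have "prob I = (if i = r then 0 else prob {\<omega> \<in> space M. Y n \<omega> = Site (par i) \<and> Y (Suc n) \<omega> = Site i})"
    by (auto simp: I_def)
  ultimately show ?thesis
    unfolding inb_def B_def L_def by simp
qed

text \<open>At each step the net crossings of the edge, times its resistance
  \<open>\<delta> (lev i)\<close>, equal the difference of the visit probabilities over the rates.
  For \<open>N = 0\<close> the value \<open>w 0\<close> above the root accounts for the start at
  \<open>r\<close>.\<close>

lemma above_green: "above (green N) i - green N i = \<delta> (lev i) * inb N i"
proof (induction N)
  case 0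
  have "inb 0 i = prob {\<omega> \<in> space M. (i = r)}"
    unfolding inb_def
  proof (rule finite_measure_eq_AE)
    have "r \<in> branch i \<longleftrightarrow> i = r" using branch_lev[of r i] by auto
    with AE_start show "AE \<omega> in M. \<omega> \<in> {\<omega> \<in> space M. Y 0 \<omega> \<in> Site ` branch i} \<longleftrightarrow> \<omega> \<in> {\<omega> \<in> space M. i = r}"
      by (elim eventually_mono) auto
  qed auto
  then show ?case by (auto simp: above_def green_def prob_space)
next
  case (Suc N)
  show ?case
  proof (cases "i = r")
    case True
    have eq: "inb (Suc N) r - inb N r = - (occ N r / (w 0 * rate r))"
      using inb_Suc[of N r] prob_two_step[of N "Site r" Absorbed] by (simp add: tp_absorb occ_def)
    have "w 0 * (inb (Suc N) r - inb N r) = - (occ N r / rate r)"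
      unfolding eq using w_pos[of 0] by simp
    then show ?thesis using Suc True by (simp add: above_def green_def right_diff_distrib)
  next
    case False
    have "inb (Suc N) i - inb N i = occ N (par i) / (\<delta> (lev i) * rate (par i)) - occ N i / (\<delta> (lev i) * rate i)"
      using inb_Suc[of N i] False prob_two_step[of N "Site (par i)" "Site i"] prob_two_step[of N "Site i" "Site (par i)"]
      by (simp add: tp_succ tp_par occ_def)
    then have "\<delta> (lev i) * (inb (Suc N) i - inb N i) = occ N (par i) / rate (par i) - occ N i / rate i"
      using increment_pos[of "lev i"] by (simp add: right_diff_distrib)
    then show ?thesis using Suc False by (simp add: above_def green_def right_diff_distrib)
  qed
qed

text \<open>By \<open>above_green\<close> the potential does not increase away from the extra state,
  where its value is \<open>w 0\<close>.\<close>

lemma green_le: "green N i \<le> w 0"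
proof (induction "lev i" arbitrary: i)
  case 0
  then have "i = r" by (metis lev_eq_0_iff)
  moreover have "0 \<le> \<delta> (lev r) * inb N r" using increment_pos inb_nonneg by (simp add: less_imp_le w_pos)
  ultimately show ?case using above_green[of N r] by (simp add: above_def)
next
  case (Suc n)
  then have ir: "i \<noteq> r" by auto
  have "n = lev (par i)" using lev_par[OF ir] Suc(2) by linarith
  then have "green N (par i) \<le> w 0" by (rule Suc(1))
  moreover have "0 \<le> \<delta> (lev i) * inb N i"
    using increment_pos[of "lev i"] inb_nonneg by (simp add: less_imp_le)
  ultimately show ?case using above_green[of N i] ir by (simp add: above_def)
qed

section \<open>The Green potential and the limiting flow\<close>

definition potential :: "'v \<Rightarrow> real" where
  "potential i = (\<Sum>n. occ n i / rate i)"

text \<open>Introduced as a flow driven by the potential; \<open>prob_ends_in\<close> identifies it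
  with the probability of ending in the branch at \<open>i\<close>.\<close>

definition escape :: "'v \<Rightarrow> real" where
  "escape i = (above potential i - potential i) / \<delta> (lev i)"

lemma summable_occ: "summable (\<lambda>n. occ n i / rate i)"
  using green_le[of _ i] rate_pos[of i] unfolding green_def
  by (intro summableI_nonneg_bounded[where x = "w 0"] divide_nonneg_pos occ_nonneg) auto

lemma green_tendsto: "(\<lambda>N. green N i) \<longlonglongrightarrow> potential i"
  unfolding green_def potential_def by (rule summable_LIMSEQ[OF summable_occ])

lemma potential_nonneg: "0 \<le> potential i"
  by (rule LIMSEQ_le_const[OF green_tendsto]) (auto intro: green_nonneg)

lemma occ_summable: "summable (\<lambda>n. occ n i)"
  using summable_mult[OF summable_occ[of i], of "rate i"] rate_pos[of i] by simp

text \<open>By \<open>above_green\<close>, \<open>inb N i\<close> is a difference quotient of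
  \<open>green N\<close>, whose values converge as partial sums of a summable series.\<close>

lemma inb_tendsto: "(\<lambda>N. inb N i) \<longlonglongrightarrow> escape i"
proof -
  have "(\<lambda>N. above (green N) i) \<longlonglongrightarrow> above potential i"
    unfolding above_def by (cases "i = r") (auto intro: green_tendsto)
  then have "(\<lambda>N. (above (green N) i - green N i) / \<delta> (lev i)) \<longlonglongrightarrow> escape i"
    unfolding escape_def using increment_pos[of "lev i"] by (intro tendsto_intros green_tendsto) auto
  then show ?thesis using increment_pos[of "lev i"] by (simp add: above_green)
qed

lemma escape_nonneg: "0 \<le> escape i"
  by (rule LIMSEQ_le_const[OF inb_tendsto]) (auto intro: inb_nonneg)

lemma above_potential: "above potential i - potential i = \<delta> (lev i) * escape i"
  unfolding escape_def using increment_pos[of "lev i"] by simp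

lemma inb_split: "inb n i = occ n i + (\<Sum>j\<in>succs i. inb n j)"
proof -
  define B where "B j = {\<omega> \<in> space M. Y n \<omega> \<in> Site ` branch j}" for j
  define P where "P = {\<omega> \<in> space M. Y n \<omega> = Site i}"
  have [measurable]: "B j \<in> sets M" "P \<in> sets M" for j unfolding B_def P_def by measurable
  have "prob (\<Union>j\<in>succs i. B j) = (\<Sum>j\<in>succs i. prob (B j))"
  proof (rule finite_measure_finite_Union)
    show "disjoint_family_on B (succs i)"
      unfolding disjoint_family_on_def
    proof (intro ballI impI)
      fix j k assume "j \<in> succs i" "k \<in> succs i" "j \<noteq> k"
      then have "branch j \<inter> branch k = {}" by (rule branch_disjoint)
      then show "B j \<inter> B k = {}" by (auto simp: B_def)
    qed
  qed (auto simp: finite_succs)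
  moreover have "P \<inter> (\<Union>j\<in>succs i. B j) = {}"
    using not_branch_succ[of _ i] by (auto simp: P_def B_def)
  then have "prob (P \<union> (\<Union>j\<in>succs i. B j)) = prob P + prob (\<Union>j\<in>succs i. B j)"
    using finite_succs[of i] by (intro finite_measure_Union) auto
  moreover have "P \<union> (\<Union>j\<in>succs i. B j) = B i"
    unfolding B_def P_def by (subst branch_decomp[of i]) auto
  ultimately have "prob (B i) = prob P + (\<Sum>j\<in>succs i. prob (B j))" by simp
  then show ?thesis unfolding inb_def occ_def B_def P_def .
qed

text \<open>The occupation probability in \<open>inb_split\<close> is summable in \<open>n\<close>
  and so vanishes in the limit: the flow has no sources.\<close>

lemma escape_split: "escape i = (\<Sum>j\<in>succs i. escape j)"
proof -
  have "(\<lambda>n. occ n i + (\<Sum>j\<in>succs i. inb n j)) \<longlonglongrightarrow> 0 + (\<Sum>j\<in>succs i. escape j)"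
    by (intro tendsto_add tendsto_sum inb_tendsto summable_LIMSEQ_zero occ_summable)
  then have "(\<lambda>n. inb n i) \<longlonglongrightarrow> (\<Sum>j\<in>succs i. escape j)"
    unfolding inb_split[symmetric] by simp
  then show ?thesis by (rule LIMSEQ_unique[OF inb_tendsto])
qed

section \<open>The energy estimate\<close>

lemma AE_lev_le: "AE \<omega> in M. \<forall>n i. Y n \<omega> = Site i \<longrightarrow> lev i \<le> n"
  using AE_start AE_step
proof eventually_elim
  case (elim \<omega>)
  have "\<forall>i. Y n \<omega> = Site i \<longrightarrow> lev i \<le> n" for n
  proof (induction n)
    case 0
    then show ?case using elim by auto
  next
    case (Suc n)
    have "tp (Y n \<omega>) (Y (Suc n) \<omega>) \<noteq> 0" using elim by blast
    then show ?case
    proof (cases rule: tp_nonzeroE)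
      case (3 i)
      then have "lev i \<le> n" using Suc by blast
      then show ?thesis using 3 lev_par[OF 3(1)] by auto
    next
      case (4 i)
      then have "lev (par i) \<le> n" using Suc by blast
      then show ?thesis using 4 lev_par[OF 4(1)] by auto
    qed auto
  qed
  then show ?case by blast
qed

text \<open>Only the times \<open>0, ..., N - 1\<close> count, and at these the chain has level at
  most \<open>N - 1\<close>.\<close>

lemma green_eq_0:
  assumes "N \<le> lev i"
  shows "green N i = 0"
proof -
  have "occ n i = 0" if "n < N" for n
  proof -
    have "AE \<omega> in M. Y n \<omega> \<noteq> Site i"
      using AE_lev_le
    proof eventually_elim
      case (elim \<omega>)
      then show ?case using that assms by (meson leD le_trans less_le_trans)
    qed
    then show ?thesis unfolding occ_def by (subst prob_Collect_eq_0) auto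
  qed
  then show ?thesis by (simp add: green_def)
qed

text \<open>The Dirichlet energy of \<open>potential - green m\<close> up to level \<open>m\<close> is nonnegative, and
  \<open>green m\<close> vanishes on the sphere of radius \<open>m\<close>.\<close>

lemma potential_sphere_le: "(\<Sum>i\<in>sphere m. potential i * escape i) \<le> w 0 * (inb m r - escape r)"
proof -
  \<comment> \<open>Energy as a form on flows: flow times resistance is the potential difference
    across an edge, by \<open>above_green\<close> and \<open>above_potential\<close>.\<close>
  define D where "D a b = (\<Sum>k\<le>m. \<Sum>j\<in>sphere k. \<delta> (lev j) * a j * b j)" for a b :: "'v \<Rightarrow> real"
  have es: "escape i = 0 + (\<Sum>j\<in>succs i. escape j)" for i unfolding add_0 by (rule escape_split)
  \<comment> \<open>No source terms here: only the root and the sphere contribute.\<close>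
  have ee: "D escape escape = w 0 * escape r - (\<Sum>i\<in>sphere m. potential i * escape i)"
    using energy_by_parts[where c = escape and s = "\<lambda>_. 0", OF es, of potential m] by (simp add: D_def above_potential)
  have "(\<Sum>i\<in>sphere m. green m i * c i) = 0" for c
    by (intro sum.neutral) (auto simp: sphere_def green_eq_0)
  note green_sphere = this
  \<comment> \<open>The same flow against \<open>green m\<close>, for which the sphere contributes
    nothing either.\<close>
  have be: "D (inb m) escape = w 0 * escape r"
    using energy_by_parts[where c = escape and s = "\<lambda>_. 0", OF es, of "green m" m] by (simp add: D_def above_green green_sphere)
  have "D (inb m) (inb m) = w 0 * inb m r - (\<Sum>k<m. \<Sum>i\<in>sphere k. green m i * occ m i)"
    using energy_by_parts[where c = "inb m" and s = "occ m", OF inb_split, of "green m" m] by (simp add: D_def above_green green_sphere)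
  \<comment> \<open>The loss \<open>occ m\<close> of the flow \<open>inb m\<close> enters with the
    favourable sign.\<close>
  also have "\<dots> \<le> w 0 * inb m r"
    by (simp add: sum_nonneg green_nonneg occ_nonneg)
  finally have bb: "D (inb m) (inb m) \<le> w 0 * inb m r" .
  have "D (\<lambda>i. escape i - inb m i) (\<lambda>i. escape i - inb m i) = D escape escape - 2 * D (inb m) escape + D (inb m) (inb m)"
    unfolding D_def sum_distrib_left sum_subtractf[symmetric] sum.distrib[symmetric]
    by (intro sum.cong refl) (simp add: algebra_simps)
  moreover have "0 \<le> D (\<lambda>i. escape i - inb m i) (\<lambda>i. escape i - inb m i)"
    unfolding D_def mult.assoc using increment_pos
    by (intro sum_nonneg mult_nonneg_nonneg zero_le_square) (auto intro: less_imp_le)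
  ultimately show ?thesis using ee be bb by (simp add: right_diff_distrib)
qed

lemma potential_sphere_tendsto: "(\<lambda>m. \<Sum>i\<in>sphere m. potential i * escape i) \<longlonglongrightarrow> 0"
proof (rule tendsto_sandwich[OF always_eventually[OF allI] always_eventually[OF allI[OF potential_sphere_le]] tendsto_const])
  show "0 \<le> (\<Sum>i\<in>sphere m. potential i * escape i)" for m
    by (intro sum_nonneg mult_nonneg_nonneg potential_nonneg escape_nonneg)
  have "(\<lambda>m. w 0 * (inb m r - escape r)) \<longlonglongrightarrow> w 0 * (escape r - escape r)"
    by (intro tendsto_mult tendsto_diff tendsto_const inb_tendsto)
  then show "(\<lambda>m. w 0 * (inb m r - escape r)) \<longlonglongrightarrow> 0" by simp
qed

section \<open>Almost sure behaviour of the jump chain\<close>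

text \<open>Borel-Cantelli: \<open>green_le\<close> makes the expected number of visits to each site
  finite.\<close>

lemma AE_transient: "AE \<omega> in M. \<forall>i. \<forall>\<^sub>F n in sequentially. Y n \<omega> \<noteq> Site i"
proof -
  have "AE \<omega> in M. \<forall>\<^sub>F n in sequentially. Y n \<omega> \<noteq> Site i" for i
  proof -
    have "AE \<omega> in M. \<forall>\<^sub>F n in sequentially. \<omega> \<in> space M - {\<omega> \<in> space M. Y n \<omega> = Site i}"
    proof (rule borel_cantelli_AE1)
      show "summable (\<lambda>n. prob {\<omega> \<in> space M. Y n \<omega> = Site i})"
        using occ_summable[of i] by (simp add: occ_def)
    qed (auto simp: less_top[symmetric])
    then show ?thesis
    proof eventually_elim
      case (elim \<omega>)
      then show ?case by (rule eventually_mono) auto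
    qed
  qed
  then have "AE \<omega> in M. \<forall>i\<in>UNIV. \<forall>\<^sub>F n in sequentially. Y n \<omega> \<noteq> Site i"
    by (intro AE_ball_countable' countable_sites)
  then show ?thesis by simp
qed

definition ends_in :: "'v \<Rightarrow> 'w set" where
  "ends_in i = {\<omega> \<in> space M. \<forall>\<^sub>F n in sequentially. Y n \<omega> \<in> Site ` branch i}"

lemma ends_in_sets [measurable]: "ends_in i \<in> sets M"
  unfolding ends_in_def eventually_sequentially by measurable

text \<open>A step into or out of the branch uses the site \<open>i\<close>, so none occurs after
  the last visit to \<open>i\<close>.\<close>

lemma AE_branch_settles:
  "AE \<omega> in M. \<forall>i. (\<forall>\<^sub>F n in sequentially. Y n \<omega> \<in> Site ` branch i) \<or> (\<forall>\<^sub>F n in sequentially. Y n \<omega> \<notin> Site ` branch i)"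
  using AE_transient AE_step
proof eventually_elim
  case (elim \<omega>)
  show ?case
  proof
    fix i
    obtain N where N: "\<And>n. N \<le> n \<Longrightarrow> Y n \<omega> \<noteq> Site i"
      using elim(1) unfolding eventually_sequentially by blast
    have step: "Y (Suc n) \<omega> \<in> Site ` branch i \<longleftrightarrow> Y n \<omega> \<in> Site ` branch i" if "N \<le> n" for n
    proof -
      have notin: "Y n \<omega> \<noteq> Site i" "Y (Suc n) \<omega> \<noteq> Site i" using N that by auto
      have "tp (Y n \<omega>) (Y (Suc n) \<omega>) \<noteq> 0" using elim(2) by blast
      then show ?thesis using leave_branch(1)[of _ _ i] enter_branch[of _ _ i] notin by metis
    qed
    have "Y n \<omega> \<in> Site ` branch i \<longleftrightarrow> Y N \<omega> \<in> Site ` branch i" if "N \<le> n" for n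
      using that
    proof (induction rule: dec_induct)
      case (step n)
      then show ?case using \<open>\<And>n. N \<le> n \<Longrightarrow> (Y (Suc n) \<omega> \<in> Site ` branch i) = (Y n \<omega> \<in> Site ` branch i)\<close>[of n] by simp
    qed simp
    then show "(\<forall>\<^sub>F n in sequentially. Y n \<omega> \<in> Site ` branch i) \<or> (\<forall>\<^sub>F n in sequentially. Y n \<omega> \<notin> Site ` branch i)"
      unfolding eventually_sequentially by (cases "Y N \<omega> \<in> Site ` branch i") blast+
  qed
qed

text \<open>Since trajectories settle, the indicators of being in the branch at time
  \<open>n\<close> converge a.s.; their expectations are \<open>inb n i\<close>, with limit
  \<open>escape i\<close>.\<close>

lemma prob_ends_in: "prob (ends_in i) = escape i"
proof -
  let ?B = "\<lambda>n. {\<omega> \<in> space M. Y n \<omega> \<in> Site ` branch i}"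
  have "(\<lambda>n. \<integral>\<omega>. indicator (?B n) \<omega> \<partial>M) \<longlonglongrightarrow> (\<integral>\<omega>. indicat_real (ends_in i) \<omega> \<partial>M)"
  proof (rule integral_dominated_convergence)
    show "AE \<omega> in M. (\<lambda>n. indicator (?B n) \<omega> :: real) \<longlonglongrightarrow> indicator (ends_in i) \<omega>"
      using AE_branch_settles AE_space
    proof eventually_elim
      case (elim \<omega>)
      from elim(1)[rule_format, of i] show ?case
      proof
        assume *: "\<forall>\<^sub>F n in sequentially. Y n \<omega> \<in> Site ` branch i"
        then have "indicator (ends_in i) \<omega> = (1::real)" using elim(2) by (simp add: ends_in_def)
        moreover have "\<forall>\<^sub>F n in sequentially. indicator (?B n) \<omega> = (1::real)"
          using * by (rule eventually_mono) (simp add: elim(2))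
        ultimately show ?thesis by (simp only: tendsto_eventually)
      next
        assume *: "\<forall>\<^sub>F n in sequentially. Y n \<omega> \<notin> Site ` branch i"
        have "\<not> (\<forall>\<^sub>F n in sequentially. Y n \<omega> \<in> Site ` branch i)"
        proof
          assume "\<forall>\<^sub>F n in sequentially. Y n \<omega> \<in> Site ` branch i"
          then have "\<forall>\<^sub>F n in sequentially. False"
            by (rule eventually_rev_mp) (rule eventually_mono[OF *], iprover)
          then show False by simp
        qed
        then have "indicator (ends_in i) \<omega> = (0::real)" by (simp add: ends_in_def)
        moreover have "\<forall>\<^sub>F n in sequentially. indicator (?B n) \<omega> = (0::real)"
          using * by (rule eventually_mono) simp
        ultimately show ?thesis by (simp only: tendsto_eventually)
      qed
    qed
    show "AE \<omega> in M. norm (indicator (?B n) \<omega> :: real) \<le> 1" for n by (simp add: indicator_def)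
  qed auto
  then have "(\<lambda>n. inb n i) \<longlonglongrightarrow> prob (ends_in i)"
    by (simp add: inb_def)
  then show ?thesis by (rule LIMSEQ_unique[OF _ inb_tendsto])
qed

end


section \<open>Exit through the boundary\<close>

locale exit_chain = tree_chain adj r w M Y H
  for adj :: "'v \<Rightarrow> 'v \<Rightarrow> bool" and r :: 'v and w :: "nat \<Rightarrow> real" and M :: "'w measure"
    and Y :: "nat \<Rightarrow> 'w \<Rightarrow> 'v state" and H :: "nat \<Rightarrow> 'w \<Rightarrow> ennreal" +
  fixes X :: "ennreal \<Rightarrow> 'w \<Rightarrow> 'v state option"
  assumes path: "\<And>t \<omega>. \<omega> \<in> space M \<Longrightarrow> X t \<omega> = jump_hold_path Y H t \<omega>"
begin

section \<open>Jump times and the explosion time\<close>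

abbreviation jt :: "nat \<Rightarrow> 'w \<Rightarrow> ennreal" where "jt \<equiv> jump_time H"

lemma jt_0 [simp]: "jt 0 \<omega> = 0" and jt_Suc: "jt (Suc n) \<omega> = jt n \<omega> + H n \<omega>"
  by (simp_all add: jump_time_def)

lemma jt_mono: "m \<le> n \<Longrightarrow> jt m \<omega> \<le> jt n \<omega>"
  by (rule lift_Suc_mono_le[of "\<lambda>n. jt n \<omega>"]) (simp_all add: jt_Suc)

definition expl :: "'w \<Rightarrow> ennreal" where "expl \<omega> = (SUP n. jt n \<omega>)"

lemma jt_le_expl: "jt n \<omega> \<le> expl \<omega>"
  unfolding expl_def by (rule SUP_upper) simp

lemma X_at:
  assumes "\<omega> \<in> space M" "jt n \<omega> \<le> t" "t < jt (Suc n) \<omega>"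
  shows "X t \<omega> = Some (Y n \<omega>)"
proof -
  have "m = n" if "jt m \<omega> \<le> t" "t < jt (Suc m) \<omega>" for m
  proof (rule linorder_cases[of m n])
    assume "m < n"
    then have "jt (Suc m) \<omega> \<le> jt n \<omega>" by (intro jt_mono) simp
    then show ?thesis using that(2) assms(2) by (meson leD le_less_trans less_le_trans)
  next
    assume "n < m"
    then have "jt (Suc n) \<omega> \<le> jt m \<omega>" by (intro jt_mono) simp
    then show ?thesis using that(1) assms(3) by (meson leD le_less_trans less_le_trans)
  qed
  then have "(THE n. jt n \<omega> \<le> t \<and> t < jt (Suc n) \<omega>) = n"
    using assms by (intro the_equality) blast+
  moreover have "\<exists>n. jt n \<omega> \<le> t \<and> t < jt (Suc n) \<omega>" using assms by blast
  ultimately show ?thesis by (simp add: path[OF assms(1)] jump_hold_path_def)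
qed

lemma jump_interval:
  assumes "t < expl \<omega>"
  obtains n where "jt n \<omega> \<le> t" "t < jt (Suc n) \<omega>"
proof -
  obtain k where k: "t < jt k \<omega>" using assms by (auto simp: expl_def less_SUP_iff)
  define m where "m = (LEAST k. t < jt k \<omega>)"
  have m: "t < jt m \<omega>" unfolding m_def using k by (rule LeastI)
  then obtain n where n: "m = Suc n" by (cases m) auto
  have "\<not> t < jt n \<omega>" using not_less_Least[of n "\<lambda>k. t < jt k \<omega>"] n by (simp add: m_def)
  then show ?thesis using that[of n] m n by (simp add: not_less)
qed

lemma X_None: "\<omega> \<in> space M \<Longrightarrow> expl \<omega> \<le> t \<Longrightarrow> X t \<omega> = None"
  using jt_le_expl by (auto simp: path jump_hold_path_def) (meson leD le_less_trans less_le_trans)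

lemma explosion_time_eq:
  assumes "\<omega> \<in> space M"
  shows "explosion_time X \<omega> = expl \<omega>"
proof -
  have "X t \<omega> = None \<longleftrightarrow> expl \<omega> \<le> t" for t
  proof (cases "t < expl \<omega>")
    case True
    then obtain n where "jt n \<omega> \<le> t" "t < jt (Suc n) \<omega>" by (rule jump_interval)
    then show ?thesis using X_at[OF assms] True by simp
  next
    case False
    then show ?thesis using X_None[OF assms] by (simp add: not_less)
  qed
  then have "explosion_time X \<omega> = Inf {expl \<omega>..}" by (simp add: explosion_time_def atLeast_def)
  then show ?thesis by simp
qed

lemma lifetime_eq:
  assumes "\<omega> \<in> space M" "\<And>t. X t \<omega> \<noteq> Some Absorbed"
  shows "lifetime X \<omega> = expl \<omega>"
  using assms by (simp add: lifetime_def absorption_time_def explosion_time_eq)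

lemma expl_pos: "\<omega> \<in> space M \<Longrightarrow> 0 < expl \<omega>"
  using jt_le_expl[of 1 \<omega>] H_pos[of \<omega> 0] by (simp add: jt_Suc less_le_trans)

text \<open>Finiteness matters: in \<open>ennreal\<close> nothing increases an infinite
  time.\<close>

lemma jt_strict:
  assumes "\<omega> \<in> space M" "\<And>k. H k \<omega> < \<infinity>"
  shows "jt n \<omega> < jt (Suc n) \<omega>"
proof -
  have "jt n \<omega> < \<infinity>" for n using assms(2) by (induction n) (auto simp: jt_Suc)
  then show ?thesis using H_pos[OF assms(1), of n] ennreal_add_left_cancel_less[of "jt n \<omega>" 0 "H n \<omega>"]
    by (simp add: jt_Suc less_top)
qed

text \<open>With finite holding times the jump times increase strictly to \<open>expl\<close>, so
  left neighbourhoods of \<open>expl\<close> correspond to tails of the jump chain.\<close>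

lemma eventually_at_expl_iff:
  assumes \<omega>: "\<omega> \<in> space M" "\<And>k. H k \<omega> < \<infinity>"
  shows "(\<forall>\<^sub>F t in at_left (expl \<omega>). P (X t \<omega>)) \<longleftrightarrow> (\<forall>\<^sub>F n in sequentially. P (Some (Y n \<omega>)))"
proof
  assume "\<forall>\<^sub>F t in at_left (expl \<omega>). P (X t \<omega>)"
  then obtain b where b: "b < expl \<omega>" "\<And>t. b < t \<Longrightarrow> t < expl \<omega> \<Longrightarrow> P (X t \<omega>)"
    by (subst (asm) eventually_at_left[OF expl_pos[OF \<omega>(1)]]) blast
  obtain N where N: "b < jt N \<omega>" using b(1) by (auto simp: expl_def less_SUP_iff)
  have "P (Some (Y n \<omega>))" if "N \<le> n" for n
  proof -
    have "b < jt n \<omega>" using N jt_mono[OF that] by (rule less_le_trans)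
    moreover have "jt n \<omega> < expl \<omega>" using jt_strict[OF \<omega>, of n] jt_le_expl by (rule less_le_trans)
    ultimately have "P (X (jt n \<omega>) \<omega>)" by (rule b(2))
    then show ?thesis using X_at[OF \<omega>(1), of n "jt n \<omega>"] jt_strict[OF \<omega>, of n] by simp
  qed
  then show "\<forall>\<^sub>F n in sequentially. P (Some (Y n \<omega>))" unfolding eventually_sequentially by blast
next
  assume "\<forall>\<^sub>F n in sequentially. P (Some (Y n \<omega>))"
  then obtain N where N: "\<And>n. N \<le> n \<Longrightarrow> P (Some (Y n \<omega>))" unfolding eventually_sequentially by blast
  have "jt N \<omega> < expl \<omega>" using jt_strict[OF \<omega>, of N] jt_le_expl by (rule less_le_trans)
  moreover have "P (X t \<omega>)" if t: "jt N \<omega> < t" "t < expl \<omega>" for t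
  proof -
    obtain n where n: "jt n \<omega> \<le> t" "t < jt (Suc n) \<omega>" using t(2) by (rule jump_interval)
    have "N \<le> n"
    proof (rule ccontr)
      assume "\<not> N \<le> n"
      then have "jt (Suc n) \<omega> \<le> jt N \<omega>" by (intro jt_mono) simp
      then show False using n t by (meson leD less_le_trans less_trans)
    qed
    then show ?thesis using N X_at[OF \<omega>(1) n] by simp
  qed
  ultimately show "\<forall>\<^sub>F t in at_left (expl \<omega>). P (X t \<omega>)"
    by (subst eventually_at_left[OF expl_pos[OF \<omega>(1)]]) blast
qed

section \<open>Exit expressed through the jump chain\<close>

definition follows :: "'w \<Rightarrow> (nat \<Rightarrow> 'v) \<Rightarrow> bool" where
  "follows \<omega> \<xi> \<longleftrightarrow> \<xi> \<in> rays adj r \<and> (\<forall>n. \<forall>\<^sub>F k in sequentially. Y k \<omega> \<in> Site ` branch (\<xi> n))"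

lemma in_branch_iff: "(\<exists>j. Some s = Some (Site j) \<and> i \<in> set (geodesic adj r j)) \<longleftrightarrow> s \<in> Site ` branch i"
  by (auto simp: branch_def)

lemma tends_to_ray_iff:
  assumes \<omega>: "\<omega> \<in> space M" "\<And>k. H k \<omega> < \<infinity>" and na: "\<And>t. X t \<omega> \<noteq> Some Absorbed"
  shows "tends_to_ray adj r X \<omega> \<xi> \<longleftrightarrow> follows \<omega> \<xi>"
  unfolding tends_to_ray_def follows_def lifetime_eq[OF \<omega>(1) na]
    eventually_at_expl_iff[OF \<omega>, of "\<lambda>s. \<exists>j. s = Some (Site j) \<and> _ j"] in_branch_iff ..

text \<open>A trajectory that stays forever at one site does not converge to a ray.\<close>

lemma tends_to_ray_finite_hold:
  assumes \<omega>: "\<omega> \<in> space M" and na: "\<And>t. X t \<omega> \<noteq> Some Absorbed" and tr: "tends_to_ray adj r X \<omega> \<xi>"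
  shows "H k \<omega> < \<infinity>"
proof (rule ccontr)
  assume "\<not> H k \<omega> < \<infinity>"
  then have k: "H k \<omega> = \<infinity>" by (simp add: less_top[symmetric])
  \<comment> \<open>From the start of the first infinite holding time on, the trajectory stays at
    \<open>Y m\<close>.\<close>
  define m where "m = (LEAST k. H k \<omega> = \<infinity>)"
  have m: "H m \<omega> = \<infinity>" unfolding m_def using k by (rule LeastI)
  have below: "H l \<omega> \<noteq> \<infinity>" if "l < m" for l
    using not_less_Least that unfolding m_def by blast
  have "jt l \<omega> < \<infinity>" if "l \<le> m" for l
    using that below by (induction l) (auto simp: jt_Suc less_top[symmetric])
  then have fin: "jt m \<omega> < top" by simp
  have top: "jt (Suc m) \<omega> = top" using m by (simp add: jt_Suc)
  then have ex: "expl \<omega> = top" using jt_le_expl[of "Suc m" \<omega>] by (simp add: top_unique)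
  have "\<exists>j. Y m \<omega> = Site j \<and> \<xi> n \<in> set (geodesic adj r j)" for n
  proof -
    have "\<forall>\<^sub>F t in at_left top. \<exists>j. X t \<omega> = Some (Site j) \<and> \<xi> n \<in> set (geodesic adj r j)"
      using tr unfolding tends_to_ray_def lifetime_eq[OF \<omega> na] ex by blast
    then obtain b where b: "b < top" "\<And>t. b < t \<Longrightarrow> t < top \<Longrightarrow> \<exists>j. X t \<omega> = Some (Site j) \<and> \<xi> n \<in> set (geodesic adj r j)"
      by (subst (asm) eventually_at_left[OF fin]) blast
    obtain t where t: "max b (jt m \<omega>) < t" "t < top"
      using dense[of "max b (jt m \<omega>)" top] b(1) fin by auto
    then have "X t \<omega> = Some (Y m \<omega>)" using X_at[OF \<omega>, of m t] top by (simp add: less_imp_le)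
    then show ?thesis using b(2)[of t] t by simp
  qed
  then obtain j where j: "Y m \<omega> = Site j" "\<And>n. \<xi> n \<in> set (geodesic adj r j)"
    by (metis state.inject)
  \<comment> \<open>The vertex of the ray one level deeper than \<open>j\<close> cannot lie on the
    geodesic to \<open>j\<close>.\<close>
  then have "j \<in> branch (\<xi> (Suc (lev j)))" by (simp add: branch_def)
  then have "lev (\<xi> (Suc (lev j))) \<le> lev j" by (rule branch_lev)
  moreover have "lev (\<xi> (Suc (lev j))) = Suc (lev j)"
    using tr by (intro ray_lev) (simp add: tends_to_ray_def)
  ultimately show False by simp
qed

lemma not_absorbed_iff:
  assumes \<omega>: "\<omega> \<in> space M" "\<And>k. H k \<omega> < \<infinity>"
  shows "(\<forall>t. X t \<omega> \<noteq> Some Absorbed) \<longleftrightarrow> (\<forall>k. Y k \<omega> \<noteq> Absorbed)"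
proof
  assume *: "\<forall>t. X t \<omega> \<noteq> Some Absorbed"
  show "\<forall>k. Y k \<omega> \<noteq> Absorbed"
  proof
    fix k show "Y k \<omega> \<noteq> Absorbed"
      using *[rule_format, of "jt k \<omega>"] X_at[OF \<omega>(1), of k "jt k \<omega>"] jt_strict[OF \<omega>, of k] by simp
  qed
next
  assume *: "\<forall>k. Y k \<omega> \<noteq> Absorbed"
  show "\<forall>t. X t \<omega> \<noteq> Some Absorbed"
  proof
    fix t show "X t \<omega> \<noteq> Some Absorbed"
    proof (cases "t < expl \<omega>")
      case True
      then obtain n where "jt n \<omega> \<le> t" "t < jt (Suc n) \<omega>" by (rule jump_interval)
      then have "X t \<omega> = Some (Y n \<omega>)" by (rule X_at[OF \<omega>(1)])
      then show ?thesis using * by simp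
    next
      case False
      then show ?thesis using X_None[OF \<omega>(1), of t] by simp
    qed
  qed
qed

abbreviation exits :: "'w set" where "exits \<equiv> boundary_exit adj r M X"

lemma exits_iff:
  "\<omega> \<in> exits \<longleftrightarrow> \<omega> \<in> space M \<and> (\<forall>k. H k \<omega> < \<infinity>) \<and> (\<forall>k. Y k \<omega> \<noteq> Absorbed) \<and> (\<exists>\<xi>. follows \<omega> \<xi>)"
proof
  assume "\<omega> \<in> exits"
  then have e: "\<omega> \<in> space M" "\<And>t. X t \<omega> \<noteq> Some Absorbed" "\<exists>\<xi>. tends_to_ray adj r X \<omega> \<xi>"
    by (auto simp: boundary_exit_def)
  then have "\<And>k. H k \<omega> < \<infinity>" using tends_to_ray_finite_hold by blast
  then show "\<omega> \<in> space M \<and> (\<forall>k. H k \<omega> < \<infinity>) \<and> (\<forall>k. Y k \<omega> \<noteq> Absorbed) \<and> (\<exists>\<xi>. follows \<omega> \<xi>)"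
    using e not_absorbed_iff tends_to_ray_iff by blast
next
  assume *: "\<omega> \<in> space M \<and> (\<forall>k. H k \<omega> < \<infinity>) \<and> (\<forall>k. Y k \<omega> \<noteq> Absorbed) \<and> (\<exists>\<xi>. follows \<omega> \<xi>)"
  then have "\<forall>t. X t \<omega> \<noteq> Some Absorbed" using not_absorbed_iff by blast
  moreover from this * have "\<exists>\<xi>. tends_to_ray adj r X \<omega> \<xi>" using tends_to_ray_iff by blast
  ultimately show "\<omega> \<in> exits" using * by (simp add: boundary_exit_def)
qed

lemma eventually_branch_eq:
  assumes "\<forall>\<^sub>F k in sequentially. Y k \<omega> \<in> Site ` branch i" "\<forall>\<^sub>F k in sequentially. Y k \<omega> \<in> Site ` branch j" "lev i = lev j"
  shows "i = j"
proof -
  obtain k where "Y k \<omega> \<in> Site ` branch i" "Y k \<omega> \<in> Site ` branch j"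
    using eventually_happens[OF eventually_conj[OF assms(1,2)]] by auto
  then obtain v where "v \<in> branch i" "v \<in> branch j" by auto
  then show ?thesis using assms(3) by (rule branch_same_level)
qed

lemma follows_unique:
  assumes "follows \<omega> \<xi>" "follows \<omega> \<eta>" shows "\<xi> = \<eta>"
proof
  fix n show "\<xi> n = \<eta> n"
    using assms by (intro eventually_branch_eq[of \<omega>]) (auto simp: follows_def ray_lev)
qed

lemma exit_ray_follows:
  assumes "\<omega> \<in> exits" shows "follows \<omega> (exit_ray adj r X \<omega>)"
proof -
  have e: "\<omega> \<in> space M" "\<And>t. X t \<omega> \<noteq> Some Absorbed" "\<And>k. H k \<omega> < \<infinity>"
    using assms exits_iff[of \<omega>] by (auto simp: boundary_exit_def)
  obtain \<xi> where \<xi>: "follows \<omega> \<xi>" using assms exits_iff by blast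
  have "tends_to_ray adj r X \<omega> = follows \<omega>"
    using tends_to_ray_iff[OF e(1,3,2)] by blast
  then have "exit_ray adj r X \<omega> = \<xi>"
    unfolding exit_ray_def using \<xi> follows_unique by (metis the_equality)
  then show ?thesis using \<xi> by simp
qed

lemma exit_ray_in_rays: "\<omega> \<in> exits \<Longrightarrow> exit_ray adj r X \<omega> \<in> rays adj r"
  using exit_ray_follows by (auto simp: follows_def)

text \<open>Two branches of the same level that both contain the trajectory eventually are equal, so
  a cylinder of rays pulls back to an event of the jump chain.\<close>

lemma exit_ray_through:
  assumes "\<omega> \<in> exits"
  shows "exit_ray adj r X \<omega> \<in> rays_through adj r i \<longleftrightarrow> \<omega> \<in> ends_in i"
proof -
  note f = exit_ray_follows[OF assms]
  let ?\<xi> = "exit_ray adj r X \<omega>"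
  have ev: "\<forall>\<^sub>F k in sequentially. Y k \<omega> \<in> Site ` branch (?\<xi> (lev i))" and ray: "?\<xi> \<in> rays adj r"
    using f by (auto simp: follows_def)
  have "\<omega> \<in> space M" using assms exits_iff by blast
  moreover have "?\<xi> (lev i) = i" if "\<forall>\<^sub>F k in sequentially. Y k \<omega> \<in> Site ` branch i"
    using eventually_branch_eq[OF ev that] ray_lev[OF ray] by simp
  moreover have "\<forall>\<^sub>F k in sequentially. Y k \<omega> \<in> Site ` branch i" if "?\<xi> (lev i) = i"
    using ev unfolding that .
  ultimately show ?thesis
    using ray unfolding rays_through_def ends_in_def by blast
qed

lemma exits_subset: "exits \<subseteq> ends_in r"
proof
  fix \<omega> assume \<omega>: "\<omega> \<in> exits"
  have "exit_ray adj r X \<omega> \<in> rays_through adj r r"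
    using exit_ray_in_rays[OF \<omega>] ray_0 by (simp add: rays_through_def)
  then show "\<omega> \<in> ends_in r" using exit_ray_through[OF \<omega>] by simp
qed

text \<open>As \<open>branch r\<close> is the whole tree, \<open>ends_in r\<close> amounts to
  non-absorption; the limit ray is then built from the branches in which the trajectory
  settles.\<close>

lemma AE_ends_in_exits: "AE \<omega> in M. \<omega> \<in> ends_in r \<longrightarrow> \<omega> \<in> exits"
  using AE_step AE_finite_hold AE_transient AE_branch_settles
proof eventually_elim
  case (elim \<omega>)
  show ?case
  proof
    assume \<omega>: "\<omega> \<in> ends_in r"
    then have ev: "\<forall>\<^sub>F n in sequentially. Y n \<omega> \<in> Site ` branch r" and sp: "\<omega> \<in> space M"
      by (auto simp: ends_in_def)
    \<comment> \<open>Absorption is permanent, so a trajectory that is eventually at sites was never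
      absorbed.\<close>
    have stay: "Y m \<omega> = Absorbed" if "Y k \<omega> = Absorbed" "k \<le> m" for k m
      using that(2)
    proof (induction rule: dec_induct)
      case (step n)
      have "tp (Y n \<omega>) (Y (Suc n) \<omega>) \<noteq> 0" using elim(1) by blast
      then show ?case using step.IH by (cases rule: tp_nonzeroE) simp_all
    qed (rule that(1))
    have na: "Y k \<omega> \<noteq> Absorbed" for k
    proof
      assume k: "Y k \<omega> = Absorbed"
      obtain N where "\<And>n. N \<le> n \<Longrightarrow> Y n \<omega> \<in> Site ` branch r"
        using ev unfolding eventually_sequentially by blast
      then have "Y (max N k) \<omega> \<in> Site ` branch r" by simp
      then show False using stay[OF k, of "max N k"] by auto
    qed
    have fin: "H k \<omega> < \<infinity>" for k
    proof -
      obtain i where "Y k \<omega> = Site i" using na[of k] by (cases "Y k \<omega>") auto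
      then have "Q_absorbed adj r w (Y k \<omega>) (Y k \<omega>) < 0" using rate_pos[of i] by (simp add: rate_def)
      then show ?thesis using elim(2) by blast
    qed
    define E where "E i \<longleftrightarrow> (\<forall>\<^sub>F n in sequentially. Y n \<omega> \<in> Site ` branch i)" for i
    \<comment> \<open>Gone from \<open>i\<close> for good and with finitely many successor branches
      available, the trajectory settles in one of them.\<close>
    have next_site: "\<exists>j\<in>succs i. E j" if "E i" for i
    proof (rule ccontr)
      assume "\<not> ?thesis"
      then have "\<forall>j\<in>succs i. \<forall>\<^sub>F n in sequentially. Y n \<omega> \<notin> Site ` branch j"
        using elim(4) unfolding E_def by blast
      then have "\<forall>\<^sub>F n in sequentially. \<forall>j\<in>succs i. Y n \<omega> \<notin> Site ` branch j"
        by (intro eventually_ball_finite finite_succs)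
      moreover have "\<forall>\<^sub>F n in sequentially. Y n \<omega> \<noteq> Site i" using elim(3) by blast
      moreover have "\<forall>\<^sub>F n in sequentially. Y n \<omega> \<in> Site ` branch i" using that by (simp add: E_def)
      ultimately have "\<forall>\<^sub>F n in sequentially. (\<forall>j\<in>succs i. Y n \<omega> \<notin> Site ` branch j) \<and> Y n \<omega> \<noteq> Site i \<and> Y n \<omega> \<in> Site ` branch i"
        by (intro eventually_conj)
      then obtain n where n: "\<forall>j\<in>succs i. Y n \<omega> \<notin> Site ` branch j" "Y n \<omega> \<noteq> Site i" "Y n \<omega> \<in> Site ` branch i"
        using eventually_happens by force
      then obtain v where v: "Y n \<omega> = Site v" "v \<in> branch i" by blast
      then have "v \<in> insert i (\<Union>j\<in>succs i. branch j)" using branch_decomp[of i] by metis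
      then show False using n(1,2) v(1) by blast
    qed
    have "\<exists>\<xi>. \<forall>n. ((n = 0 \<longrightarrow> \<xi> n = r) \<and> E (\<xi> n)) \<and> \<xi> (Suc n) \<in> succs (\<xi> n)"
    proof (rule dependent_nat_choice)
      show "\<exists>x. (0 = (0::nat) \<longrightarrow> x = r) \<and> E x" using ev by (simp add: E_def)
    next
      fix x and n :: nat assume "(n = 0 \<longrightarrow> x = r) \<and> E x"
      then show "\<exists>y. ((Suc n = 0 \<longrightarrow> y = r) \<and> E y) \<and> y \<in> succs x" using next_site[of x] by auto
    qed
    then obtain \<xi> where \<xi>: "\<xi> 0 = r" "\<And>n. E (\<xi> n)" "\<And>n. \<xi> (Suc n) \<in> succs (\<xi> n)" by blast
    then have "follows \<omega> \<xi>" by (simp add: follows_def rays_def E_def)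
    then show "\<omega> \<in> exits" using sp na fin exits_iff by blast
  qed
qed

end


section \<open>The boundary and the exit distribution\<close>

context rooted_tree
begin

lemma rays_through_subset: "rays_through adj r i \<subseteq> rays adj r"
  by (auto simp: rays_through_def)

lemma rays_through_nested:
  assumes "\<xi> \<in> rays_through adj r i" "lev i \<le> n"
  shows "rays_through adj r (\<xi> n) \<subseteq> rays_through adj r i"
proof
  fix \<eta> assume \<eta>: "\<eta> \<in> rays_through adj r (\<xi> n)"
  have \<xi>: "\<xi> \<in> rays adj r" "\<xi> (lev i) = i" using assms by (auto simp: rays_through_def)
  have "\<eta> \<in> rays adj r" "\<eta> n = \<xi> n" using \<eta> ray_lev[OF \<xi>(1)] by (auto simp: rays_through_def)
  then show "\<eta> \<in> rays_through adj r i"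
    using ray_eq_below[OF _ \<xi>(1) _ assms(2)] \<xi>(2) by (simp add: rays_through_def)
qed

text \<open>Cylinders form a base: around a common ray, two of them contain the cylinder at the
  deeper of their levels.\<close>

lemma open_contains_rays_through:
  assumes "openin (boundary_topology adj r) U" "\<xi> \<in> U"
  shows "\<exists>i. \<xi> \<in> rays_through adj r i \<and> rays_through adj r i \<subseteq> U"
proof -
  have "generate_topology_on (range (rays_through adj r)) U"
    using assms(1) by (simp add: boundary_topology_def openin_topology_generated_by_iff)
  then show ?thesis using assms(2)
  proof (induction arbitrary: \<xi> rule: generate_topology_on.induct)
    case (Int a b)
    then obtain i k where i: "\<xi> \<in> rays_through adj r i" "rays_through adj r i \<subseteq> a"
      and k: "\<xi> \<in> rays_through adj r k" "rays_through adj r k \<subseteq> b" by blast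
    define n where "n = max (lev i) (lev k)"
    have "\<xi> \<in> rays adj r" using i rays_through_subset by blast
    then have "\<xi> \<in> rays_through adj r (\<xi> n)" by (simp add: rays_through_def ray_lev)
    moreover have "rays_through adj r (\<xi> n) \<subseteq> a \<inter> b"
      using rays_through_nested[OF i(1), of n] rays_through_nested[OF k(1), of n] i(2) k(2) by (auto simp: n_def)
    ultimately show ?case by blast
  next
    case (UN K)
    then show ?case by (meson Sup_upper UnionE order_trans)
  qed blast+
qed

lemma open_subset_rays: "openin (boundary_topology adj r) U \<Longrightarrow> U \<subseteq> rays adj r"
  using open_contains_rays_through rays_through_subset by blast

lemma space_boundary_borel [simp]: "space (boundary_borel adj r) = rays adj r"
  unfolding boundary_borel_def by (rule space_measure_of) (use open_subset_rays in blast)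

text \<open>There are countably many cylinders, so every open set is a countable union of
  them.\<close>

lemma sets_boundary_borel: "sets (boundary_borel adj r) = sigma_sets (rays adj r) (range (rays_through adj r))"
proof -
  have sub: "{A. openin (boundary_topology adj r) A} \<subseteq> Pow (rays adj r)" using open_subset_rays by blast
  have 1: "sets (boundary_borel adj r) = sigma_sets (rays adj r) {A. openin (boundary_topology adj r) A}"
    unfolding boundary_borel_def by (rule sets_measure_of[OF sub])
  have "sigma_sets (rays adj r) {A. openin (boundary_topology adj r) A} = sigma_sets (rays adj r) (range (rays_through adj r))"
  proof (rule sigma_sets_eqI)
    fix U assume "U \<in> {A. openin (boundary_topology adj r) A}"
    then have "U = (\<Union>i\<in>{i. rays_through adj r i \<subseteq> U}. rays_through adj r i)"
      using open_contains_rays_through by fast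
    moreover have "(\<Union>i\<in>{i. rays_through adj r i \<subseteq> U}. rays_through adj r i) \<in> sigma_sets (rays adj r) (range (rays_through adj r))"
      using countable_subset[OF subset_UNIV countable_sites]
      by (intro sigma_sets_UNION) (auto intro: sigma_sets.Basic)
    ultimately show "U \<in> sigma_sets (rays adj r) (range (rays_through adj r))" by simp
  next
    fix U assume "U \<in> range (rays_through adj r)"
    then have "openin (boundary_topology adj r) U"
      unfolding boundary_topology_def by (rule topology_generated_by_Basis)
    then show "U \<in> sigma_sets (rays adj r) {A. openin (boundary_topology adj r) A}"
      by (intro sigma_sets.Basic) simp
  qed
  then show ?thesis by (simp add: 1)
qed

lemma rays_through_sets [measurable]: "rays_through adj r i \<in> sets (boundary_borel adj r)"
  unfolding sets_boundary_borel by (intro sigma_sets.Basic) simp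

lemma rays_through_ray: "\<xi> \<in> rays adj r \<Longrightarrow> {\<eta> \<in> rays adj r. \<eta> n = \<xi> n} = rays_through adj r (\<xi> n)"
  by (simp add: rays_through_def ray_lev)

lemma ray_sphere: "\<xi> \<in> rays adj r \<Longrightarrow> \<xi> n \<in> sphere n"
  by (simp add: sphere_def ray_lev)

lemma coordinate_measurable: "(\<lambda>\<xi>. \<xi> n) \<in> measurable (boundary_borel adj r) (count_space UNIV)"
proof (rule measurableI)
  fix A :: "'v set"
  have "(\<lambda>\<xi>. \<xi> n) -` A \<inter> rays adj r = (\<Union>i\<in>A \<inter> sphere n. rays_through adj r i)"
    using ray_lev by (auto simp: rays_through_def sphere_def)
  then show "(\<lambda>\<xi>. \<xi> n) -` A \<inter> space (boundary_borel adj r) \<in> sets (boundary_borel adj r)"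
    by (auto intro!: sets.finite_UN)
qed simp

end

context tree_weights
begin

lemma sum_increment: "(\<Sum>n\<le>N. \<delta> n) = w N"
  by (induction N) (simp_all add: increment_def)

text \<open>Distinct rays agree on an initial segment of levels, over which the increments telescope
  to \<open>w\<close> at the branching level; on the diagonal all levels count.\<close>

lemma U_boundary_eq:
  assumes \<xi>: "\<xi> \<in> rays adj r" and \<eta>: "\<eta> \<in> rays adj r"
  shows "U_boundary w \<xi> \<eta> = (\<Sum>n. ennreal (\<delta> n) * indicator {\<eta> \<in> rays adj r. \<eta> n = \<xi> n} \<eta>)"
proof -
  have nn: "0 \<le> \<delta> n" for n using increment_pos by (rule less_imp_le)
  have w: "(\<Sum>n\<le>N. ennreal (\<delta> n)) = ennreal (w N)" for N
    using nn by (simp add: sum_ennreal sum_increment)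
  show ?thesis
  proof (cases "\<xi> = \<eta>")
    case True
    have "(\<lambda>n. ennreal (\<delta> n)) sums (\<Sum>n. ennreal (\<delta> n))" by (rule summable_sums) simp
    then have "(\<lambda>N. ennreal (w N)) \<longlonglongrightarrow> (\<Sum>n. ennreal (\<delta> n))"
      unfolding sums_def_le w .
    then have "lim (\<lambda>N. ennreal (w N)) = (\<Sum>n. ennreal (\<delta> n))" by (rule limI)
    then show ?thesis using True \<eta> by (simp add: U_boundary_def)
  next
    case False
    define S where "S = {n. \<xi> n = \<eta> n}"
    obtain m where m: "\<xi> m \<noteq> \<eta> m" using False by blast
    have down: "k \<in> S" if "n \<in> S" "k \<le> n" for k n
      using ray_eq_below[OF \<xi> \<eta>, of n k] that by (simp add: S_def)
    have "S \<subseteq> {..m}" using down[of _ m] m by (fastforce simp: S_def)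
    then have fin: "finite S" by (rule finite_subset) simp
    have "0 \<in> S" using ray_0[OF \<xi>] ray_0[OF \<eta>] by (simp add: S_def)
    then have MS: "Max S \<in> S" using fin by (intro Max_in) auto
    then have S: "S = {..Max S}" using down fin by (auto intro: Max_ge)
    have "(\<Sum>n. ennreal (\<delta> n) * indicator {\<eta> \<in> rays adj r. \<eta> n = \<xi> n} \<eta>) = (\<Sum>n\<in>S. ennreal (\<delta> n))"
      using fin \<eta> by (subst suminf_finite[of S]) (auto simp: S_def indicator_def intro!: sum.cong)
    also have "\<dots> = ennreal (w (Max S))" by (subst S) (rule w)
    finally show ?thesis using False by (simp add: U_boundary_def S_def)
  qed
qed

end

context exit_chain
begin

context
  assumes transient: "0 < measure M exits"
begin

abbreviation \<mu> :: "(nat \<Rightarrow> 'v) measure" where "\<mu> \<equiv> exit_distribution adj r M X"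

abbreviation N :: "'w measure" where "N \<equiv> uniform_measure (restrict_space M exits) exits"

text \<open>A non-measurable set has \<open>measure\<close> 0 by convention, so positive measure
  entails measurability.\<close>

lemma exits_sets [measurable]: "exits \<in> sets M"
  using transient measure_notin_sets[of exits M] by force

lemma prob_exits: "prob exits = escape r"
proof -
  have "prob exits = prob (ends_in r)"
    using exits_subset AE_ends_in_exits by (intro finite_measure_eq_AE) (auto elim!: eventually_mono)
  then show ?thesis by (simp add: prob_ends_in)
qed

lemma escape_root_pos: "0 < escape r"
  using transient prob_exits by simp

lemma sets_restrict_exits: "A \<in> sets (restrict_space M exits) \<longleftrightarrow> A \<subseteq> exits \<and> A \<in> sets M"
  by (rule sets_restrict_space_iff) simp

lemma space_restrict_exits: "space (restrict_space M exits) = exits"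
  using sets.sets_into_space[OF exits_sets] by (simp add: space_restrict_space Int_absorb2)

lemma exit_ray_measurable [measurable]: "exit_ray adj r X \<in> measurable N (boundary_borel adj r)"
proof -
  have "exit_ray adj r X \<in> measurable (restrict_space M exits) (sigma (rays adj r) (range (rays_through adj r)))"
  proof (rule measurable_measure_of)
    show "range (rays_through adj r) \<subseteq> Pow (rays adj r)" using rays_through_subset by auto
    show "exit_ray adj r X \<in> space (restrict_space M exits) \<rightarrow> rays adj r"
      using exit_ray_in_rays by (auto simp: space_restrict_exits)
    fix A assume "A \<in> range (rays_through adj r)"
    then obtain i where "A = rays_through adj r i" by blast
    then have "exit_ray adj r X -` A \<inter> space (restrict_space M exits) = exits \<inter> ends_in i"
      using exit_ray_through by (auto simp: space_restrict_exits)
    then show "exit_ray adj r X -` A \<inter> space (restrict_space M exits) \<in> sets (restrict_space M exits)"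
      by (simp add: sets_restrict_exits)
  qed
  moreover have "sets (sigma (rays adj r) (range (rays_through adj r))) = sets (boundary_borel adj r)"
    unfolding sets_boundary_borel using rays_through_subset by (intro sets_measure_of) auto
  ultimately show ?thesis
    using measurable_cong_sets[of N "restrict_space M exits"] by (simp cong: measurable_cong_sets)
qed

lemma exit_distribution_eq: "\<mu> = distr N (boundary_borel adj r) (exit_ray adj r X)"
  by (simp add: exit_distribution_def Let_def)

lemma sets_exit_distribution [simp]: "sets \<mu> = sets (boundary_borel adj r)"
  and space_exit_distribution [simp]: "space \<mu> = rays adj r"
  by (simp_all add: exit_distribution_eq)

lemma emeasure_exits: "emeasure (restrict_space M exits) exits = ennreal (escape r)"
  by (subst emeasure_restrict_space) (simp_all add: emeasure_eq_measure prob_exits)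

lemma prob_space_exit_distribution: "prob_space \<mu>"
proof -
  have "prob_space N"
    using escape_root_pos by (intro prob_space_uniform_measure) (simp_all add: emeasure_exits)
  then show ?thesis
    unfolding exit_distribution_eq by (rule prob_space.prob_space_distr) (rule exit_ray_measurable)
qed

text \<open>Up to a null set \<open>exits\<close> is \<open>ends_in r\<close>, which contains
  \<open>ends_in i\<close>; conditioning divides by \<open>escape r\<close>.\<close>

lemma emeasure_rays_through: "emeasure \<mu> (rays_through adj r i) = ennreal (escape i / escape r)"
proof -
  have ends: "AE \<omega> in M. \<omega> \<in> exits \<inter> ends_in i \<longleftrightarrow> \<omega> \<in> ends_in i"
    using AE_ends_in_exits
  proof eventually_elim
    case (elim \<omega>)
    have "ends_in i \<subseteq> ends_in r" unfolding ends_in_def by (auto elim!: eventually_mono)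
    then show ?case using elim by blast
  qed
  have "prob (exits \<inter> ends_in i) = prob (ends_in i)"
    by (rule finite_measure_eq_AE[OF ends]) simp_all
  then have p: "prob (exits \<inter> ends_in i) = escape i" by (simp add: prob_ends_in)
  have *: "exit_ray adj r X -` rays_through adj r i \<inter> space N = exits \<inter> ends_in i"
    using exit_ray_through by (auto simp: space_restrict_exits)
  have "emeasure \<mu> (rays_through adj r i) = emeasure N (exits \<inter> ends_in i)"
    unfolding exit_distribution_eq by (subst emeasure_distr) (simp_all add: * del: space_uniform_measure)
  also have "\<dots> = emeasure (restrict_space M exits) (exits \<inter> ends_in i) / ennreal (escape r)"
    by (subst emeasure_uniform_measure) (simp_all add: sets_restrict_exits emeasure_exits)
  also have "emeasure (restrict_space M exits) (exits \<inter> ends_in i) = ennreal (escape i)"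
    by (subst emeasure_restrict_space) (simp_all add: emeasure_eq_measure p)
  also have "ennreal (escape i) / ennreal (escape r) = ennreal (escape i / escape r)"
    using escape_nonneg escape_root_pos by (intro divide_ennreal)
  finally show ?thesis .
qed

lemma measure_rays_through: "measure \<mu> (rays_through adj r i) = escape i / escape r"
  using escape_nonneg escape_root_pos by (simp add: measure_def emeasure_rays_through)

lemma potential_ray_Suc:
  assumes "\<xi> \<in> rays adj r"
  shows "potential (\<xi> n) - potential (\<xi> (Suc n)) = \<delta> (Suc n) * escape (\<xi> (Suc n))"
proof -
  have "\<xi> (Suc n) \<noteq> r" using ray_succ[OF assms] by (auto simp: succs_iff)
  then show ?thesis
    using above_potential[of "\<xi> (Suc n)"] ray_par[OF assms] ray_lev[OF assms] by (simp add: above_def)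
qed

lemma sum_escape_ray:
  assumes "\<xi> \<in> rays adj r"
  shows "(\<Sum>n\<le>m. \<delta> n * escape (\<xi> n)) = w 0 - potential (\<xi> m)"
proof (induction m)
  case 0
  show ?case using above_potential[of r] ray_0[OF assms] by (simp add: above_def)
next
  case (Suc m)
  then show ?case using potential_ray_Suc[OF assms, of m] by simp
qed

lemma nn_integral_potential:
  "(\<integral>\<^sup>+\<xi>. ennreal (potential (\<xi> m)) \<partial>\<mu>) = ennreal ((\<Sum>i\<in>sphere m. potential i * escape i) / escape r)"
proof -
  have eq: "ennreal (potential (\<xi> m)) = (\<Sum>i\<in>sphere m. ennreal (potential i) * indicator (rays_through adj r i) \<xi>)"
    if "\<xi> \<in> rays adj r" for \<xi>
    using that ray_sphere[OF that, of m] finite_sphere[of m]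
    by (subst sum.mono_neutral_right[of _ "{\<xi> m}"]) (auto simp: rays_through_def sphere_def indicator_def)
  have [measurable]: "rays_through adj r i \<in> sets \<mu>" for i
    unfolding sets_exit_distribution by (rule rays_through_sets)
  have "(\<integral>\<^sup>+\<xi>. ennreal (potential (\<xi> m)) \<partial>\<mu>)
      = (\<integral>\<^sup>+\<xi>. (\<Sum>i\<in>sphere m. ennreal (potential i) * indicator (rays_through adj r i) \<xi>) \<partial>\<mu>)"
    by (intro nn_integral_cong eq) simp
  also have "\<dots> = (\<Sum>i\<in>sphere m. ennreal (potential i) * emeasure \<mu> (rays_through adj r i))"
    by (subst nn_integral_sum) (measurable, simp add: nn_integral_cmult_indicator)
  also have "\<dots> = (\<Sum>i\<in>sphere m. ennreal (potential i * (escape i / escape r)))"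
    by (intro sum.cong refl) (simp only: emeasure_rays_through ennreal_mult'[OF potential_nonneg])
  also have "\<dots> = ennreal (\<Sum>i\<in>sphere m. potential i * (escape i / escape r))"
    using potential_nonneg escape_nonneg escape_root_pos
    by (intro sum_ennreal) simp
  finally show ?thesis by (simp add: sum_divide_distrib)
qed

text \<open>The integral of the infimum is at most each normalised sphere sum, and these tend to 0.
  Since the potential does not increase along rays, its infimum is its limit.\<close>

lemma AE_potential_tendsto: "AE \<xi> in \<mu>. (\<lambda>m. potential (\<xi> m)) \<longlonglongrightarrow> 0"
proof -
  have [measurable]: "(\<lambda>\<xi>. ennreal (potential (\<xi> m))) \<in> borel_measurable \<mu>" for m
    using measurable_compose[OF coordinate_measurable[of m], of "\<lambda>i. ennreal (potential i)" borel]
    by (simp cong: measurable_cong_sets)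
  let ?f = "\<lambda>\<xi>. INF m. ennreal (potential (\<xi> m))"
  have "(\<lambda>m. ennreal ((\<Sum>i\<in>sphere m. potential i * escape i) / escape r)) \<longlonglongrightarrow> ennreal (0 / escape r)"
    using escape_root_pos by (intro tendsto_ennrealI tendsto_divide potential_sphere_tendsto tendsto_const) simp
  moreover have "(\<integral>\<^sup>+\<xi>. ?f \<xi> \<partial>\<mu>) \<le> ennreal ((\<Sum>i\<in>sphere m. potential i * escape i) / escape r)" for m
    unfolding nn_integral_potential[symmetric] by (intro nn_integral_mono INF_lower) simp
  ultimately have "(\<integral>\<^sup>+\<xi>. ?f \<xi> \<partial>\<mu>) \<le> ennreal (0 / escape r)"
    by (rule LIMSEQ_le_const[rotated, OF exI, OF allI, OF impI, rotated])
  then have "(\<integral>\<^sup>+\<xi>. ?f \<xi> \<partial>\<mu>) = 0" by simp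
  then have "AE \<xi> in \<mu>. ?f \<xi> = 0"
    by (subst (asm) nn_integral_0_iff_AE) simp_all
  with AE_space show ?thesis
  proof eventually_elim
    case (elim \<xi>)
    then have ray: "\<xi> \<in> rays adj r" by simp
    have "potential (\<xi> (Suc n)) \<le> potential (\<xi> n)" for n
    proof -
      have "0 \<le> \<delta> (Suc n) * escape (\<xi> (Suc n))"
        using increment_pos[of "Suc n"] escape_nonneg[of "\<xi> (Suc n)"] by simp
      then show ?thesis using potential_ray_Suc[OF ray, of n] by linarith
    qed
    then have dec: "potential (\<xi> n) \<le> potential (\<xi> m)" if "m \<le> n" for m n
      using lift_Suc_antimono_le[of "\<lambda>n. potential (\<xi> n)"] that by blast
    show ?case
    proof (rule order_tendstoI)
      fix a :: real assume "a < 0"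
      then show "\<forall>\<^sub>F m in sequentially. a < potential (\<xi> m)"
        using potential_nonneg by (intro always_eventually allI) (rule less_le_trans)
    next
      fix a :: real assume a: "0 < a"
      then have "?f \<xi> < ennreal a" using elim by simp
      then obtain m where "ennreal (potential (\<xi> m)) < ennreal a" by (auto simp: INF_less_iff)
      then have "potential (\<xi> m) < a" using a by (simp add: ennreal_less_iff potential_nonneg)
      then show "\<forall>\<^sub>F m in sequentially. potential (\<xi> m) < a"
        using dec[of m] unfolding eventually_sequentially by (meson le_less_trans)
    qed
  qed
qed

lemma filtered_kernel_exit_distribution:
  "filtered_kernel \<mu> (\<lambda>n \<xi>. \<xi> n) \<delta> (w 0 / escape r)"
proof -
  interpret ps: prob_space \<mu> by (rule prob_space_exit_distribution)
  show ?thesis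
  proof
    show "(\<lambda>\<xi>. \<xi> n) \<in> measurable \<mu> (count_space UNIV)" for n
      unfolding measurable_cong_sets[OF sets_exit_distribution refl] by (rule coordinate_measurable)
    show "finite ((\<lambda>\<xi>. \<xi> n) ` space \<mu>)" for n
      by (rule finite_subset[OF _ finite_sphere[of n]]) (auto simp: ray_sphere)
    show "\<xi> n = \<eta> n" if "\<xi> \<in> space \<mu>" "\<eta> \<in> space \<mu>" "\<xi> (Suc n) = \<eta> (Suc n)" for \<xi> \<eta> n
      using ray_eq_below[of \<xi> \<eta> "Suc n" n] that by simp
    show "0 \<le> \<delta> n" for n using increment_pos by (rule less_imp_le)
    show "AE \<xi> in \<mu>. (\<lambda>n. \<delta> n * measure \<mu> {\<eta> \<in> space \<mu>. \<eta> n = \<xi> n}) sums (w 0 / escape r)"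
      using AE_potential_tendsto AE_space
    proof eventually_elim
      case (elim \<xi>)
      then have ray: "\<xi> \<in> rays adj r" by simp
      have "(\<Sum>n\<le>m. \<delta> n * measure \<mu> {\<eta> \<in> space \<mu>. \<eta> n = \<xi> n}) = (w 0 - potential (\<xi> m)) / escape r" for m
        unfolding sum_escape_ray[OF ray, symmetric]
        by (simp add: rays_through_ray[OF ray] measure_rays_through sum_divide_distrib)
      moreover have "(\<lambda>m. (w 0 - potential (\<xi> m)) / escape r) \<longlonglongrightarrow> (w 0 - 0) / escape r"
        using escape_root_pos by (intro tendsto_divide tendsto_diff tendsto_const elim(1)) simp
      ultimately show ?case by (simp add: sums_def_le)
    qed
  qed
qed

text \<open>The first conjunct, from Schur's test, says that the integral behind
  \<open>W_operator\<close> is a genuine one a.e.\<close>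

lemma exit_operator:
  "(\<forall>f\<in>L2 \<mu>. AE \<eta> in \<mu>. (\<integral>\<^sup>+\<xi>. U_boundary w \<eta> \<xi> * ennreal \<bar>f \<xi>\<bar> \<partial>\<mu>) < \<infinity>) \<and>
    self_adjoint_L2 \<mu> (W_operator w \<mu>) \<and> stochastic_integral_operator \<mu> (W_operator w \<mu>)"
proof -
  interpret K: filtered_kernel \<mu> "\<lambda>n \<xi>. \<xi> n" \<delta> "w 0 / escape r"
    by (rule filtered_kernel_exit_distribution)
  have U: "U_boundary w \<eta> \<xi> = K.kern \<eta> \<xi>" if "\<eta> \<in> space \<mu>" "\<xi> \<in> space \<mu>" for \<xi> \<eta>
    using that U_boundary_eq[of \<eta> \<xi>] by (simp add: K.kern_def K.atom_def)
  have int: "(\<integral>\<^sup>+\<xi>. U_boundary w \<eta> \<xi> * h \<xi> \<partial>\<mu>) = (\<integral>\<^sup>+\<xi>. K.kern \<eta> \<xi> * h \<xi> \<partial>\<mu>)" if "\<eta> \<in> space \<mu>" for \<eta> h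
    by (intro nn_integral_cong) (simp only: U[OF that])
  have W: "W_operator w \<mu> f \<eta> = K.oper f \<eta>" if "\<eta> \<in> space \<mu>" for f \<eta>
    unfolding W_operator_def K.oper_def int[OF that] ..
  have "AE \<eta> in \<mu>. (\<integral>\<^sup>+\<xi>. U_boundary w \<eta> \<xi> * ennreal \<bar>f \<xi>\<bar> \<partial>\<mu>) < \<infinity>" if "f \<in> L2 \<mu>" for f
    using K.bound_finite[OF that] AE_space
  proof eventually_elim
    case (elim \<eta>)
    then show ?case unfolding int[OF elim(2)] by (simp only: K.bound_def)
  qed
  moreover have "self_adjoint_L2 \<mu> (W_operator w \<mu>)"
    using K.self_adjoint_oper W by (rule self_adjoint_L2_cong)
  moreover have "stochastic_integral_operator \<mu> (W_operator w \<mu>)"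
    using K.stochastic_integral_oper W by (rule stochastic_integral_operator_cong)
  ultimately show ?thesis by blast
qed

end

end

theorem proposition3p3:
  fixes adj :: "'v \<Rightarrow> 'v \<Rightarrow> bool" and r :: 'v and w :: "nat \<Rightarrow> real"
    and M :: "'w measure" and X :: "ennreal \<Rightarrow> 'w \<Rightarrow> 'v state option"
    and \<mu> :: "(nat \<Rightarrow> 'v) measure"
  assumes "infinite_rooted_tree adj r"
    and "strict_mono w" and "\<And>n. 0 < w n"
    and "minimal_chain M (Q_absorbed adj r w) (Site r) X"
    and transient: "0 < measure M (boundary_exit adj r M X)"
    and mu: "\<mu> = exit_distribution adj r M X"
  shows "(\<forall>f\<in>L2 \<mu>. AE \<eta> in \<mu>. (\<integral>\<^sup>+\<xi>. U_boundary w \<eta> \<xi> * ennreal \<bar>f \<xi>\<bar> \<partial>\<mu>) < \<infinity>) \<and>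
    self_adjoint_L2 \<mu> (W_operator w \<mu>) \<and>
    stochastic_integral_operator \<mu> (W_operator w \<mu>)"
proof -
  from assms(4) obtain Y H where YH: "prob_space M" "jump_hold_law M (Q_absorbed adj r w) (Site r) Y H"
    "\<And>t \<omega>. \<omega> \<in> space M \<Longrightarrow> X t \<omega> = jump_hold_path Y H t \<omega>"
    unfolding minimal_chain_def by blast
  interpret prob_space M by (rule YH)
  interpret exit_chain adj r w M Y H X
    by unfold_locales (use assms YH in auto)
  show ?thesis unfolding mu by (rule exit_operator[OF transient])
qed

end
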